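(* Fix $h>0$ and let $p,q:\mathbb{R}\to\mathbb{C}$ be $1$-periodic functions with $p,q\in AC_{\rm loc}(\mathbb{R})$ and $p',q'\in L^\infty(\mathbb{R})$. Let $\sigma(\mathfrak{D})\subset\mathbb{C}$ be the $L^2(\mathbb{R})^2$-spectrum of the Dirac operator $\mathfrak{D}$ with potentials $p,q$ and semiclassical parameter $h$. Then $\sigma(\mathfrak{D})\subset\Lambda^h(p,q)$, where $$\Lambda^h(p,q):=\Big\{z\in\mathbb{C}:|\operatorname{Im} z|\le\left(\|p\|_\infty\|q\|_\infty\right)^{1/2}\Big\}\cap\Big\{z\in\mathbb{C}:|\operatorname{Im} z|\,|\operatorname{Re} z|\le C(h)\Big\}$$ and $$C(h):=\frac{h}{2}\left(\|p'\|_\infty+\|q'\|_\infty\right)+\frac14\|\overline{p}\,\overline{q}-pq\|_\infty.$$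
   Context: The Dirac operator is the differential expression $\mathfrak{D}:= ih\sigma_3\partial_x + Q(x)$, $x\in\mathbb{R}$, where $i$ is the imaginary unit, $h>0$ is the semiclassical parameter, $\sigma_3=\begin{pmatrix}1&0\\0&-1\end{pmatrix}$ and $Q(x)=\begin{pmatrix}0&-iq(x)\\ ip(x)&0\end{pmatrix}$. It is realized as the densely and maximally defined closed operator $H\Psi=\mathfrak{D}\Psi$ in $L^2(\mathbb{R})^2=L^2(\mathbb{R};\mathbb{C}^2)$ with domain $\{\Psi\in L^2(\mathbb{R})^2:\Psi\in AC_{\rm loc}(\mathbb{R})^2,\ \mathfrak{D}\Psi\in L^2(\mathbb{R})^2\}$, where $AC_{\rm loc}(\mathbb{R})$ denotes the locally absolutely continuous complex-valued functions. $\sigma(\mathfrak{D})$ denotes the spectrum of this operator. $\|\cdot\|_\infty$ is the $L^\infty(\mathbb{R})$ (essential supremum) norm, and overbar denotes complex conjugation. *)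

theory Defs
  imports "HOL-Analysis.Analysis" "HOL-Probability.Essential_Supremum"
begin

definition absolutely_continuous_on_interval ::
    "real \<Rightarrow> real \<Rightarrow> (real \<Rightarrow> 'a::real_normed_vector) \<Rightarrow> bool" where
  "absolutely_continuous_on_interval a b f \<longleftrightarrow>
    (\<forall>\<epsilon>>0. \<exists>\<delta>>0. \<forall>(n::nat) (u::nat \<Rightarrow> real) (v::nat \<Rightarrow> real).
       (\<forall>k<n. a \<le> u k \<and> u k \<le> v k \<and> v k \<le> b) \<longrightarrow>
       disjoint_family_on (\<lambda>k. {u k<..<v k}) {..<n} \<longrightarrow>
       (\<Sum>k<n. v k - u k) < \<delta> \<longrightarrow>
       (\<Sum>k<n. norm (f (v k) - f (u k))) < \<epsilon>)"

definition AC_loc :: "(real \<Rightarrow> complex) set" where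
  "AC_loc = {f. \<forall>a b. absolutely_continuous_on_interval a b f}"

text \<open>
  Elements of the Lebesgue spaces are represented by Lebesgue measurable functions; functions that
  agree almost everywhere represent the same element, and equations between elements are therefore
  stated almost everywhere.
\<close>

definition Linfty :: "(real \<Rightarrow> complex) set" where
  "Linfty = {f \<in> borel_measurable lebesgue. esssup lebesgue (\<lambda>x. ereal (cmod (f x))) < \<infinity>}"

definition Linfty_norm :: "(real \<Rightarrow> complex) \<Rightarrow> real" where
  "Linfty_norm f = real_of_ereal (esssup lebesgue (\<lambda>x. ereal (cmod (f x))))"

text \<open>The norm on \<^typ>\<open>complex^2\<close> is the Euclidean one.\<close>

definition L2_C2 :: "(real \<Rightarrow> complex^2) set" where
  "L2_C2 = {\<Psi> \<in> borel_measurable lebesgue. integrable lebesgue (\<lambda>x. (norm (\<Psi> x))\<^sup>2)}"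

definition L2_C2_norm :: "(real \<Rightarrow> complex^2) \<Rightarrow> real" where
  "L2_C2_norm \<Psi> = sqrt (LINT x|lebesgue. (norm (\<Psi> x))\<^sup>2)"

definition AE_equal :: "(real \<Rightarrow> complex^2) \<Rightarrow> (real \<Rightarrow> complex^2) \<Rightarrow> bool" where
  "AE_equal \<Phi> \<Psi> \<longleftrightarrow> (AE x in lebesgue. \<Phi> x = \<Psi> x)"

text \<open>
  An operator in \<open>L\<^sup>2(\<real>)\<^sup>2\<close> is given by its domain \<open>D\<close> and its action \<open>T\<close> on \<open>D\<close>.
  The three conditions below say that \<open>T - z\<close> maps \<open>D\<close> onto the whole space, that it is
  injective, and that its inverse is bounded.
\<close>

definition L2_resolvent_set ::
    "(real \<Rightarrow> complex^2) set \<Rightarrow> ((real \<Rightarrow> complex^2) \<Rightarrow> (real \<Rightarrow> complex^2)) \<Rightarrow> complex set" where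
  "L2_resolvent_set D T = {z. let S = (\<lambda>\<Psi> x. T \<Psi> x - z *s \<Psi> x) in
     (\<forall>\<Phi>\<in>L2_C2. \<exists>\<Psi>\<in>D. AE_equal (S \<Psi>) \<Phi>) \<and>
     (\<forall>\<Psi>\<^sub>1\<in>D. \<forall>\<Psi>\<^sub>2\<in>D. AE_equal (S \<Psi>\<^sub>1) (S \<Psi>\<^sub>2) \<longrightarrow> AE_equal \<Psi>\<^sub>1 \<Psi>\<^sub>2) \<and>
     (\<exists>K. \<forall>\<Psi>\<in>D. L2_C2_norm \<Psi> \<le> K * L2_C2_norm (S \<Psi>))}"

definition L2_spectrum ::
    "(real \<Rightarrow> complex^2) set \<Rightarrow> ((real \<Rightarrow> complex^2) \<Rightarrow> (real \<Rightarrow> complex^2)) \<Rightarrow> complex set" where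
  "L2_spectrum D T = - L2_resolvent_set D T"

definition sigma3 :: "complex^2^2" where
  "sigma3 = vector [vector [1, 0], vector [0, -1]]"

definition dirac_potential ::
    "(real \<Rightarrow> complex) \<Rightarrow> (real \<Rightarrow> complex) \<Rightarrow> real \<Rightarrow> complex^2^2" where
  "dirac_potential p q x = vector [vector [0, - \<i> * q x], vector [\<i> * p x, 0]]"

text \<open>
  A locally absolutely continuous function is differentiable almost everywhere; the values of
  \<^const>\<open>vector_derivative\<close> on the exceptional null set are arbitrary and irrelevant.
\<close>

definition dirac_expr ::
    "real \<Rightarrow> (real \<Rightarrow> complex) \<Rightarrow> (real \<Rightarrow> complex) \<Rightarrow> (real \<Rightarrow> complex^2) \<Rightarrow> real \<Rightarrow> complex^2" where
  "dirac_expr h p q \<Psi> x =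
     (\<i> * of_real h) *s (sigma3 *v vector_derivative \<Psi> (at x)) + dirac_potential p q x *v \<Psi> x"

text \<open>
  Each element of the maximal domain is represented by its locally absolutely continuous
  representative, which is unique.
\<close>

definition dirac_domain ::
    "real \<Rightarrow> (real \<Rightarrow> complex) \<Rightarrow> (real \<Rightarrow> complex) \<Rightarrow> (real \<Rightarrow> complex^2) set" where
  "dirac_domain h p q =
     {\<Psi> \<in> L2_C2. (\<forall>j. (\<lambda>x. \<Psi> x $ j) \<in> AC_loc) \<and> dirac_expr h p q \<Psi> \<in> L2_C2}"

definition dirac_spectrum ::
    "real \<Rightarrow> (real \<Rightarrow> complex) \<Rightarrow> (real \<Rightarrow> complex) \<Rightarrow> complex set" where
  "dirac_spectrum h p q = L2_spectrum (dirac_domain h p q) (dirac_expr h p q)"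

definition dirac_C :: "real \<Rightarrow> (real \<Rightarrow> complex) \<Rightarrow> (real \<Rightarrow> complex) \<Rightarrow> real" where
  "dirac_C h p q =
     h / 2 * (Linfty_norm (\<lambda>x. vector_derivative p (at x)) + Linfty_norm (\<lambda>x. vector_derivative q (at x)))
     + 1 / 4 * Linfty_norm (\<lambda>x. cnj (p x) * cnj (q x) - p x * q x)"

definition dirac_Lambda :: "real \<Rightarrow> (real \<Rightarrow> complex) \<Rightarrow> (real \<Rightarrow> complex) \<Rightarrow> complex set" where
  "dirac_Lambda h p q =
     {z. \<bar>Im z\<bar> \<le> sqrt (Linfty_norm p * Linfty_norm q)} \<inter>
     {z. \<bar>Im z\<bar> * \<bar>Re z\<bar> \<le> dirac_C h p q}"

end

theory Submission
  imports Defs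
begin

text \<open>
  Let \<open>H\<close> be the Dirac operator and let \<open>z\<close> lie outside the enclosure region. The equation
  \<open>(H - z) \<Psi> = \<Phi>\<close> is a linear system
  \<open>a' = al * a + be * b + f\<close>, \<open>b' = ga * a + de * b + g\<close> for the components \<open>a\<close>, \<open>b\<close> of \<open>\<Psi>\<close>. The idea is
  to find an indefinite Hermitian form \<open>E\<close>, with bounded coefficients that may depend on \<open>x\<close>, whose
  derivative along solutions of the homogeneous system is at least \<open>c * (\<bar>a\<bar>\<^sup>2 + \<bar>b\<bar>\<^sup>2)\<close> for some \<open>c > 0\<close>.

  If \<open>\<bar>Im z\<bar>\<close> exceeds the bound of the strip, then \<open>\<plusminus> (P * \<bar>a\<bar>\<^sup>2 - Q * \<bar>b\<bar>\<^sup>2)\<close> is such a form, where \<open>P\<close> and \<open>Q\<close>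
  are the sup norms of \<open>p\<close> and \<open>q\<close>, slightly enlarged (\<open>strip_definite\<close>). If \<open>\<bar>Im z\<bar> * \<bar>Re z\<bar> > C(h)\<close>, then
  \<open>\<plusminus> (Im (p * w) + Im (q * cnj w) + Re z * (\<bar>b\<bar>\<^sup>2 - \<bar>a\<bar>\<^sup>2))\<close> with \<open>w = a * cnj b\<close> is one: \<open>h\<close> times its
  derivative is, up to the sign, \<open>h * Im (p' * w + q' * cnj w) + (Im (p * q) - 2 * Re z * Im z) * (\<bar>a\<bar>\<^sup>2 + \<bar>b\<bar>\<^sup>2)\<close>, and
  \<open>C(h)\<close> is large enough to dominate everything but the last product (\<open>hyperbola_energy_identity\<close>,
  \<open>hyperbola_definite\<close>).

  Such a form puts \<open>z\<close> into the resolvent set. With forcing, the derivative of \<open>E\<close> along a solution is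
  still at least \<open>c / 2 * (\<bar>a\<bar>\<^sup>2 + \<bar>b\<bar>\<^sup>2)\<close> minus a multiple of \<open>\<bar>f\<bar>\<^sup>2 + \<bar>g\<bar>\<^sup>2\<close> (\<open>energy_derivative\<close>). Integrated over
  the line, where \<open>E\<close> leaves no boundary terms, this bounds the norm of \<open>\<Psi>\<close> by that of \<open>\<Phi>\<close>, so \<open>H - z\<close> is
  injective with bounded inverse (\<open>resolvent_bound\<close>). For surjectivity, solve the system on \<open>[- n, n]\<close> with
  boundary conditions that make \<open>E\<close> nonpositive at \<open>n\<close> and nonnegative at \<open>- n\<close>. The same estimate
  gives uniqueness, hence existence by linear algebra, and a bound on the solutions independent of \<open>n\<close>;
  a limit of them is the required preimage (\<open>boundary_value_solution\<close>, \<open>resolvent_exists\<close>).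

  Since the domain of \<open>H\<close> consists of locally absolutely continuous functions, integrating these
  inequalities requires that such functions are differentiable almost everywhere
  (\<open>ac_loc_real_AE_differentiable\<close>) and are the integrals of their derivatives
  (\<open>absolutely_continuous_FTC\<close>). Conversely, solving the system with a forcing that is only square
  integrable requires that an indefinite integral has the integrand as its derivative almost everywhere
  (\<open>ac_loc_AE_derivative_if_integral\<close>). The first is proved with Vitali coverings, the second with the gauge
  integral, and the third follows from these two.
\<close>

section \<open>Absolutely continuous functions: the fundamental theorem of calculus\<close>

text \<open>
  This is membership in \<^const>\<open>AC_loc\<close> for values in an arbitrary normed space; the energies
  below are real valued.
\<close>

definition ac_loc :: "(real \<Rightarrow> 'a::real_normed_vector) \<Rightarrow> bool" where
  "ac_loc f \<longleftrightarrow> (\<forall>a b. absolutely_continuous_on_interval a b f)"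

definition nonoverlapping :: "'i set \<Rightarrow> ('i \<Rightarrow> real) \<Rightarrow> ('i \<Rightarrow> real) \<Rightarrow> bool" where
  "nonoverlapping I u v \<longleftrightarrow>
     finite I \<and> (\<forall>i\<in>I. u i \<le> v i) \<and> disjoint_family_on (\<lambda>i. {u i<..<v i}) I"

text \<open>
  Absolute continuity is stated for families indexed by an initial segment of the naturals. The
  families below come as finite sets of intervals or of tagged intervals, so any finite index set
  has to be allowed.
\<close>

lemma absolutely_continuous_finite_family:
  fixes f :: "real \<Rightarrow> 'a::real_normed_vector"
  assumes "absolutely_continuous_on_interval a b f" "e > 0"
  obtains d where "d > 0"
    "\<forall>(I::'i set) u v. nonoverlapping I u v \<longrightarrow> (\<forall>i\<in>I. a \<le> u i \<and> v i \<le> b) \<longrightarrow>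
       (\<Sum>i\<in>I. v i - u i) < d \<longrightarrow> (\<Sum>i\<in>I. norm (f (v i) - f (u i))) < e"
proof -
  obtain d where d: "d > 0" "\<forall>(n::nat) u v. (\<forall>k<n. a \<le> u k \<and> u k \<le> v k \<and> v k \<le> b) \<longrightarrow>
       disjoint_family_on (\<lambda>k. {u k<..<v k}) {..<n} \<longrightarrow>
       (\<Sum>k<n. v k - u k) < d \<longrightarrow> (\<Sum>k<n. norm (f (v k) - f (u k))) < e"
    using assms unfolding absolutely_continuous_on_interval_def by blast
  show ?thesis
  proof (rule that[OF d(1)], intro allI impI)
    fix I :: "'i set" and u v
    assume I: "nonoverlapping I u v" "\<forall>i\<in>I. a \<le> u i \<and> v i \<le> b" "(\<Sum>i\<in>I. v i - u i) < d"
    obtain h where h: "bij_betw h {..<card I} I"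
      using I(1) ex_bij_betw_nat_finite[of I] unfolding nonoverlapping_def
      by (auto simp: atLeast0LessThan)
    have hI: "h k \<in> I" if "k < card I" for k
      using h that by (auto simp: bij_betw_def)
    have inj: "inj_on h {..<card I}"
      using h by (auto simp: bij_betw_def)
    have 1: "\<forall>k<card I. a \<le> (u \<circ> h) k \<and> (u \<circ> h) k \<le> (v \<circ> h) k \<and> (v \<circ> h) k \<le> b"
      using hI I unfolding nonoverlapping_def by auto
    have 2: "disjoint_family_on (\<lambda>k. {(u \<circ> h) k<..<(v \<circ> h) k}) {..<card I}"
      unfolding disjoint_family_on_def
    proof (intro ballI impI)
      fix k l assume kl: "k \<in> {..<card I}" "l \<in> {..<card I}" "k \<noteq> l"
      then have "h k \<noteq> h l" using inj by (auto simp: inj_on_def)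
      then show "{(u \<circ> h) k<..<(v \<circ> h) k} \<inter> {(u \<circ> h) l<..<(v \<circ> h) l} = {}"
        using I(1) hI kl unfolding nonoverlapping_def disjoint_family_on_def by simp
    qed
    have 3: "(\<Sum>k<card I. (v \<circ> h) k - (u \<circ> h) k) = (\<Sum>i\<in>I. v i - u i)"
      using sum.reindex_bij_betw[OF h, of "\<lambda>i. v i - u i"] by simp
    have 4: "(\<Sum>k<card I. norm (f ((v \<circ> h) k) - f ((u \<circ> h) k))) = (\<Sum>i\<in>I. norm (f (v i) - f (u i)))"
      using sum.reindex_bij_betw[OF h, of "\<lambda>i. norm (f (v i) - f (u i))"] by simp
    show "(\<Sum>i\<in>I. norm (f (v i) - f (u i))) < e"
      using d(2)[rule_format, OF 1[rule_format] 2] unfolding 3 4 by (simp add: I(3))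
  qed
qed

lemma nonoverlapping_length_eq:
  assumes "nonoverlapping I u v"
  shows "measure lebesgue (\<Union>i\<in>I. {u i<..<v i}) = (\<Sum>i\<in>I. v i - u i)"
proof -
  have "measure lebesgue (\<Union>i\<in>I. {u i<..<v i}) = (\<Sum>i\<in>I. measure lebesgue {u i<..<v i})"
    using assms unfolding nonoverlapping_def
    by (intro measure_UNION_AE measure_finite_Union) auto
  also have "\<dots> = (\<Sum>i\<in>I. v i - u i)"
    using assms unfolding nonoverlapping_def by (intro sum.cong) auto
  finally show ?thesis .
qed

lemma nonoverlapping_length_le:
  assumes "nonoverlapping I u v" "\<And>i. i \<in> I \<Longrightarrow> {u i<..<v i} \<subseteq> V" "V \<in> lmeasurable"
  shows "(\<Sum>i\<in>I. v i - u i) \<le> measure lebesgue V"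
proof -
  have fin: "finite I" using assms(1) by (simp add: nonoverlapping_def)
  have "measure lebesgue (\<Union>i\<in>I. {u i<..<v i}) \<le> measure lebesgue V"
    using assms(2,3) fin by (intro measure_mono_fmeasurable) auto
  then show ?thesis using nonoverlapping_length_eq[OF assms(1)] by simp
qed

lemma ac_loc_continuous_on:
  fixes f :: "real \<Rightarrow> 'a::real_normed_vector"
  assumes "ac_loc f"
  shows "continuous_on UNIV f"
proof -
  have "isCont f x" for x
    unfolding continuous_at_eps_delta
  proof (intro allI impI)
    fix e :: real assume "e > 0"
    have "absolutely_continuous_on_interval (x - 1) (x + 1) f"
      using assms by (simp add: ac_loc_def)
    then obtain d where d: "d > 0" "\<forall>(I::unit set) u v. nonoverlapping I u v \<longrightarrow>
       (\<forall>i\<in>I. x - 1 \<le> u i \<and> v i \<le> x + 1) \<longrightarrow>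
       (\<Sum>i\<in>I. v i - u i) < d \<longrightarrow> (\<Sum>i\<in>I. norm (f (v i) - f (u i))) < e"
      by (rule absolutely_continuous_finite_family[OF _ \<open>e > 0\<close>]) (rule that)
    show "\<exists>d>0. \<forall>x'. dist x' x < d \<longrightarrow> dist (f x') (f x) < e"
    proof (intro exI[of _ "min d 1"] conjI allI impI)
      show "0 < min d 1" using d by simp
      fix y assume y: "dist y x < min d 1"
      have "(\<Sum>i\<in>{()}. norm (f (max x y) - f (min x y))) < e"
        using y by (intro d(2)[rule_format]) (auto simp: nonoverlapping_def disjoint_family_on_def dist_real_def)
      then show "dist (f y) (f x) < e"
        by (auto simp: dist_norm norm_minus_commute max_def min_def split: if_splits)
    qed
  qed
  then show ?thesis by (simp add: continuous_on_eq_continuous_at)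
qed

text \<open>
  The gauge integral makes this direct. Away from the exceptional set \<open>N\<close> the gauge is dictated by
  differentiability, as for everywhere differentiable functions. Tags in \<open>N\<close> are confined to an
  open set of small measure that contains \<open>N\<close>; there the integrand may be taken to be \<open>0\<close>, and the
  increments of \<open>f\<close> over the corresponding intervals are small by absolute continuity.
\<close>

lemma absolutely_continuous_FTC:
  fixes f :: "real \<Rightarrow> 'a::banach"
  assumes ac: "absolutely_continuous_on_interval a b f" and "a \<le> b" and N: "negligible N"
    and deriv: "\<And>x. x \<in> {a..b} - N \<Longrightarrow> (f has_vector_derivative f' x) (at x)"
  shows "(f' has_integral (f b - f a)) {a..b}"
proof -
  define g where "g x = (if x \<in> N then 0 else f' x)" for x
  have "(g has_integral (f b - f a)) (cbox a b)"
    unfolding has_integral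
  proof (intro allI impI)
    fix e :: real assume "e > 0"
    define \<epsilon> where "\<epsilon> = e / (2 * (b - a + 1))"
    have \<epsilon>: "\<epsilon> > 0" using \<open>e > 0\<close> \<open>a \<le> b\<close> by (simp add: \<epsilon>_def)
    obtain d where d: "d > 0" "\<forall>(I::(real \<times> real set) set) u v. nonoverlapping I u v \<longrightarrow>
       (\<forall>i\<in>I. a \<le> u i \<and> v i \<le> b) \<longrightarrow>
       (\<Sum>i\<in>I. v i - u i) < d \<longrightarrow> (\<Sum>i\<in>I. norm (f (v i) - f (u i))) < e / 2"
      by (rule absolutely_continuous_finite_family[OF ac half_gt_zero[OF \<open>e > 0\<close>]]) (rule that)
    have Nl: "N \<in> sets lebesgue" using N negligible_imp_sets by blast
    obtain V where V: "open V" "N \<subseteq> V" "V - N \<in> lmeasurable" "emeasure lebesgue (V - N) < ennreal d"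
      using sets_lebesgue_outer_open[OF Nl d(1)] by metis
    have N0: "N \<in> lmeasurable" "measure lebesgue N = 0"
      using N negligible_iff_measure by blast+
    have VN: "V = (V - N) \<union> N" using V by auto
    have Vl: "V \<in> lmeasurable"
      using fmeasurable.Un[OF V(3) N0(1)] VN by simp
    have "measure lebesgue V \<le> measure lebesgue (V - N) + measure lebesgue N"
      using measure_Un_le[of "V - N" lebesgue N] V(3) Nl VN by (simp add: fmeasurableD)
    also have "\<dots> < d"
      using V(3,4) d(1) N0 by (simp add: emeasure_eq_measure2 ennreal_less_iff)
    finally have mV: "measure lebesgue V < d" .
    have "\<exists>r>0. \<forall>y. \<bar>y - x\<bar> < r \<longrightarrow> norm (f y - f x - (y - x) *\<^sub>R f' x) \<le> \<epsilon> * \<bar>y - x\<bar>"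
      if "x \<in> {a..b} - N" for x
      using deriv[OF that] \<epsilon> unfolding has_vector_derivative_def has_derivative_at_alt
      by (auto simp: )
    then obtain r where r: "\<And>x. x \<in> {a..b} - N \<Longrightarrow> r x > 0"
      "\<And>x y. x \<in> {a..b} - N \<Longrightarrow> \<bar>y - x\<bar> < r x \<Longrightarrow> norm (f y - f x - (y - x) *\<^sub>R f' x) \<le> \<epsilon> * \<bar>y - x\<bar>"
      by metis
    \<comment> \<open>Tags outside \<open>N\<close> see the differentiability radius, tags in \<open>N\<close> the small open set.\<close>
    define \<gamma> where "\<gamma> x = (if x \<in> N then V else if x \<in> {a..b} then ball x (r x) else UNIV)" for x
    have 1: "gauge \<gamma>" using V r by (auto simp: gauge_def \<gamma>_def)
    have 2: "norm ((\<Sum>(x, k)\<in>p. measure lborel k *\<^sub>R g x) - (f b - f a)) < e"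
      if p: "p tagged_division_of cbox a b" and fine: "\<gamma> fine p" for p
    proof -
      note pD = tagged_division_ofD[OF p]
      have finp: "finite p" by (rule pD)
      have Kab: "Inf K \<le> x \<and> x \<le> Sup K \<and> a \<le> Inf K \<and> Sup K \<le> b \<and>
          measure lborel K = Sup K - Inf K \<and> interior K = {Inf K<..<Sup K} \<and> {Inf K..Sup K} \<subseteq> K"
        if xK: "(x, K) \<in> p" for x K
      proof -
        obtain u v where uv: "K = {u..v}" using pD(4)[OF xK] by auto
        have "x \<in> K" "K \<subseteq> {a..b}" using pD(2,3)[OF xK] by auto
        then show ?thesis using uv by auto
      qed
      have fineK: "K \<subseteq> \<gamma> x" if "(x, K) \<in> p" for x K
        using fine that by (auto simp: fine_def)
      define p0 where "p0 = {(x, K) \<in> p. x \<in> N}"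
      have p0: "p0 \<subseteq> p" by (auto simp: p0_def)
      have no: "nonoverlapping p0 (\<lambda>i. Inf (snd i)) (\<lambda>i. Sup (snd i))"
        unfolding nonoverlapping_def
      proof (intro conjI ballI)
        show "finite p0" using p0 finp finite_subset by blast
        show "Inf (snd i) \<le> Sup (snd i)" if "i \<in> p0" for i
          using Kab[of "fst i" "snd i"] that p0 by auto
        show "disjoint_family_on (\<lambda>i. {Inf (snd i)<..<Sup (snd i)}) p0"
          unfolding disjoint_family_on_def
        proof (intro ballI impI)
          fix i j assume "i \<in> p0" "j \<in> p0" "i \<noteq> j"
          then have "interior (snd i) \<inter> interior (snd j) = {}"
            using pD(5)[of "fst i" "snd i" "fst j" "snd j"] p0 by auto
          moreover have "interior (snd i) = {Inf (snd i)<..<Sup (snd i)}" "interior (snd j) = {Inf (snd j)<..<Sup (snd j)}"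
            using Kab[of "fst i" "snd i"] Kab[of "fst j" "snd j"] \<open>i \<in> p0\<close> \<open>j \<in> p0\<close> p0 by auto
          ultimately show "{Inf (snd i)<..<Sup (snd i)} \<inter> {Inf (snd j)<..<Sup (snd j)} = {}" by simp
        qed
      qed
      have "(\<Sum>i\<in>p0. Sup (snd i) - Inf (snd i)) \<le> measure lebesgue V"
      proof (rule nonoverlapping_length_le[OF no _ Vl])
        fix i assume i: "i \<in> p0"
        then have "(fst i, snd i) \<in> p" "fst i \<in> N" by (auto simp: p0_def)
        then have "snd i \<subseteq> V" using fineK[of "fst i" "snd i"] by (simp add: \<gamma>_def)
        moreover have "{Inf (snd i)..Sup (snd i)} \<subseteq> snd i"
          using Kab[of "fst i" "snd i"] i p0 by auto
        ultimately show "{Inf (snd i)<..<Sup (snd i)} \<subseteq> V"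
          by (meson atLeastAtMost_iff greaterThanLessThan_iff less_imp_le subset_iff)
      qed
      then have "(\<Sum>i\<in>p0. Sup (snd i) - Inf (snd i)) < d" using mV by simp
      then have p0small: "(\<Sum>i\<in>p0. norm (f (Sup (snd i)) - f (Inf (snd i)))) < e / 2"
        using Kab p0 by (intro d(2)[rule_format, OF no]) auto
      have rest: "norm (measure lborel K *\<^sub>R g x - (f (Sup K) - f (Inf K))) \<le> \<epsilon> * measure lborel K"
        if "(x, K) \<in> p - p0" for x K
      proof -
        have xK: "(x, K) \<in> p" "x \<notin> N" using that by (auto simp: p0_def)
        have x: "x \<in> {a..b} - N" using xK Kab[OF xK(1)] by auto
        have "K \<subseteq> ball x (r x)" using fineK[OF xK(1)] xK x by (simp add: \<gamma>_def)
        moreover have "Sup K \<in> K" "Inf K \<in> K" using Kab[OF xK(1)] by auto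
        ultimately have S: "\<bar>Sup K - x\<bar> < r x" "\<bar>Inf K - x\<bar> < r x"
          by (auto simp: dist_real_def abs_minus_commute)
        have c: "measure lborel K = Sup K - Inf K" "g x = f' x"
          using Kab[OF xK(1)] xK by (auto simp: g_def)
        have "measure lborel K *\<^sub>R g x - (f (Sup K) - f (Inf K)) =
            (f (Inf K) - f x - (Inf K - x) *\<^sub>R f' x) - (f (Sup K) - f x - (Sup K - x) *\<^sub>R f' x)"
          unfolding c by (simp add: algebra_simps)
        also have "norm \<dots> \<le> \<epsilon> * \<bar>Inf K - x\<bar> + \<epsilon> * \<bar>Sup K - x\<bar>"
          using norm_triangle_le_diff[OF add_mono[OF r(2)[OF x S(2)] r(2)[OF x S(1)]]] .
        also have "\<dots> = \<epsilon> * measure lborel K" using Kab[OF xK(1)] unfolding c by (simp add: algebra_simps)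
        finally show ?thesis .
      qed
      have tot: "(\<Sum>(x,K)\<in>p. f (Sup K) - f (Inf K)) = f b - f a"
        using additive_tagged_division_1[OF \<open>a \<le> b\<close>, of p f] p by simp
      have "norm ((\<Sum>(x, k)\<in>p. measure lborel k *\<^sub>R g x) - (f b - f a))
          = norm (\<Sum>(x, K)\<in>p. measure lborel K *\<^sub>R g x - (f (Sup K) - f (Inf K)))"
        unfolding tot[symmetric] by (simp add: sum_subtractf split_def)
      also have "\<dots> = norm ((\<Sum>(x, K)\<in>p0. measure lborel K *\<^sub>R g x - (f (Sup K) - f (Inf K)))
           + (\<Sum>(x, K)\<in>p - p0. measure lborel K *\<^sub>R g x - (f (Sup K) - f (Inf K))))"
        by (subst sum.subset_diff[OF p0 finp]) (simp add: add.commute)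
      also have "\<dots> \<le> (\<Sum>(x, K)\<in>p0. norm (f (Sup K) - f (Inf K))) + (\<Sum>(x, K)\<in>p - p0. \<epsilon> * measure lborel K)"
      proof (intro norm_triangle_mono sum_norm_le)
        show "norm (case i of (x, K) \<Rightarrow> measure lborel K *\<^sub>R g x - (f (Sup K) - f (Inf K)))
            \<le> (case i of (x, K) \<Rightarrow> norm (f (Sup K) - f (Inf K)))" if "i \<in> p0" for i
          using that by (auto simp: p0_def g_def norm_minus_commute)
        show "norm (case i of (x, K) \<Rightarrow> measure lborel K *\<^sub>R g x - (f (Sup K) - f (Inf K)))
            \<le> (case i of (x, K) \<Rightarrow> \<epsilon> * measure lborel K)" if "i \<in> p - p0" for i
          using rest[of "fst i" "snd i"] that by (simp add: split_def)
      qed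
      also have "(\<Sum>(x, K)\<in>p - p0. \<epsilon> * measure lborel K) \<le> (\<Sum>(x, K)\<in>p. \<epsilon> * measure lborel K)"
        using finp \<epsilon> by (intro sum_mono2) auto
      also have "(\<Sum>(x, K)\<in>p. \<epsilon> * measure lborel K) = \<epsilon> * (b - a)"
        using additive_content_tagged_division[OF p] \<open>a \<le> b\<close>
        by (simp add: sum_distrib_left[symmetric] split_def)
      also have "\<epsilon> * (b - a) < e / 2" using \<open>e > 0\<close> \<open>a \<le> b\<close> by (simp add: \<epsilon>_def field_simps)
      finally show ?thesis using p0small by (simp add: split_def)
    qed
    show "\<exists>\<gamma>. gauge \<gamma> \<and> (\<forall>\<D>. \<D> tagged_division_of cbox a b \<and> \<gamma> fine \<D> \<longrightarrow>
         norm ((\<Sum>(x, k)\<in>\<D>. measure lborel k *\<^sub>R g x) - (f b - f a)) < e)"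
      by (intro exI[of _ \<gamma>] conjI allI impI, fact 1, elim conjE, rule 2)
  qed
  then have "(f' has_integral (f b - f a)) (cbox a b)"
    by (rule has_integral_spike[OF N, rotated]) (auto simp: g_def)
  then show ?thesis by simp
qed

section \<open>Vitali coverings by intervals\<close>

text \<open>
  A form of the Vitali covering theorem suited to increments: a property \<open>P\<close> that holds for
  arbitrarily short intervals around each point of \<open>E\<close> holds on finitely many disjoint intervals that
  exhaust \<open>E\<close> up to measure \<open>e\<close>. Discarding the end points keeps the union open, so that the
  lemma can be applied a second time inside it.
\<close>

lemma Vitali_finite_intervals:
  fixes E T :: "real set" and P :: "real \<Rightarrow> real \<Rightarrow> bool"
  assumes E: "E \<in> lmeasurable" "E \<subseteq> T" and T: "open T"
    and P: "\<And>x d. x \<in> E \<Longrightarrow> d > 0 \<Longrightarrow> \<exists>u v. u < x \<and> x < v \<and> v - u < d \<and> P u v"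
    and e: "e > 0"
  obtains D :: "(real \<times> real) set" where "nonoverlapping D fst snd"
    "\<forall>(u, v)\<in>D. u < v \<and> P u v \<and> {u..v} \<subseteq> T"
    "measure lebesgue (E - (\<Union>i\<in>D. {fst i<..<snd i})) < e"
proof -
  define K where "K = {(u, v). u < v \<and> P u v \<and> {u..v} \<subseteq> T}"
  define a where "a i = (fst i + snd i) / 2" for i :: "real \<times> real"
  define r where "r i = (snd i - fst i) / 2" for i :: "real \<times> real"
  have cb: "cball (a i) (r i) = {fst i..snd i}" for i
    by (auto simp: a_def r_def cball_eq_atLeastAtMost field_simps)
  have 2: "\<exists>i. i \<in> K \<and> x \<in> cball (a i) (r i) \<and> r i < d" if x: "x \<in> E" and d: "0 < d" for x d
  proof -
    obtain t where t: "t > 0" "cball x t \<subseteq> T"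
      using T E(2) x open_contains_cball by blast
    obtain u v where uv: "u < x" "x < v" "v - u < min t (2 * d)" "P u v"
      using P[OF x, of "min t (2 * d)"] t d by auto
    have "{u..v} \<subseteq> cball x t" using uv by (auto simp: dist_real_def)
    then have "(u, v) \<in> K" using uv t by (auto simp: K_def)
    moreover have "x \<in> cball (a (u, v)) (r (u, v))" unfolding cb using uv by simp
    moreover have "r (u, v) < d" using uv by (simp add: r_def)
    ultimately show ?thesis by blast
  qed
  have 1: "0 < r i" if "i \<in> K" for i using that by (auto simp: K_def r_def)
  obtain C where C: "countable C" "C \<subseteq> K"
     "pairwise (\<lambda>i j. disjnt (cball (a i) (r i)) (cball (a j) (r j))) C"
     "negligible (E - (\<Union>i\<in>C. cball (a i) (r i)))"
    by (rule Vitali_covering_theorem_cballs[of K r E a, OF 1 2]; (assumption | rule that))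
  define U where "U D = (\<Union>i\<in>D. {fst i<..<snd i})" for D :: "(real \<times> real) set"
  have no: "nonoverlapping D fst snd" if "finite D" "D \<subseteq> C" for D
    unfolding nonoverlapping_def disjoint_family_on_def
  proof (intro conjI ballI impI)
    show "fst i \<le> snd i" if "i \<in> D" for i
      using that \<open>D \<subseteq> C\<close> C(2) by (auto simp: K_def)
    fix i j assume "i \<in> D" "j \<in> D" "i \<noteq> j"
    then have "disjnt {fst i..snd i} {fst j..snd j}"
      using C(3) \<open>D \<subseteq> C\<close> unfolding pairwise_def cb by blast
    then have "disjnt {fst i<..<snd i} {fst j<..<snd j}"
      by (rule disjnt_subset1[OF disjnt_subset2]) auto
    then show "{fst i<..<snd i} \<inter> {fst j<..<snd j} = {}"
      by (simp add: disjnt_def)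
  qed (use that in auto)
  have neg: "negligible (E - U C)"
  proof (rule negligible_subset)
    show "negligible ((E - (\<Union>i\<in>C. cball (a i) (r i))) \<union> (fst ` C \<union> snd ` C))"
      using C(4) C(1)[THEN countable_image, THEN countable_imp_null_set_lborel, THEN null_sets_completionI]
      by (intro negligible_Un) (simp_all add: negligible_iff_null_sets)
    show "E - U C \<subseteq> (E - (\<Union>i\<in>C. cball (a i) (r i))) \<union> (fst ` C \<union> snd ` C)"
      unfolding cb U_def by (force simp: less_le)
  qed
  have "\<exists>D. finite D \<and> D \<subseteq> C \<and> measure lebesgue (E - U D) < e"
  proof (cases "C = {}")
    case True
    then show ?thesis using neg e by (auto simp: U_def negligible_imp_measure0)
  next
    case False
    define D where "D n = from_nat_into C ` {..n::nat}" for n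
    have UD: "U C = (\<Union>n. U (D n))"
    proof
      show "U C \<subseteq> (\<Union>n. U (D n))"
      proof
        fix x assume "x \<in> U C"
        then obtain i where i: "i \<in> C" "x \<in> {fst i<..<snd i}" by (auto simp: U_def)
        then have "i \<in> D (to_nat_on C i)"
          using C(1) unfolding D_def by (metis atMost_iff from_nat_into_to_nat_on image_eqI order_refl)
        then show "x \<in> (\<Union>n. U (D n))" using i by (auto simp: U_def)
      qed
      show "(\<Union>n. U (D n)) \<subseteq> U C"
        using from_nat_into[OF False] by (auto simp: U_def D_def)
    qed
    have meas: "E - U (D n) \<in> lmeasurable" for n
      using E(1) by (intro fmeasurable_Diff) (auto simp: U_def D_def)
    have "decseq (\<lambda>n. E - U (D n))"
      by (force simp: decseq_def U_def D_def)
    then have "(\<lambda>n. measure lebesgue (E - U (D n))) \<longlonglongrightarrow> measure lebesgue (\<Inter>n. E - U (D n))"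
      using fmeasurableD[OF meas] fmeasurableD2[OF meas] by (intro Lim_measure_decseq) (auto simp del: emeasure_completion)
    moreover have "(\<Inter>n. E - U (D n)) = E - U C" using UD by auto
    ultimately have "(\<lambda>n. measure lebesgue (E - U (D n))) \<longlonglongrightarrow> 0"
      using neg by (simp add: negligible_imp_measure0)
    then have "\<forall>\<^sub>F n in sequentially. measure lebesgue (E - U (D n)) < e"
      using e order_tendstoD(2) by blast
    then obtain n where "measure lebesgue (E - U (D n)) < e"
      using eventually_sequentially by auto
    moreover have "finite (D n)" "D n \<subseteq> C"
      using from_nat_into[OF False] by (auto simp: D_def)
    ultimately show ?thesis by blast
  qed
  then obtain D where D: "finite D" "D \<subseteq> C" "measure lebesgue (E - U D) < e" by blast
  show ?thesis
    using that[OF no[OF D(1,2)]] D C(2) by (force simp: K_def U_def)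
qed

text \<open>
  Completing both divisions of \<open>S\<close> by the same complementary intervals to divisions of a single interval
  reduces the claim to additivity over that interval.
\<close>

lemma sum_over_divisions_eq:
  fixes g :: "real set \<Rightarrow> real"
  assumes g: "operative_real (+) 0 g"
    and p: "p division_of S" and q: "q division_of S"
  shows "sum g p = sum g q"
proof -
  interpret g: operative_real "(+)" 0 g
    rewrites "comm_monoid_set.F (+) 0 = sum"
    by (rule g) (auto simp add: sum_def)
  obtain a b where ab: "S \<subseteq> cbox a b"
    using elementary_subset_cbox[OF p] by auto
  obtain r where r: "p \<subseteq> r" "r division_of cbox a b"
    using partial_division_extend_interval[of p a b] p ab division_ofD(6)[OF p] by metis
  have c: "(r - p) division_of \<Union>(r - p)"
    by (rule division_of_subset[of r]) (use r(2) in \<open>simp_all add: division_ofD(6)[OF r(2)]\<close>)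
  have disj: "interior S \<inter> interior (\<Union>(r - p)) = {}"
  proof (rule Int_interior_Union_intervals)
    show "finite (r - p)" using r(2) by auto
    show "open (interior S)" by simp
    show "\<exists>a b. t = cbox a b" if "t \<in> r - p" for t
      using that r(2) by blast
    fix t assume t: "t \<in> r - p"
    have "interior t \<inter> interior (\<Union>p) = {}"
    proof (rule Int_interior_Union_intervals)
      show "finite p" using p by auto
      show "\<exists>a b. t = cbox a b" if "t \<in> p" for t
        using that p by blast
      show "interior t \<inter> interior k = {}" if "k \<in> p" for k
        using that t r division_ofD(5)[OF r(2)] by blast
    qed simp
    then show "interior S \<inter> interior t = {}"
      using division_ofD(6)[OF p] by blast
  qed
  have *: "sum g s + sum g (r - p) = g {a..b}" if s: "s division_of S" for s
  proof -
    have u: "(s \<union> (r - p)) division_of (S \<union> \<Union>(r - p))"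
      using division_disjoint_union[OF s c disj] .
    have "S \<union> \<Union>(r - p) = \<Union>p \<union> \<Union>(r - p)" using division_ofD(6)[OF p] by simp
    also have "\<dots> = \<Union>r" using r(1) by blast
    also have "\<dots> = cbox a b" using division_ofD(6)[OF r(2)] .
    finally have "sum g (s \<union> (r - p)) = g {a..b}"
      using g.division[of "s \<union> (r - p)" a b] u by simp
    moreover have "sum g (s \<union> (r - p)) = sum g s + sum g (r - p)"
    proof (rule sum.union_inter_neutral)
      show "finite s" "finite (r - p)" using s r(2) by auto
      show "\<forall>x\<in>s \<inter> (r - p). g x = 0"
      proof
        fix x assume x: "x \<in> s \<inter> (r - p)"
        then have "interior x \<subseteq> interior S" "interior x \<subseteq> interior (\<Union>(r - p))"
          using s by (auto intro!: interior_mono)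
        then have "interior x = {}" using disj by blast
        moreover obtain u v where "x = cbox u v" using s x by blast
        ultimately show "g x = 0"
          using g.neutral by auto
      qed
    qed
    ultimately show ?thesis by simp
  qed
  show ?thesis using *[OF p] *[OF q] by simp
qed

lemma operative_real_increment:
  fixes f :: "real \<Rightarrow> real"
  shows "operative_real (+) 0 (\<lambda>K. if K = {} then 0 else f (Sup K) - f (Inf K))"
  by standard auto

lemma operative_real_length: "operative_real (+) (0::real) (\<lambda>K. measure lborel K)"
  by standard auto

lemma nonoverlapping_division:
  assumes "nonoverlapping D fst snd" "\<forall>(u, v)\<in>D. u < v"
  shows "(\<lambda>(u, v). {u..v::real}) ` D division_of (\<Union>(u, v)\<in>D. {u..v})"
    "inj_on (\<lambda>(u, v). {u..v::real}) D"
proof -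
  show "inj_on (\<lambda>(u, v). {u..v::real}) D"
    using assms(2) by (auto simp: inj_on_def Icc_eq_Icc)
  show "(\<lambda>(u, v). {u..v::real}) ` D division_of (\<Union>(u, v)\<in>D. {u..v})"
  proof (rule division_ofI)
    show "finite ((\<lambda>(u, v). {u..v}) ` D)" using assms(1) by (simp add: nonoverlapping_def)
    fix K assume K: "K \<in> (\<lambda>(u, v). {u..v}) ` D"
    then show "K \<subseteq> (\<Union>(u, v)\<in>D. {u..v})" "\<exists>a b. K = cbox a b" by auto
    show "K \<noteq> {}" using K assms(2) by force
    fix L assume L: "L \<in> (\<lambda>(u, v). {u..v}) ` D" "K \<noteq> L"
    obtain i where i: "i \<in> D" "K = {fst i..snd i}" using K by (auto simp: split_def)
    obtain j where j: "j \<in> D" "L = {fst j..snd j}" using L by (auto simp: split_def)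
    note ij = i j
    then have "i \<noteq> j" using L by auto
    then have "{fst i<..<snd i} \<inter> {fst j<..<snd j} = {}"
      using assms(1) ij unfolding nonoverlapping_def disjoint_family_on_def by blast
    then show "interior K \<inter> interior L = {}" using ij by simp
  qed auto
qed


text \<open>
  Cover \<open>E\<close> by intervals
  \<open>D1\<close> on which the mean slope is at least \<open>s\<close>, and then, inside them, by intervals \<open>D2\<close> on which
  it is at most \<open>r\<close>. Both families have total length close to the measure of \<open>E\<close>, so what \<open>D1\<close> has
  beyond \<open>D2\<close> is short and contributes little increment, by absolute continuity. The increments over
  \<open>D1\<close> are thus both at least about \<open>s\<close> and at most about \<open>r\<close> times the measure of \<open>E\<close>.
\<close>

lemma derivates_separated_negligible:
  fixes f :: "real \<Rightarrow> real"
  assumes ac: "absolutely_continuous_on_interval a b f"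
    and E: "E \<in> sets lebesgue" "E \<subseteq> {a<..<b}" and "r < s"
    and up: "\<And>x d. x \<in> E \<Longrightarrow> d > 0 \<Longrightarrow> \<exists>u v. u < x \<and> x < v \<and> v - u < d \<and> f v - f u \<ge> s * (v - u)"
    and lo: "\<And>x d. x \<in> E \<Longrightarrow> d > 0 \<Longrightarrow> \<exists>u v. u < x \<and> x < v \<and> v - u < d \<and> f v - f u \<le> r * (v - u)"
  shows "negligible E"
proof -
  have El: "E \<in> lmeasurable"
    using E by (intro bounded_set_imp_lmeasurable bounded_subset[OF _ E(2)]) auto
  define \<mu> where "\<mu> = measure lebesgue E"
  have "\<not> \<mu> > 0"
  proof
    assume \<mu>: "\<mu> > 0"
    define \<eta> where "\<eta> = (s - r) * \<mu> / 8"
    have \<eta>: "\<eta> > 0" using \<mu> \<open>r < s\<close> by (simp add: \<eta>_def)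
    obtain \<delta> where \<delta>: "\<delta> > 0" "\<forall>(I::real set set) u v. nonoverlapping I u v \<longrightarrow>
       (\<forall>i\<in>I. a \<le> u i \<and> v i \<le> b) \<longrightarrow>
       (\<Sum>i\<in>I. v i - u i) < \<delta> \<longrightarrow> (\<Sum>i\<in>I. norm (f (v i) - f (u i))) < \<eta>"
      by (rule absolutely_continuous_finite_family[OF ac \<eta>]) (rule that)
    \<comment> \<open>Small enough that both the leftover length and its effect on the slope \<open>s\<close> stay below \<open>\<delta>\<close> and \<open>\<eta>\<close>.\<close>
    define \<epsilon> where "\<epsilon> = min (\<mu> / 4) (min (\<delta> / 4) (\<eta> / (3 * (\<bar>s\<bar> + 1))))"
    have \<epsilon>: "\<epsilon> > 0" "\<epsilon> \<le> \<mu> / 4" "3 * \<epsilon> < \<delta>" "\<bar>s\<bar> * (3 * \<epsilon>) \<le> \<eta>"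
    proof -
      show "\<epsilon> > 0" using \<mu> \<delta> \<eta> by (simp add: \<epsilon>_def)
      show "\<epsilon> \<le> \<mu> / 4" unfolding \<epsilon>_def by (rule min.cobounded1)
      have "\<epsilon> \<le> \<delta> / 4" unfolding \<epsilon>_def by (rule order_trans[OF min.cobounded2 min.cobounded1])
      then show "3 * \<epsilon> < \<delta>" using \<delta>(1) by linarith
      have "\<epsilon> \<le> \<eta> / (3 * (\<bar>s\<bar> + 1))"
        unfolding \<epsilon>_def by (rule order_trans[OF min.cobounded2 min.cobounded2])
      then have "3 * \<epsilon> * (\<bar>s\<bar> + 1) \<le> \<eta>" by (simp add: field_simps)
      then show "\<bar>s\<bar> * (3 * \<epsilon>) \<le> \<eta>" using \<open>\<epsilon> > 0\<close> by (simp add: field_simps)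
    qed
    obtain T0 where T0: "open T0" "E \<subseteq> T0" "T0 - E \<in> lmeasurable" "emeasure lebesgue (T0 - E) < ennreal \<epsilon>"
      using sets_lebesgue_outer_open[OF E(1) \<epsilon>(1)] by blast
    define T where "T = T0 \<inter> {a<..<b}"
    have "open T" "E \<subseteq> T" "T \<subseteq> {a<..<b}"
      using T0(1,2) E(2) by (auto simp: T_def)
    moreover have "bounded T" using bounded_subset[OF _ \<open>T \<subseteq> {a<..<b}\<close>] by simp
    ultimately have T: "open T" "E \<subseteq> T" "T \<in> lmeasurable" "T \<subseteq> {a<..<b}"
      using lmeasurable_open by auto
    have "measure lebesgue (T0 - E) < \<epsilon>"
      using T0(3,4) \<epsilon>(1) by (simp add: emeasure_eq_measure2 ennreal_less_iff)
    moreover have "measure lebesgue (T - E) \<le> measure lebesgue (T0 - E)"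
      using T0(3) T El by (intro measure_mono_fmeasurable) (auto simp: T_def)
    moreover have "measure lebesgue (T - E) = measure lebesgue T - \<mu>"
      using T El by (simp add: \<mu>_def measurable_measure_Diff fmeasurableD)
    ultimately have mT: "measure lebesgue T < \<mu> + \<epsilon>" by simp
    obtain D1 where D1: "nonoverlapping D1 fst snd"
      "\<forall>(u, v)\<in>D1. u < v \<and> f v - f u \<ge> s * (v - u) \<and> {u..v} \<subseteq> T"
      "measure lebesgue (E - (\<Union>i\<in>D1. {fst i<..<snd i})) < \<epsilon>"
      by (rule Vitali_finite_intervals[OF El T(2,1) up \<epsilon>(1)]; (assumption | rule that))
    define T1 where "T1 = (\<Union>i\<in>D1. {fst i<..<snd i})"
    have finD1: "finite D1" using D1(1) by (simp add: nonoverlapping_def)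
    have T1: "open T1" "T1 \<in> lmeasurable" unfolding T1_def using finD1 by auto
    have E1: "E \<inter> T1 \<in> lmeasurable" using El T1 by (intro fmeasurable.Int) auto
    have lo1: "\<exists>u v. u < x \<and> x < v \<and> v - u < d \<and> f v - f u \<le> r * (v - u)" if "x \<in> E \<inter> T1" "d > 0" for x d
      using lo that by blast
    obtain D2 where D2: "nonoverlapping D2 fst snd"
      "\<forall>(u, v)\<in>D2. u < v \<and> f v - f u \<le> r * (v - u) \<and> {u..v} \<subseteq> T1"
      "measure lebesgue ((E \<inter> T1) - (\<Union>i\<in>D2. {fst i<..<snd i})) < \<epsilon>"
      by (rule Vitali_finite_intervals[OF E1 Int_lower2 T1(1) lo1 \<epsilon>(1)]; (assumption | rule that))
    define T2 where "T2 = (\<Union>i\<in>D2. {fst i<..<snd i})"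
    have finD2: "finite D2" using D2(1) by (simp add: nonoverlapping_def)
    have T2: "T2 \<in> lmeasurable" unfolding T2_def using finD2 by auto
    have T21: "T2 \<subseteq> T1" using D2(2) by (fastforce simp: T2_def subset_iff)
    have T1T: "T1 \<subseteq> T" using D1(2) by (fastforce simp: T1_def subset_iff)
    have "\<mu> \<le> measure lebesgue ((E - T1) \<union> ((E \<inter> T1 - T2) \<union> T2))"
      unfolding \<mu>_def using El T1 T2 E1
      by (intro measure_mono_fmeasurable fmeasurable.Un fmeasurable.Diff) (auto dest: fmeasurableD)
    also have "\<dots> \<le> measure lebesgue (E - T1) + (measure lebesgue (E \<inter> T1 - T2) + measure lebesgue T2)"
      using El T1 T2 E1 
      by (intro order_trans[OF measure_Un_le] add_left_mono measure_Un_le) (auto dest!: fmeasurableD)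
    finally have m2: "measure lebesgue T2 \<ge> \<mu> - 2 * \<epsilon>"
      using D1(3) D2(3) unfolding T1_def T2_def by linarith
    have m1: "measure lebesgue T1 < \<mu> + \<epsilon>"
      using mT measure_mono_fmeasurable[OF T1T fmeasurableD[OF T1(2)] T(3)] by simp
    have m21: "measure lebesgue T2 \<le> measure lebesgue T1"
      using measure_mono_fmeasurable[OF T21 fmeasurableD[OF T2] T1(2)] .
    define I where "I = (\<lambda>(u, v). {u..v::real})"
    have d1: "I ` D1 division_of (\<Union>(u, v)\<in>D1. {u..v})" "inj_on I D1"
      and d2: "I ` D2 division_of (\<Union>(u, v)\<in>D2. {u..v})" "inj_on I D2"
      unfolding I_def using D1 D2 by (auto intro!: nonoverlapping_division)
    have sub: "(\<Union>(u, v)\<in>D2. {u..v}) \<subseteq> (\<Union>(u, v)\<in>D1. {u..v})"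
    proof
      fix x assume "x \<in> (\<Union>(u, v)\<in>D2. {u..v})"
      then have "x \<in> T1" using D2(2) by blast
      then show "x \<in> (\<Union>(u, v)\<in>D1. {u..v})" 
        unfolding T1_def by (auto simp: split_def intro!: bexI)
    qed
    \<comment> \<open>\<open>R\<close> consists of \<open>D2\<close> and the gaps that \<open>D2\<close> leaves inside \<open>D1\<close>.\<close>
    obtain R where R: "I ` D2 \<subseteq> R" "R division_of (\<Union>(u, v)\<in>D1. {u..v})"
      using partial_division_extend[OF d2(1) d1(1) sub] by blast
    have finR: "finite R" using R(2) by auto
    define g where "g K = (if K = {} then 0 else f (Sup K) - f (Inf K))" for K
    have sg: "sum g R = sum g (I ` D1)"
      unfolding g_def by (rule sum_over_divisions_eq[OF operative_real_increment R(2) d1(1)])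
    have sl: "sum (measure lborel) R = sum (measure lborel) (I ` D1)"
      by (rule sum_over_divisions_eq[OF operative_real_length R(2) d1(1)])
    have gI: "g (I i) = f (snd i) - f (fst i)" "measure lborel (I i) = snd i - fst i" if "fst i < snd i" for i
      using that by (auto simp: g_def I_def split_def)
    have D12: "fst i < snd i" if "i \<in> D1 \<union> D2" for i using that D1(2) D2(2) by auto
    have g1: "sum g (I ` D1) \<ge> s * measure lebesgue T1"
    proof -
      have "s * measure lebesgue T1 = (\<Sum>i\<in>D1. s * (snd i - fst i))"
        unfolding T1_def nonoverlapping_length_eq[OF D1(1)] by (simp add: sum_distrib_left)
      also have "\<dots> \<le> (\<Sum>i\<in>D1. g (I i))"
        using D1(2) D12 gI by (intro sum_mono) auto
      finally show ?thesis using d1(2) by (simp add: sum.reindex)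
    qed
    have g2: "sum g (I ` D2) \<le> r * measure lebesgue T2"
    proof -
      have "(\<Sum>i\<in>D2. g (I i)) \<le> (\<Sum>i\<in>D2. r * (snd i - fst i))"
        using D2(2) D12 gI by (intro sum_mono) auto
      also have "\<dots> = r * measure lebesgue T2"
        unfolding T2_def nonoverlapping_length_eq[OF D2(1)] by (simp add: sum_distrib_left)
      finally show ?thesis using d2(2) by (simp add: sum.reindex)
    qed
    have l1: "sum (measure lborel) (I ` D1) = measure lebesgue T1"
      unfolding T1_def nonoverlapping_length_eq[OF D1(1)] using d1(2) D12 gI by (simp add: sum.reindex)
    have l2: "sum (measure lborel) (I ` D2) = measure lebesgue T2"
      unfolding T2_def nonoverlapping_length_eq[OF D2(1)] using d2(2) D12 gI by (simp add: sum.reindex)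
    have K: "K \<noteq> {}" "Inf K \<le> Sup K" "a \<le> Inf K" "Sup K \<le> b" "measure lborel K = Sup K - Inf K"
      "{Inf K<..<Sup K} = interior K" if K: "K \<in> R" for K
    proof -
      have "K \<noteq> {}" "\<exists>u v. K = cbox u v" "K \<subseteq> (\<Union>(u, v)\<in>D1. {u..v})"
        using R(2) K by blast+
      then obtain u v where uv: "K = {u..v}" "u \<le> v" by auto
      have "(\<Union>(u, v)\<in>D1. {u..v}) \<subseteq> {a<..<b}" using D1(2) T(4) by blast
      then have "{u..v} \<subseteq> {a<..<b}" using uv \<open>K \<subseteq> (\<Union>(u, v)\<in>D1. {u..v})\<close> by blast
      then show "K \<noteq> {}" "Inf K \<le> Sup K" "a \<le> Inf K" "Sup K \<le> b" "measure lborel K = Sup K - Inf K"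
        "{Inf K<..<Sup K} = interior K"
        using uv by auto
    qed
    have no: "nonoverlapping (R - I ` D2) Inf Sup"
      unfolding nonoverlapping_def disjoint_family_on_def
      using K division_ofD(5)[OF R(2)] finR by auto
    have "(\<Sum>K\<in>R - I ` D2. Sup K - Inf K) = sum (measure lborel) (R - I ` D2)"
      using K by (intro sum.cong) auto
    also have "\<dots> = sum (measure lborel) R - sum (measure lborel) (I ` D2)"
      using R(1) finR by (simp add: sum_diff)
    also have "\<dots> < \<delta>" unfolding sl l1 l2 using m1 m2 \<epsilon>(3) by linarith
    finally have "(\<Sum>K\<in>R - I ` D2. norm (f (Sup K) - f (Inf K))) < \<eta>"
      using K by (intro \<delta>(2)[rule_format, OF no]) auto
    moreover have "sum g (R - I ` D2) \<le> (\<Sum>K\<in>R - I ` D2. norm (f (Sup K) - f (Inf K)))"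
      using K by (intro sum_mono) (auto simp: g_def)
    moreover have "sum g (R - I ` D2) = sum g R - sum g (I ` D2)"
      using R(1) finR by (simp add: sum_diff)
    ultimately have main: "s * measure lebesgue T1 - r * measure lebesgue T2 < \<eta>"
      using sg g1 g2 by linarith
    have "\<bar>s * (measure lebesgue T1 - measure lebesgue T2)\<bar> \<le> \<bar>s\<bar> * (3 * \<epsilon>)"
      unfolding abs_mult using m1 m2 m21 by (intro mult_left_mono) auto
    moreover have "(s - r) * measure lebesgue T2 \<ge> (s - r) * (\<mu> / 2)"
      using m2 \<epsilon>(2) \<open>r < s\<close> by (intro mult_left_mono) auto
    moreover have "(s - r) * (\<mu> / 2) = 4 * \<eta>" by (simp add: \<eta>_def)
    ultimately show False using main \<epsilon>(4) \<eta> by (simp add: algebra_simps)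
  qed
  then show ?thesis
    using El by (simp add: \<mu>_def negligible_iff_measure not_less antisym measure_le_0_iff)
qed

section \<open>Differentiability almost everywhere of absolutely continuous functions\<close>

lemma AE_lebesgue_iff_negligible: "(AE x in lebesgue. P x) \<longleftrightarrow> negligible {x. \<not> P x}"
  using negligible_subset[of _ "{x. \<not> P x}"]
  by (auto simp: eventually_ae_filter negligible_iff_null_sets)

text \<open>
  On a window shorter than the \<open>\<delta>\<close> that absolute continuity assigns to \<open>\<epsilon> = 1\<close>, disjoint
  intervals have total increment below \<open>1\<close>. If the part of \<open>E\<close> in the window had positive measure \<open>\<mu>\<close>,
  intervals of slope at least \<open>2 / \<mu>\<close> covering more than half of it would exceed this. Countably many
  windows cover the line.
\<close>

lemma infinite_derivate_negligible:
  fixes f :: "real \<Rightarrow> real"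
  assumes ac: "absolutely_continuous_on_interval a b f"
    and E: "E \<in> sets lebesgue" "E \<subseteq> {a<..<b}"
    and up: "\<And>N x d. x \<in> E \<Longrightarrow> d > 0 \<Longrightarrow> \<exists>u v. u < x \<and> x < v \<and> v - u < d \<and> f v - f u \<ge> N * (v - u)"
  shows "negligible E"
proof -
  obtain \<delta> where \<delta>: "\<delta> > 0" "\<forall>(I::(real \<times> real) set) u v. nonoverlapping I u v \<longrightarrow>
       (\<forall>i\<in>I. a \<le> u i \<and> v i \<le> b) \<longrightarrow>
       (\<Sum>i\<in>I. v i - u i) < \<delta> \<longrightarrow> (\<Sum>i\<in>I. norm (f (v i) - f (u i))) < 1"
    by (rule absolutely_continuous_finite_family[OF ac zero_less_one]) (rule that)
  define W where "W k = {of_int k * (\<delta> / 3)<..<(of_int k + 2) * (\<delta> / 3)}" for k :: int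
  have W: "negligible (E \<inter> W k)" for k
  proof -
    define T where "T = W k \<inter> {a<..<b}"
    have T: "open T" "T \<subseteq> {a<..<b}" "E \<inter> W k \<subseteq> T" using E by (auto simp: T_def W_def)
    have WE: "E \<inter> W k \<in> lmeasurable"
      using E(1) by (intro bounded_set_imp_lmeasurable bounded_Int) (auto simp: W_def)
    have Wl: "W k \<in> lmeasurable" by (auto simp: W_def)
    have mW: "measure lebesgue (W k) < \<delta>" using \<delta>(1) by (simp add: W_def algebra_simps)
    have "\<not> measure lebesgue (E \<inter> W k) > 0"
    proof
      assume pos: "measure lebesgue (E \<inter> W k) > 0"
      define \<mu> where "\<mu> = measure lebesgue (E \<inter> W k)"
      have \<mu>2: "\<mu> / 2 > 0" using pos by (simp add: \<mu>_def)
      have up1: "\<exists>u v. u < x \<and> x < v \<and> v - u < d \<and> f v - f u \<ge> (2 / \<mu>) * (v - u)"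
        if "x \<in> E \<inter> W k" "d > 0" for x d
        using up that by blast
      obtain D where D: "nonoverlapping D fst snd"
        "\<forall>(u, v)\<in>D. u < v \<and> f v - f u \<ge> (2 / \<mu>) * (v - u) \<and> {u..v} \<subseteq> T"
        "measure lebesgue ((E \<inter> W k) - (\<Union>i\<in>D. {fst i<..<snd i})) < \<mu> / 2"
        by (rule Vitali_finite_intervals[OF WE T(3,1) up1 \<mu>2]; (assumption | rule that))
      define T1 where "T1 = (\<Union>i\<in>D. {fst i<..<snd i})"
      have T1: "T1 \<in> lmeasurable"
        unfolding T1_def using D(1) by (auto simp: nonoverlapping_def)
      have DT: "{fst i..snd i} \<subseteq> T" "fst i < snd i" if "i \<in> D" for i
        using bspec[OF D(2) that] by (simp_all add: split_def)
      have sub: "{fst i<..<snd i} \<subseteq> W k" if "i \<in> D" for i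
      proof -
        have "{fst i<..<snd i} \<subseteq> {fst i..snd i}" by auto
        then show ?thesis using DT[OF that] T_def by blast
      qed
      have "(\<Sum>i\<in>D. snd i - fst i) \<le> measure lebesgue (W k)"
        by (rule nonoverlapping_length_le[OF D(1) sub Wl])
      then have lt: "(\<Sum>i\<in>D. snd i - fst i) < \<delta>" using mW by simp
      have ab: "a \<le> fst i \<and> snd i \<le> b" if "i \<in> D" for i
      proof -
        have "fst i \<in> {a<..<b}" "snd i \<in> {a<..<b}"
          using DT[OF that] T(2) by (auto simp: subset_iff)
        then show ?thesis by auto
      qed
      have "\<mu> \<le> measure lebesgue ((E \<inter> W k - T1) \<union> T1)"
        unfolding \<mu>_def using WE T1
        by (intro measure_mono_fmeasurable fmeasurable.Un fmeasurable.Diff) (auto dest: fmeasurableD)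
      also have "\<dots> \<le> measure lebesgue (E \<inter> W k - T1) + measure lebesgue T1"
        using WE T1 by (intro measure_Un_le) (auto dest!: fmeasurableD)
      finally have "measure lebesgue T1 > \<mu> / 2" using D(3) unfolding T1_def by linarith
      then have "1 < (2 / \<mu>) * measure lebesgue T1" using \<mu>2 by (simp add: field_simps)
      also have "\<dots> = (\<Sum>i\<in>D. (2 / \<mu>) * (snd i - fst i))"
        unfolding T1_def nonoverlapping_length_eq[OF D(1)] by (simp add: sum_distrib_left)
      also have "\<dots> \<le> (\<Sum>i\<in>D. norm (f (snd i) - f (fst i)))"
      proof (rule sum_mono)
        fix i assume "i \<in> D"
        then have "(2 / \<mu>) * (snd i - fst i) \<le> f (snd i) - f (fst i)"
          using bspec[OF D(2), of i] by (simp add: split_def)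
        then show "(2 / \<mu>) * (snd i - fst i) \<le> norm (f (snd i) - f (fst i))" by simp
      qed
      also have "\<dots> < 1" using ab by (intro \<delta>(2)[rule_format, OF D(1) _ lt]) auto
      finally show False .
    qed
    then show ?thesis
      using WE by (simp add: negligible_iff_measure not_less antisym measure_le_0_iff)
  qed
  have "E \<subseteq> (\<Union>k\<in>UNIV. E \<inter> W k)"
  proof
    fix x assume x: "x \<in> E"
    define k where "k = \<lceil>x / (\<delta> / 3)\<rceil> - 1"
    have "of_int k < x / (\<delta> / 3)" "x / (\<delta> / 3) < of_int k + 2"
      unfolding k_def by linarith+
    then have "x \<in> W k" using \<delta>(1) unfolding W_def by (simp add: pos_divide_less_eq pos_less_divide_eq)
    then show "x \<in> (\<Union>k\<in>UNIV. E \<inter> W k)" using x by blast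
  qed
  moreover have "negligible (\<Union>k\<in>UNIV. E \<inter> W k)"
    using W by (intro negligible_countable_Union) auto
  ultimately show ?thesis by (rule negligible_subset[rotated])
qed

text \<open>
  The points at which slopes of at least \<open>s\<close> recur along arbitrarily short intervals with the point in
  their interior; an upper derivate of at least \<open>s\<close>, up to the boundary case. Straddling the point is
  what makes this set a countable intersection of open sets, hence measurable.
\<close>

definition steep :: "(real \<Rightarrow> real) \<Rightarrow> real \<Rightarrow> real set" where
  "steep f s = {x. \<forall>d>0. \<exists>u v. u < x \<and> x < v \<and> v - u < d \<and> f v - f u \<ge> s * (v - u)}"

lemma steep_measurable: "steep f s \<in> sets lebesgue"
proof -
  define G where "G n = \<Union>{{u<..<v} | u v. v - u < 1 / real (Suc n) \<and> f v - f u \<ge> s * (v - u)}" for n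
  have "steep f s = (\<Inter>n. G n)"
  proof
    show "steep f s \<subseteq> (\<Inter>n. G n)"
    proof
      fix x assume x: "x \<in> steep f s"
      have "x \<in> G n" for n
      proof -
        have "1 / real (Suc n) > 0" by simp
        then obtain u v where "u < x" "x < v" "v - u < 1 / real (Suc n)" "f v - f u \<ge> s * (v - u)"
          using x unfolding steep_def by blast
        then show ?thesis unfolding G_def by (intro UnionI[of "{u<..<v}"]) auto
      qed
      then show "x \<in> (\<Inter>n. G n)" by blast
    qed
    show "(\<Inter>n. G n) \<subseteq> steep f s"
    proof
      fix x assume x: "x \<in> (\<Inter>n. G n)"
      have "\<exists>u v. u < x \<and> x < v \<and> v - u < d \<and> f v - f u \<ge> s * (v - u)" if d: "d > 0" for d
      proof -
        obtain n where n: "1 / real (Suc n) < d"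
          using d reals_Archimedean[of d] by (auto simp: inverse_eq_divide)
        have "x \<in> G n" using x by blast
        then obtain u v where "u < x" "x < v" "v - u < 1 / real (Suc n)" "f v - f u \<ge> s * (v - u)"
          unfolding G_def by auto
        then show ?thesis using n by (intro exI[of _ u] exI[of _ v]) auto
      qed
      then show "x \<in> steep f s" unfolding steep_def by blast
    qed
  qed
  moreover have "open (G n)" for n unfolding G_def by (rule open_Union) auto
  then have "(\<Inter>n. G n) \<in> sets borel" by auto
  ultimately show ?thesis by simp
qed

lemma steep_antimono: "s \<le> t \<Longrightarrow> steep f t \<subseteq> steep f s"
proof
  fix x assume st: "s \<le> t" and x: "x \<in> steep f t"
  show "x \<in> steep f s"
    unfolding steep_def
  proof (safe)
    fix d :: real assume "d > 0"
    then obtain u v where uv: "u < x" "x < v" "v - u < d" "f v - f u \<ge> t * (v - u)"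
      using x unfolding steep_def by blast
    have "s * (v - u) \<le> t * (v - u)" using st uv by (intro mult_right_mono) auto
    also have "\<dots> \<le> f v - f u" by (rule uv)
    finally show "\<exists>u v. u < x \<and> x < v \<and> v - u < d \<and> f v - f u \<ge> s * (v - u)"
      using uv by blast
  qed
qed

lemma negligible_if_bounded_parts_negligible:
  assumes "\<And>n::nat. negligible (E \<inter> {- real n<..<real n})"
  shows "negligible E"
proof (rule negligible_subset)
  show "negligible (\<Union>n. E \<inter> {- real n<..<real n})"
    using assms by (intro negligible_countable_Union) auto
  show "E \<subseteq> (\<Union>n. E \<inter> {- real n<..<real n})"
  proof
    fix x assume "x \<in> E"
    moreover obtain n :: nat where "real n > \<bar>x\<bar>" using reals_Archimedean2 by blast
    ultimately show "x \<in> (\<Union>n. E \<inter> {- real n<..<real n})" by (intro UN_I[of n]) auto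
  qed
qed

lemma steep_crossing_negligible:
  assumes "ac_loc f" "r < s"
  shows "negligible (steep f s \<inter> steep (\<lambda>x. - f x) (- r))"
proof (rule negligible_if_bounded_parts_negligible)
  fix n :: nat
  show "negligible (steep f s \<inter> steep (\<lambda>x. - f x) (- r) \<inter> {- real n<..<real n})"
  proof (rule derivates_separated_negligible[OF _ _ _ \<open>r < s\<close>])
    show "absolutely_continuous_on_interval (- real n) (real n) f" using assms by (simp add: ac_loc_def)
    show "steep f s \<inter> steep (\<lambda>x. - f x) (- r) \<inter> {- real n<..<real n} \<in> sets lebesgue"
      using steep_measurable by (intro sets.Int) auto
    fix x d :: real assume x: "x \<in> steep f s \<inter> steep (\<lambda>x. - f x) (- r) \<inter> {- real n<..<real n}" and d: "d > 0"
    show "\<exists>u v. u < x \<and> x < v \<and> v - u < d \<and> f v - f u \<ge> s * (v - u)"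
      using x d unfolding steep_def by blast
    obtain u v where uv: "u < x" "x < v" "v - u < d" "- f v - - f u \<ge> - r * (v - u)"
      using x d unfolding steep_def by blast
    then show "\<exists>u v. u < x \<and> x < v \<and> v - u < d \<and> f v - f u \<le> r * (v - u)"
      by (intro exI[of _ u] exI[of _ v]) auto
  qed auto
qed

lemma steep_all_negligible:
  assumes "ac_loc f"
  shows "negligible (\<Inter>N::nat. steep f (real N))"
proof (rule negligible_if_bounded_parts_negligible)
  fix n :: nat
  show "negligible ((\<Inter>N::nat. steep f (real N)) \<inter> {- real n<..<real n})"
  proof (rule infinite_derivate_negligible)
    show "absolutely_continuous_on_interval (- real n) (real n) f" using assms by (simp add: ac_loc_def)
    show "(\<Inter>N::nat. steep f (real N)) \<inter> {- real n<..<real n} \<in> sets lebesgue"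
      using steep_measurable by (intro sets.Int) auto
    fix N x d :: real assume x: "x \<in> (\<Inter>N::nat. steep f (real N)) \<inter> {- real n<..<real n}" and d: "d > 0"
    obtain M :: nat where "N \<le> real M" using real_arch_simple by blast
    then have "x \<in> steep f N" using x steep_antimono[of N "real M" f] by blast
    then show "\<exists>u v. u < x \<and> x < v \<and> v - u < d \<and> f v - f u \<ge> N * (v - u)"
      using d unfolding steep_def by blast
  qed auto
qed

lemma ac_loc_uminus: "ac_loc f \<Longrightarrow> ac_loc (\<lambda>x. - f x)"
  unfolding ac_loc_def absolutely_continuous_on_interval_def
  by (simp add: norm_minus_commute)

text \<open>
  The candidate for the derivative is the supremum \<open>c\<close> of the slopes that recur at \<open>x\<close>. Slopes above
  \<open>c\<close> do not recur, and slopes below it cannot be undercut because of the rational gap condition.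
  This controls the increments over intervals that straddle \<open>x\<close>; continuity at \<open>x\<close> then
  allows \<open>x\<close> to become an end point.
\<close>

lemma differentiable_if_slopes_meet:
  fixes f :: "real \<Rightarrow> real"
  assumes cont: "continuous_on UNIV f"
    and fin: "x \<notin> steep f M" "x \<notin> steep (\<lambda>x. - f x) M'"
    and gap: "\<And>r s. r \<in> \<rat> \<Longrightarrow> s \<in> \<rat> \<Longrightarrow> r < s \<Longrightarrow> x \<notin> steep f s \<inter> steep (\<lambda>x. - f x) (- r)"
  shows "\<exists>c. (f has_real_derivative c) (at x)"
proof -
  have lower: "\<exists>d>0. \<forall>u v. u < x \<and> x < v \<and> v - u < d \<longrightarrow> f v - f u > - m * (v - u)"
    if m: "x \<notin> steep (\<lambda>x. - f x) m" for m
  proof -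
    obtain d where "d > 0" "\<And>u v. u < x \<Longrightarrow> x < v \<Longrightarrow> v - u < d \<Longrightarrow> \<not> - f v - - f u \<ge> m * (v - u)"
      using m unfolding steep_def by blast
    then show ?thesis by (intro exI[of _ d]) (auto simp: not_le algebra_simps)
  qed
  have upper: "\<exists>d>0. \<forall>u v. u < x \<and> x < v \<and> v - u < d \<longrightarrow> f v - f u < m * (v - u)"
    if m: "x \<notin> steep f m" for m
    using m unfolding steep_def by (auto simp: not_le)
  define S where "S = {s. x \<in> steep f s}"
  have "- M' \<in> S"
  proof -
    obtain d where d: "d > 0" "\<forall>u v. u < x \<and> x < v \<and> v - u < d \<longrightarrow> f v - f u > - M' * (v - u)"
      using lower[OF fin(2)] by blast
    have "\<exists>u v. u < x \<and> x < v \<and> v - u < e \<and> f v - f u \<ge> - M' * (v - u)" if e: "e > 0" for e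
    proof (intro exI conjI)
      define t where "t = min d e / 3"
      have t: "t > 0" "3 * t \<le> d" "3 * t \<le> e" using d e by (auto simp: t_def)
      show "x - t < x" "x < x + t" "x + t - (x - t) < e" using t by auto
      show "- M' * (x + t - (x - t)) \<le> f (x + t) - f (x - t)"
        using d(2)[rule_format, of "x - t" "x + t"] t by simp
    qed
    then show ?thesis by (auto simp: S_def steep_def)
  qed
  moreover have bdd: "bdd_above S"
  proof (rule bdd_aboveI[of _ M])
    fix s assume "s \<in> S"
    then show "s \<le> M" using fin(1) steep_antimono[of M s f] by (force simp: S_def)
  qed
  ultimately have ne: "S \<noteq> {}" by blast
  define c where "c = Sup S"
  have key: "\<exists>d>0. \<forall>u v. u < x \<and> x < v \<and> v - u < d \<longrightarrow> \<bar>f v - f u - c * (v - u)\<bar> \<le> e * (v - u)"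
    if e: "e > 0" for e
  proof -
    have "c + e \<notin> S" using cSup_upper[OF _ bdd, of "c + e"] e by (auto simp: c_def)
    then obtain d1 where d1: "d1 > 0" "\<forall>u v. u < x \<and> x < v \<and> v - u < d1 \<longrightarrow> f v - f u < (c + e) * (v - u)"
      using upper[of "c + e"] unfolding S_def by blast
    obtain t where t: "t \<in> S" "c - e < t"
      using less_cSup_iff[OF ne bdd, of "c - e"] e by (auto simp: c_def)
    obtain s where s: "s \<in> \<rat>" "c - e < s" "s < t" using Rats_dense_in_real[OF t(2)] by auto
    obtain r where r: "r \<in> \<rat>" "c - e < r" "r < s" using Rats_dense_in_real[OF s(2)] by auto
    have "x \<in> steep f s" using t s steep_antimono[of s t f] by (auto simp: S_def)
    then have "x \<notin> steep (\<lambda>x. - f x) (- r)" using gap[OF r(1) s(1) r(3)] by blast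
    then obtain d2 where d2: "d2 > 0" "\<forall>u v. u < x \<and> x < v \<and> v - u < d2 \<longrightarrow> f v - f u > r * (v - u)"
      using lower[of "- r"] by auto
    show ?thesis
    proof (intro exI[of _ "min d1 d2"] conjI allI impI)
      show "min d1 d2 > 0" using d1 d2 by simp
      fix u v assume uv: "u < x \<and> x < v \<and> v - u < min d1 d2"
      have "f v - f u < (c + e) * (v - u)" "f v - f u > r * (v - u)" using d1 d2 uv by auto
      moreover have "r * (v - u) \<ge> (c - e) * (v - u)" using r uv by (intro mult_right_mono) auto
      ultimately show "\<bar>f v - f u - c * (v - u)\<bar> \<le> e * (v - u)"
        by (simp add: algebra_simps abs_le_iff)
    qed
  qed
  have isc: "isCont f x" using cont by (simp add: continuous_on_eq_continuous_at)
  have "(f has_derivative (\<lambda>h. c * h)) (at x)"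
    unfolding has_derivative_at_alt
  proof (intro conjI allI impI)
    show "bounded_linear (\<lambda>h. c * h)" by (rule bounded_linear_mult_right)
    fix e :: real assume "e > 0"
    then obtain d where d: "d > 0" "\<forall>u v. u < x \<and> x < v \<and> v - u < d \<longrightarrow> \<bar>f v - f u - c * (v - u)\<bar> \<le> e * (v - u)"
      using key by blast
    show "\<exists>d>0. \<forall>y. norm (y - x) < d \<longrightarrow> norm (f y - f x - c * (y - x)) \<le> e * norm (y - x)"
    proof (intro exI[of _ "d / 2"] conjI allI impI)
      show "d / 2 > 0" using d by simp
      fix y assume y: "norm (y - x) < d / 2"
      consider "y = x" | "y > x" | "y < x" by linarith
      then show "norm (f y - f x - c * (y - x)) \<le> e * norm (y - x)"
      proof cases
        case 2
        have "((\<lambda>u. e * (y - u) - \<bar>f y - f u - c * (y - u)\<bar>) \<longlongrightarrow> e * (y - x) - \<bar>f y - f x - c * (y - x)\<bar>) (at_left x)"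
          using isc unfolding isCont_def
          by (intro tendsto_intros) (auto intro: tendsto_within_subset)
        moreover have "\<forall>\<^sub>F u in at_left x. 0 \<le> e * (y - u) - \<bar>f y - f u - c * (y - u)\<bar>"
          unfolding eventually_at_left_field
          using 2 y d by (intro exI[of _ "x - d / 2"]) auto
        ultimately have "0 \<le> e * (y - x) - \<bar>f y - f x - c * (y - x)\<bar>"
          by (rule tendsto_lowerbound) simp
        then show ?thesis using 2 by simp
      next
        case 3
        have "((\<lambda>v. e * (v - y) - \<bar>f v - f y - c * (v - y)\<bar>) \<longlongrightarrow> e * (x - y) - \<bar>f x - f y - c * (x - y)\<bar>) (at_right x)"
          using isc unfolding isCont_def
          by (intro tendsto_intros) (auto intro: tendsto_within_subset)
        moreover have "\<forall>\<^sub>F v in at_right x. 0 \<le> e * (v - y) - \<bar>f v - f y - c * (v - y)\<bar>"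
          unfolding eventually_at_right_field
          using 3 y d by (intro exI[of _ "x + d / 2"]) auto
        ultimately have "0 \<le> e * (x - y) - \<bar>f x - f y - c * (x - y)\<bar>"
          by (rule tendsto_lowerbound) simp
        then show ?thesis using 3 by (simp add: abs_le_iff algebra_simps)
      qed simp
    qed
  qed
  then show ?thesis unfolding has_field_derivative_def by blast
qed

lemma ac_loc_real_AE_differentiable:
  fixes f :: "real \<Rightarrow> real"
  assumes ac: "ac_loc f"
  shows "AE x in lebesgue. \<exists>c. (f has_real_derivative c) (at x)"
proof -
  define B where "B = (\<Union>(r, s)\<in>{(r, s). r \<in> \<rat> \<and> s \<in> \<rat> \<and> r < s}. steep f s \<inter> steep (\<lambda>x. - f x) (- r))
      \<union> (\<Inter>N::nat. steep f (real N)) \<union> (\<Inter>N::nat. steep (\<lambda>x. - f x) (real N))"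
  have "countable {(r::real, s::real). r \<in> \<rat> \<and> s \<in> \<rat> \<and> r < s}"
    by (rule countable_subset[of _ "\<rat> \<times> \<rat>"]) (auto intro: countable_rat)
  then have "negligible (\<Union>(r, s)\<in>{(r, s). r \<in> \<rat> \<and> s \<in> \<rat> \<and> r < s}. steep f s \<inter> steep (\<lambda>x. - f x) (- r))"
    by (intro negligible_countable_Union countable_image) (auto intro: steep_crossing_negligible[OF ac])
  then have "negligible B"
    unfolding B_def by (intro negligible_Un steep_all_negligible ac ac_loc_uminus)
  moreover have "\<exists>c. (f has_real_derivative c) (at x)" if x: "x \<notin> B" for x
  proof -
    obtain N N' :: nat where "x \<notin> steep f (real N)" "x \<notin> steep (\<lambda>x. - f x) (real N')"
      using x by (auto simp: B_def)
    moreover have "x \<notin> steep f s \<inter> steep (\<lambda>x. - f x) (- r)" if "r \<in> \<rat>" "s \<in> \<rat>" "r < s" for r s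
      using x that unfolding B_def by blast
    ultimately show ?thesis
      using differentiable_if_slopes_meet[OF ac_loc_continuous_on[OF ac]] by blast
  qed
  then have "{x. \<not> (\<exists>c. (f has_real_derivative c) (at x))} \<subseteq> B" by blast
  ultimately show ?thesis
    unfolding AE_lebesgue_iff_negligible by (rule negligible_subset)
qed

section \<open>Calculus with absolutely continuous functions\<close>

text \<open>
  The closure properties of absolute continuity below derive from this one.
\<close>

lemma ac_loc_dominated:
  fixes f1 :: "real \<Rightarrow> 'a::real_normed_vector" and f2 :: "real \<Rightarrow> 'b::real_normed_vector"
    and g :: "real \<Rightarrow> 'c::real_normed_vector"
  assumes ac: "ac_loc f1" "ac_loc f2"
    and dom: "\<And>a b. \<exists>K. \<forall>u\<in>{a..b}. \<forall>v\<in>{a..b}. u \<le> v \<longrightarrow>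
        norm (g v - g u) \<le> K * (norm (f1 v - f1 u) + norm (f2 v - f2 u))"
  shows "ac_loc g"
  unfolding ac_loc_def absolutely_continuous_on_interval_def
proof (intro allI impI)
  fix a b e :: real assume "e > 0"
  obtain K0 where K0: "\<forall>u\<in>{a..b}. \<forall>v\<in>{a..b}. u \<le> v \<longrightarrow>
        norm (g v - g u) \<le> K0 * (norm (f1 v - f1 u) + norm (f2 v - f2 u))"
    using dom by blast
  define K where "K = \<bar>K0\<bar> + 1"
  have "K > 0" by (simp add: K_def)
  have K: "norm (g v - g u) \<le> K * (norm (f1 v - f1 u) + norm (f2 v - f2 u))"
    if "a \<le> u" "u \<le> v" "v \<le> b" for u v
  proof -
    have "norm (g v - g u) \<le> K0 * (norm (f1 v - f1 u) + norm (f2 v - f2 u))" using K0 that by auto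
    also have "\<dots> \<le> K * (norm (f1 v - f1 u) + norm (f2 v - f2 u))"
      by (intro mult_right_mono) (auto simp: K_def)
    finally show ?thesis .
  qed
  have e: "e / (2 * K) > 0" using \<open>e > 0\<close> \<open>K > 0\<close> by simp
  have ac1: "absolutely_continuous_on_interval a b f1" and ac2: "absolutely_continuous_on_interval a b f2"
    using ac by (auto simp: ac_loc_def)
  obtain d1 where d1: "d1 > 0" "\<forall>(I::nat set) u v. nonoverlapping I u v \<longrightarrow>
       (\<forall>i\<in>I. a \<le> u i \<and> v i \<le> b) \<longrightarrow>
       (\<Sum>i\<in>I. v i - u i) < d1 \<longrightarrow> (\<Sum>i\<in>I. norm (f1 (v i) - f1 (u i))) < e / (2 * K)"
    by (rule absolutely_continuous_finite_family[OF ac1 e]) (rule that)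
  obtain d2 where d2: "d2 > 0" "\<forall>(I::nat set) u v. nonoverlapping I u v \<longrightarrow>
       (\<forall>i\<in>I. a \<le> u i \<and> v i \<le> b) \<longrightarrow>
       (\<Sum>i\<in>I. v i - u i) < d2 \<longrightarrow> (\<Sum>i\<in>I. norm (f2 (v i) - f2 (u i))) < e / (2 * K)"
    by (rule absolutely_continuous_finite_family[OF ac2 e]) (rule that)
  show "\<exists>\<delta>>0. \<forall>(n::nat) u v. (\<forall>k<n. a \<le> u k \<and> u k \<le> v k \<and> v k \<le> b) \<longrightarrow>
       disjoint_family_on (\<lambda>k. {u k<..<v k}) {..<n} \<longrightarrow>
       (\<Sum>k<n. v k - u k) < \<delta> \<longrightarrow> (\<Sum>k<n. norm (g (v k) - g (u k))) < e"
  proof (intro exI[of _ "min d1 d2"] conjI allI impI)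
    show "min d1 d2 > 0" using d1 d2 by simp
    fix n :: nat and u v :: "nat \<Rightarrow> real"
    assume uv: "\<forall>k<n. a \<le> u k \<and> u k \<le> v k \<and> v k \<le> b"
      and dis: "disjoint_family_on (\<lambda>k. {u k<..<v k}) {..<n}" and lt: "(\<Sum>k<n. v k - u k) < min d1 d2"
    have no: "nonoverlapping {..<n} u v" using uv dis by (auto simp: nonoverlapping_def)
    have "(\<Sum>k<n. norm (g (v k) - g (u k))) \<le>
       (\<Sum>k<n. K * (norm (f1 (v k) - f1 (u k)) + norm (f2 (v k) - f2 (u k))))"
      using uv K by (intro sum_mono) auto
    also have "\<dots> = K * ((\<Sum>k<n. norm (f1 (v k) - f1 (u k))) + (\<Sum>k<n. norm (f2 (v k) - f2 (u k))))"
      by (simp add: sum_distrib_left sum.distrib distrib_left)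
    also have "\<dots> < K * (e / (2 * K) + e / (2 * K))"
    proof (intro mult_strict_left_mono add_strict_mono)
      show "(\<Sum>k<n. norm (f1 (v k) - f1 (u k))) < e / (2 * K)"
        using uv lt by (intro d1(2)[rule_format, OF no]) auto
      show "(\<Sum>k<n. norm (f2 (v k) - f2 (u k))) < e / (2 * K)"
        using uv lt by (intro d2(2)[rule_format, OF no]) auto
    qed fact
    also have "\<dots> = e" using \<open>K > 0\<close> by simp
    finally show "(\<Sum>k<n. norm (g (v k) - g (u k))) < e" .
  qed
qed

lemma ac_loc_nonexpansive:
  fixes g :: "'a::real_normed_vector \<Rightarrow> 'b::real_normed_vector"
  assumes "ac_loc f" "\<And>x y. norm (g x - g y) \<le> norm (x - y)"
  shows "ac_loc (\<lambda>x. g (f x))"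
proof (rule ac_loc_dominated[OF assms(1,1)])
  fix a b
  show "\<exists>K. \<forall>u\<in>{a..b}. \<forall>v\<in>{a..b}. u \<le> v \<longrightarrow>
      norm (g (f v) - g (f u)) \<le> K * (norm (f v - f u) + norm (f v - f u))"
    using assms(2) by (intro exI[of _ 1]) (smt (verit) mult_1 norm_ge_zero)
qed

lemma ac_loc_Re: "ac_loc f \<Longrightarrow> ac_loc (\<lambda>x. Re (f x))"
  by (erule ac_loc_nonexpansive[of f Re]) (metis abs_Re_le_cmod minus_complex.simps(1) real_norm_def)

lemma ac_loc_Im: "ac_loc f \<Longrightarrow> ac_loc (\<lambda>x. Im (f x))"
  by (erule ac_loc_nonexpansive[of f Im]) (metis abs_Im_le_cmod minus_complex.simps(2) real_norm_def)

lemma ac_loc_cnj: "ac_loc f \<Longrightarrow> ac_loc (\<lambda>x. cnj (f x))"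
  by (erule ac_loc_nonexpansive[of f cnj]) (metis complex_cnj_diff complex_mod_cnj order_refl)

lemma ac_loc_add:
  assumes "ac_loc f" "ac_loc g" shows "ac_loc (\<lambda>x. f x + g x)"
proof (rule ac_loc_dominated[OF assms])
  have "norm (f v + g v - (f u + g u)) \<le> 1 * (norm (f v - f u) + norm (g v - g u))" for u v
    using norm_triangle_ineq[of "f v - f u" "g v - g u"] by (simp add: algebra_simps)
  then show "\<exists>K. \<forall>u\<in>{a..b}. \<forall>v\<in>{a..b}. u \<le> v \<longrightarrow>
      norm (f v + g v - (f u + g u)) \<le> K * (norm (f v - f u) + norm (g v - g u))" for a b by blast
qed

lemma ac_loc_diff:
  assumes "ac_loc f" "ac_loc g" shows "ac_loc (\<lambda>x. f x - g x)"
  using ac_loc_add[OF assms(1) ac_loc_nonexpansive[OF assms(2), of uminus]]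
  by (simp add: norm_minus_commute)

lemma ac_loc_mult:
  fixes f g :: "real \<Rightarrow> 'a::real_normed_algebra"
  assumes "ac_loc f" "ac_loc g" shows "ac_loc (\<lambda>x. f x * g x)"
proof (rule ac_loc_dominated[OF assms])
  fix a b :: real
  have "compact (f ` {a..b})" "compact (g ` {a..b})"
    using assms by (auto intro!: compact_continuous_image continuous_on_subset[OF ac_loc_continuous_on])
  then obtain M N where M: "\<forall>x\<in>{a..b}. norm (f x) \<le> M" and N: "\<forall>x\<in>{a..b}. norm (g x) \<le> N"
    by (metis (no_types, lifting) bounded_iff compact_imp_bounded imageI)
  show "\<exists>K. \<forall>u\<in>{a..b}. \<forall>v\<in>{a..b}. u \<le> v \<longrightarrow>
      norm (f v * g v - f u * g u) \<le> K * (norm (f v - f u) + norm (g v - g u))"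
  proof (intro exI[of _ "max M N"] ballI impI)
    fix u v assume uv: "u \<in> {a..b}" "v \<in> {a..b}"
    have "f v * g v - f u * g u = (f v - f u) * g v + f u * (g v - g u)" by (simp add: algebra_simps)
    also have "norm \<dots> \<le> norm (f v - f u) * norm (g v) + norm (f u) * norm (g v - g u)"
      by (intro norm_triangle_le add_mono norm_mult_ineq)
    also have "\<dots> \<le> norm (f v - f u) * max M N + max M N * norm (g v - g u)"
      using M N uv by (intro add_mono mult_left_mono mult_right_mono) (auto intro: le_max_iff_disj[THEN iffD2])
    finally show "norm (f v * g v - f u * g u) \<le> max M N * (norm (f v - f u) + norm (g v - g u))"
      by (simp add: algebra_simps)
  qed
qed

lemma ac_loc_id: "ac_loc (\<lambda>x::real. x)"
  unfolding ac_loc_def absolutely_continuous_on_interval_def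
proof (intro allI impI)
  fix a b e :: real assume "e > 0"
  have *: "(\<Sum>k<n. norm (v k - u k)) = (\<Sum>k<n. v k - u k)"
    if "\<forall>k<n. a \<le> u k \<and> u k \<le> v k \<and> v k \<le> b" for n :: nat and u v :: "nat \<Rightarrow> real"
    using that by (intro sum.cong) auto
  then show "\<exists>\<delta>>0. \<forall>(n::nat) u v. (\<forall>k<n. a \<le> u k \<and> u k \<le> v k \<and> v k \<le> b) \<longrightarrow>
       disjoint_family_on (\<lambda>k. {u k<..<v k}) {..<n} \<longrightarrow>
       (\<Sum>k<n. v k - u k) < \<delta> \<longrightarrow> (\<Sum>k<n. norm (v k - u k)) < e"
    using \<open>e > 0\<close> by (intro exI[of _ e]) auto
qed

lemma ac_loc_const: "ac_loc (\<lambda>x. c)"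
  unfolding ac_loc_def absolutely_continuous_on_interval_def by (auto intro: exI[of _ 1])

lemma ac_loc_AE_has_vector_derivative:
  fixes f :: "real \<Rightarrow> complex"
  assumes "ac_loc f"
  shows "AE x in lebesgue. (f has_vector_derivative vector_derivative f (at x)) (at x)"
proof -
  have "AE x in lebesgue. \<exists>c. ((\<lambda>x. Re (f x)) has_real_derivative c) (at x)"
    "AE x in lebesgue. \<exists>c. ((\<lambda>x. Im (f x)) has_real_derivative c) (at x)"
    using assms by (auto intro!: ac_loc_real_AE_differentiable ac_loc_Re ac_loc_Im)
  then show ?thesis
  proof eventually_elim
    case (elim x)
    then obtain c d where "((\<lambda>x. Re (f x)) has_real_derivative c) (at x)"
      "((\<lambda>x. Im (f x)) has_real_derivative d) (at x)" by blast
    then have "(f has_vector_derivative Complex c d) (at x)"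
      by (simp add: has_vector_derivative_complex_iff)
    then show ?case using vector_derivative_at by force
  qed
qed

lemma ac_loc_FTC:
  fixes f :: "real \<Rightarrow> 'a::banach"
  assumes "ac_loc f" "AE x in lebesgue. (f has_vector_derivative f' x) (at x)" "a \<le> b"
  shows "(f' has_integral (f b - f a)) {a..b}"
proof (rule absolutely_continuous_FTC)
  show "absolutely_continuous_on_interval a b f" using assms(1) by (simp add: ac_loc_def)
  show "negligible {x. \<not> (f has_vector_derivative f' x) (at x)}"
    using assms(2) by (simp add: AE_lebesgue_iff_negligible)
  show "(f has_vector_derivative f' x) (at x)"
    if "x \<in> {a..b} - {x. \<not> (f has_vector_derivative f' x) (at x)}" for x
    using that by blast
qed fact

text \<open>
  This is how differential inequalities that hold almost everywhere are integrated.
\<close>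

lemma ac_loc_increment_ge_integral:
  fixes E :: "real \<Rightarrow> real"
  assumes "ac_loc E" "AE x in lebesgue. \<exists>D. (E has_real_derivative D) (at x) \<and> k x \<le> D"
    and "a \<le> b" "k integrable_on {a..b}"
  shows "integral {a..b} k \<le> E b - E a"
proof -
  define E' where "E' x = (SOME D. (E has_real_derivative D) (at x) \<and> k x \<le> D)" for x
  have AE: "AE x in lebesgue. (E has_real_derivative E' x) (at x) \<and> k x \<le> E' x"
    using assms(2)
  proof eventually_elim
    case (elim x)
    show ?case unfolding E'_def by (rule someI_ex[OF elim])
  qed
  have I: "(E' has_integral (E b - E a)) {a..b}"
    using AE by (intro ac_loc_FTC assms) (auto simp: has_real_derivative_iff_has_vector_derivative)
  define N where "N = {x. \<not> k x \<le> E' x}"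
  have N: "negligible N"
    using AE unfolding N_def AE_lebesgue_iff_negligible by (rule negligible_subset) blast
  have "((\<lambda>x. if x \<in> N then E' x else k x) has_integral integral {a..b} k) {a..b}"
    by (rule has_integral_spike[OF N _ integrable_integral[OF assms(4)]]) auto
  then show ?thesis
    using I by (rule has_integral_le) (auto simp: N_def)
qed

text \<open>
  By Henstock's lemma the Riemann sums of \<open>norm \<circ> h\<close> are close to the sum of the norms of the
  integrals of \<open>h\<close> over the pieces, which vanish. So the norm of \<open>h\<close> has integral \<open>0\<close>.
\<close>

lemma zero_integrals_imp_negligible:
  fixes h :: "real \<Rightarrow> complex"
  assumes "\<And>c d. a \<le> c \<Longrightarrow> c \<le> d \<Longrightarrow> d \<le> b \<Longrightarrow> (h has_integral 0) {c..d}" and "a \<le> b"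
  shows "negligible {x \<in> {a..b}. h x \<noteq> 0}"
proof -
  have hi: "h integrable_on cbox a b" using assms(1)[of a b] \<open>a \<le> b\<close> by auto
  have "((\<lambda>x. norm (h x)) has_integral 0) (cbox a b)"
    unfolding has_integral
  proof (intro allI impI)
    fix e :: real assume "e > 0"
    obtain \<gamma> where \<gamma>: "gauge \<gamma>" 
      "\<And>p. p tagged_partial_division_of (cbox a b) \<Longrightarrow> \<gamma> fine p \<Longrightarrow>
             sum (\<lambda>(x,k). norm (measure lborel k *\<^sub>R h x - integral k h)) p < e"
      by (rule Henstock_lemma[OF hi \<open>e > 0\<close>]) (rule that)
    have small: "norm ((\<Sum>(x, k)\<in>p. measure lborel k *\<^sub>R norm (h x)) - 0) < e"
      if p: "p tagged_division_of cbox a b" and fine: "\<gamma> fine p" for p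
    proof -
      have z: "integral K h = 0" if xK: "(x, K) \<in> p" for x K
      proof -
        obtain u v where "K = {u..v}" using tagged_division_ofD(4)[OF p xK] by auto
        moreover have "K \<subseteq> {a..b}" "K \<noteq> {}" using tagged_division_ofD(2,3)[OF p xK] by auto
        ultimately show ?thesis using assms(1)[of u v] by (auto intro: integral_unique)
      qed
      have "(\<Sum>(x, k)\<in>p. measure lborel k *\<^sub>R norm (h x)) =
        sum (\<lambda>(x,k). norm (measure lborel k *\<^sub>R h x - integral k h)) p"
        using z by (intro sum.cong) auto
      also have "\<dots> < e" using p fine by (intro \<gamma>(2)) (auto simp: tagged_division_of_def)
      finally have "(\<Sum>(x, k)\<in>p. measure lborel k *\<^sub>R norm (h x)) < e" .
      moreover have "(\<Sum>(x, k)\<in>p. measure lborel k *\<^sub>R norm (h x)) \<ge> 0"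
        by (intro sum_nonneg) auto
      ultimately show ?thesis by simp
    qed
    show "\<exists>\<gamma>. gauge \<gamma> \<and> (\<forall>\<D>. \<D> tagged_division_of cbox a b \<and> \<gamma> fine \<D> \<longrightarrow>
         norm ((\<Sum>(x, k)\<in>\<D>. measure lborel k *\<^sub>R norm (h x)) - 0) < e)"
      by (intro exI[of _ \<gamma>] conjI allI impI, fact \<gamma>(1), elim conjE, rule small)
  qed
  then have ni: "((\<lambda>x. norm (h x)) has_integral 0) {a..b}" by simp
  then have "(\<lambda>x. norm (h x)) absolutely_integrable_on {a..b}"
    by (intro nonnegative_absolutely_integrable_1) auto
  then have int: "integrable lebesgue (\<lambda>x. indicator {a..b} x * norm (h x))"
    by (simp add: set_integrable_def)
  moreover have "integral\<^sup>L lebesgue (\<lambda>x. indicator {a..b} x * norm (h x)) = 0"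
    using set_lebesgue_integral_eq_integral(2)[OF \<open>(\<lambda>x. norm (h x)) absolutely_integrable_on {a..b}\<close>]
      integral_unique[OF ni] by (simp add: set_lebesgue_integral_def)
  ultimately have "AE x in lebesgue. indicator {a..b} x * norm (h x) = 0"
    by (subst (asm) integral_nonneg_eq_0_iff_AE) auto
  then show ?thesis
    unfolding AE_lebesgue_iff_negligible by (rule negligible_subset) auto
qed

text \<open>
  The Lebesgue differentiation theorem for an indefinite integral already known to be absolutely
  continuous: its derivative exists almost everywhere, has the same integrals as \<open>f\<close> over all
  intervals, and so agrees with \<open>f\<close> almost everywhere.
\<close>

lemma ac_loc_AE_derivative_if_integral:
  fixes G :: "real \<Rightarrow> complex"
  assumes ac: "ac_loc G" and f: "\<And>a b. a \<le> b \<Longrightarrow> (f has_integral (G b - G a)) {a..b}"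
  shows "AE x in lebesgue. (G has_vector_derivative f x) (at x)"
proof -
  have AE: "AE x in lebesgue. (G has_vector_derivative vector_derivative G (at x)) (at x)"
    by (rule ac_loc_AE_has_vector_derivative[OF ac])
  define h where "h x = f x - vector_derivative G (at x)" for x
  have h: "h = (\<lambda>x. f x - vector_derivative G (at x))"
    by (simp add: fun_eq_iff h_def)
  have h0: "(h has_integral 0) {c..d}" if "c \<le> d" for c d
    using has_integral_diff[OF f[OF that] ac_loc_FTC[OF ac AE that]] unfolding h by simp
  have "negligible {x. h x \<noteq> 0}"
  proof (rule negligible_if_bounded_parts_negligible)
    fix n :: nat
    have "negligible {x \<in> {- real n..real n}. h x \<noteq> 0}"
      using h0 by (intro zero_integrals_imp_negligible) auto
    then show "negligible ({x. h x \<noteq> 0} \<inter> {- real n<..<real n})"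
      by (rule negligible_subset) auto
  qed
  then have "AE x in lebesgue. h x = 0" unfolding AE_lebesgue_iff_negligible by simp
  with AE show ?thesis by eventually_elim (simp add: h_def)
qed

section \<open>Antiderivatives and linear Volterra equations\<close>

text \<open>
  The signed integral from \<open>0\<close> to \<open>x\<close>, for \<open>x\<close> of either sign.
\<close>

definition antider :: "(real \<Rightarrow> 'a::banach) \<Rightarrow> real \<Rightarrow> 'a" where
  "antider f x = (if 0 \<le> x then integral {0..x} f else - integral {x..0} f)"

lemma has_integral_antider:
  assumes "\<And>a b. f integrable_on {a..b}" "a \<le> b"
  shows "(f has_integral (antider f b - antider f a)) {a..b}"
proof -
  have "integral {a..b} f = antider f b - antider f a"
    using Henstock_Kurzweil_Integration.integral_combine[of 0 a b f] Henstock_Kurzweil_Integration.integral_combine[of a 0 b f] Henstock_Kurzweil_Integration.integral_combine[of a b 0 f] assms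
    by (auto simp: antider_def algebra_simps)
  then show ?thesis using integrable_integral[OF assms(1)[of a b]] by simp
qed

lemma antider_0 [simp]: "antider f 0 = 0"
  by (simp add: antider_def)

lemma antider_has_vector_derivative:
  assumes cont: "continuous_on UNIV f"
  shows "(antider f has_vector_derivative f x) (at x)"
proof -
  have int: "f integrable_on {a..b}" for a b
    using cont by (intro integrable_continuous_real continuous_on_subset[OF cont]) auto
  have "((\<lambda>y. antider f (x - 1) + integral {x - 1..y} f) has_vector_derivative (0 + f x)) (at x within {x - 1..x + 1})"
    by (intro has_vector_derivative_add has_vector_derivative_const integral_has_vector_derivative
         continuous_on_subset[OF cont]) auto
  then have "((\<lambda>y. antider f (x - 1) + integral {x - 1..y} f) has_vector_derivative f x) (at x)"
    by (subst (asm) at_within_interior) auto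
  then show ?thesis
  proof (rule has_vector_derivative_transform_within_open[where S = "{x - 1<..<x + 1}"])
    fix y assume "y \<in> {x - 1<..<x + 1}"
    then show "antider f (x - 1) + integral {x - 1..y} f = antider f y"
      using integral_unique[OF has_integral_antider[OF int, of "x - 1" y]] by simp
  qed auto
qed

lemma antider_exp_bound:
  assumes cont: "continuous_on UNIV g" and bound: "\<And>t. norm (g t) \<le> D * exp (L * \<bar>t\<bar>)"
    and "L > 0" "D \<ge> 0"
  shows "norm (antider g x) \<le> D / L * exp (L * \<bar>x\<bar>)"
proof -
  have int: "g integrable_on {a..b}" for a b
    by (intro integrable_continuous_real continuous_on_subset[OF cont]) auto
  show ?thesis
  proof (cases "0 \<le> x")
    case True
    have "((\<lambda>t. D * exp (L * t)) has_integral (D / L * exp (L * x) - D / L * exp (L * 0))) {0..x}"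
      using True \<open>L > 0\<close>
      by (intro fundamental_theorem_of_calculus)
        (auto simp flip: has_real_derivative_iff_has_vector_derivative intro!: derivative_eq_intros)
    note I = this
    have "norm (integral {0..x} g) \<le> integral {0..x} (\<lambda>t. D * exp (L * t))"
    proof (rule integral_norm_bound_integral[OF int has_integral_integrable[OF I]])
      show "norm (g t) \<le> D * exp (L * t)" if "t \<in> {0..x}" for t using bound[of t] that by simp
    qed
    also have "\<dots> = D / L * exp (L * x) - D / L * exp (L * 0)" by (rule integral_unique[OF I])
    finally show ?thesis using True \<open>L > 0\<close> \<open>D \<ge> 0\<close> by (simp add: antider_def) (smt (verit) divide_nonneg_pos)
  next
    case False
    have "((\<lambda>t. D * exp (- L * t)) has_integral (- D / L * exp (- L * 0) - (- D / L * exp (- L * x)))) {x..0}"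
      using False \<open>L > 0\<close>
      by (intro fundamental_theorem_of_calculus)
        (auto simp flip: has_real_derivative_iff_has_vector_derivative intro!: derivative_eq_intros)
    note I = this
    have "norm (integral {x..0} g) \<le> integral {x..0} (\<lambda>t. D * exp (- L * t))"
    proof (rule integral_norm_bound_integral[OF int has_integral_integrable[OF I]])
      show "norm (g t) \<le> D * exp (- L * t)" if "t \<in> {x..0}" for t using bound[of t] that by simp
    qed
    also have "\<dots> = - D / L * exp (- L * 0) - (- D / L * exp (- L * x))" by (rule integral_unique[OF I])
    finally show ?thesis using False \<open>L > 0\<close> \<open>D \<ge> 0\<close> by (simp add: antider_def) (smt (verit) divide_nonneg_pos)
  qed
qed

text \<open>
  Weighting with \<open>exp (- L * \<bar>x\<bar>)\<close> makes the Volterra operator a contraction on the bounded continuous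
  functions on the whole line as soon as \<open>L\<close> exceeds the Lipschitz constant \<open>K\<close>: the factor is
  \<open>K / L\<close>. Thus a single application of Banach's fixed point theorem gives a global solution.
  The inhomogeneity \<open>G\<close> is merely continuous, so that it can be the antiderivative of a square
  integrable function.
\<close>

lemma linear_Volterra_solution:
  fixes M :: "real \<Rightarrow> 'a::banach \<Rightarrow> 'a"
  assumes cont: "\<And>\<phi>. continuous_on UNIV \<phi> \<Longrightarrow> continuous_on UNIV (\<lambda>t. M t (\<phi> t))"
    and lip: "\<And>t x y. norm (M t x - M t y) \<le> K * norm (x - y)" and M0: "\<And>t. M t 0 = 0"
    and K: "0 \<le> K" "K < L"
    and G: "continuous_on UNIV G" "\<And>x. norm (G x) \<le> C * exp (L * \<bar>x\<bar>)"
  obtains \<Psi> where "continuous_on UNIV \<Psi>" "\<forall>x. \<Psi> x = G x + antider (\<lambda>t. M t (\<Psi> t)) x"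
proof -
  have L: "L > 0" using K by simp
  define m where "m \<phi> = (\<lambda>t. M t (exp (L * \<bar>t\<bar>) *\<^sub>R apply_bcontfun \<phi> t))" for \<phi>
  have mcont: "continuous_on UNIV (m \<phi>)" for \<phi>
    unfolding m_def by (intro cont continuous_intros continuous_on_apply_bcontfun)
  have mint: "m \<phi> integrable_on {a..b}" for \<phi> a b
    by (intro integrable_continuous_real continuous_on_subset[OF mcont]) auto
  have acont: "continuous_on UNIV (antider (m \<phi>))" for \<phi>
    using antider_has_vector_derivative[OF mcont]
    by (intro continuous_at_imp_continuous_on ballI has_vector_derivative_continuous) 
  define T where "T \<phi> = (\<lambda>x. exp (- L * \<bar>x\<bar>) *\<^sub>R (G x + antider (m \<phi>) x))" for \<phi>
  have diff: "norm (antider (m \<phi>) x - antider (m \<psi>) x) \<le> K * dist \<phi> \<psi> / L * exp (L * \<bar>x\<bar>)" for \<phi> \<psi> x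
  proof -
    have "antider (m \<phi>) x - antider (m \<psi>) x = antider (\<lambda>t. m \<phi> t - m \<psi> t) x"
      unfolding antider_def by (simp add: integral_diff mint)
    also have "norm \<dots> \<le> K * dist \<phi> \<psi> / L * exp (L * \<bar>x\<bar>)"
    proof (rule antider_exp_bound)
      show "continuous_on UNIV (\<lambda>t. m \<phi> t - m \<psi> t)" by (intro continuous_intros mcont)
      fix t
      have "norm (m \<phi> t - m \<psi> t) \<le> K * norm (exp (L * \<bar>t\<bar>) *\<^sub>R apply_bcontfun \<phi> t - exp (L * \<bar>t\<bar>) *\<^sub>R apply_bcontfun \<psi> t)"
        unfolding m_def by (rule lip)
      also have "\<dots> = K * (exp (L * \<bar>t\<bar>) * dist (apply_bcontfun \<phi> t) (apply_bcontfun \<psi> t))"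
        by (simp add: dist_norm flip: scaleR_diff_right)
      also have "\<dots> \<le> K * (exp (L * \<bar>t\<bar>) * dist \<phi> \<psi>)"
        by (intro mult_left_mono dist_bounded) (auto simp: K)
      finally show "norm (m \<phi> t - m \<psi> t) \<le> K * dist \<phi> \<psi> * exp (L * \<bar>t\<bar>)" by (simp add: algebra_simps)
    qed (use L K in auto)
    finally show ?thesis .
  qed
  have m0: "m 0 = (\<lambda>t. 0)" by (simp add: m_def M0)
  have bound: "norm (antider (m \<phi>) x) \<le> K * dist \<phi> 0 / L * exp (L * \<bar>x\<bar>)" for \<phi> x
    using diff[of \<phi> x 0] by (simp add: m0 antider_def split: if_splits)
  have Tb: "T \<phi> \<in> bcontfun" for \<phi>
  proof (rule bcontfun_normI)
    show "continuous_on UNIV (T \<phi>)" unfolding T_def by (intro continuous_intros G acont)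
    fix x
    have "norm (T \<phi> x) = exp (- L * \<bar>x\<bar>) * norm (G x + antider (m \<phi>) x)" by (simp add: T_def)
    also have "\<dots> \<le> exp (- L * \<bar>x\<bar>) * (C * exp (L * \<bar>x\<bar>) + K * dist \<phi> 0 / L * exp (L * \<bar>x\<bar>))"
      by (intro mult_left_mono norm_triangle_le add_mono G bound) auto
    also have "\<dots> = C + K * dist \<phi> 0 / L" by (simp add: exp_minus field_simps)
    finally show "norm (T \<phi> x) \<le> C + K * dist \<phi> 0 / L" .
  qed
  define TT where "TT \<phi> = Bcontfun (T \<phi>)" for \<phi>
  have TT: "apply_bcontfun (TT \<phi>) = T \<phi>" for \<phi>
    unfolding TT_def using Tb by (rule Bcontfun_inverse)
  have "dist (TT \<phi>) (TT \<psi>) \<le> (K / L) * dist \<phi> \<psi>" for \<phi> \<psi>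
  proof (rule dist_bound)
    fix x
    have "dist (TT \<phi> x) (TT \<psi> x) = exp (- L * \<bar>x\<bar>) * norm (antider (m \<phi>) x - antider (m \<psi>) x)"
      by (simp add: TT T_def dist_norm flip: scaleR_diff_right)
    also have "\<dots> \<le> exp (- L * \<bar>x\<bar>) * (K * dist \<phi> \<psi> / L * exp (L * \<bar>x\<bar>))"
      by (intro mult_left_mono diff) auto
    also have "\<dots> = (K / L) * dist \<phi> \<psi>" by (simp add: exp_minus field_simps)
    finally show "dist (TT \<phi> x) (TT \<psi> x) \<le> (K / L) * dist \<phi> \<psi>" .
  qed
  then have "\<exists>!\<phi>. TT \<phi> = \<phi>"
    using K L by (intro banach_fix_type[of "K / L"]) auto
  then obtain \<phi> where \<phi>: "TT \<phi> = \<phi>" by blast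
  define \<Psi> where "\<Psi> = (\<lambda>x. exp (L * \<bar>x\<bar>) *\<^sub>R apply_bcontfun \<phi> x)"
  show ?thesis
  proof
    show "continuous_on UNIV \<Psi>" unfolding \<Psi>_def by (intro continuous_intros continuous_on_apply_bcontfun)
    show "\<forall>x. \<Psi> x = G x + antider (\<lambda>t. M t (\<Psi> t)) x"
    proof
    fix x
    have "\<Psi> x = exp (L * \<bar>x\<bar>) *\<^sub>R T \<phi> x" unfolding \<Psi>_def using TT[of \<phi>] \<phi> by simp
    also have "\<dots> = G x + antider (m \<phi>) x" by (simp add: T_def exp_minus)
    also have "m \<phi> = (\<lambda>t. M t (\<Psi> t))" by (simp add: m_def \<Psi>_def)
    finally show "\<Psi> x = G x + antider (\<lambda>t. M t (\<Psi> t)) x" .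
    qed
  qed
qed

definition sq_int :: "(real \<Rightarrow> complex) \<Rightarrow> bool" where
  "sq_int f \<longleftrightarrow> f \<in> borel_measurable lebesgue \<and> integrable lebesgue (\<lambda>x. (norm (f x))\<^sup>2)"

lemma sq_int_absolutely_integrable:
  assumes "sq_int f"
  shows "f absolutely_integrable_on {a..b}"
  unfolding set_integrable_def
proof (rule Bochner_Integration.integrable_bound)
  show "integrable lebesgue (\<lambda>x. indicator {a..b} x + (norm (f x))\<^sup>2 :: real)"
    using assms by (intro Bochner_Integration.integrable_add integrable_real_indicator) (auto simp: sq_int_def emeasure_lborel_Icc_eq)
  show "(\<lambda>x. indicator {a..b} x *\<^sub>R f x) \<in> borel_measurable lebesgue"
    using assms by (auto simp: sq_int_def intro!: borel_measurable_scaleR borel_measurable_indicator)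
  have "norm (indicator {a..b} x *\<^sub>R f x) \<le> norm (indicator {a..b} x + (norm (f x))\<^sup>2 :: real)" for x
  proof -
    have "2 * norm (f x) \<le> (norm (f x))\<^sup>2 + 1" using sum_squares_bound[of "norm (f x)" 1] by simp
    moreover have "0 \<le> (norm (f x))\<^sup>2" by simp
    ultimately have "norm (f x) \<le> 1 + (norm (f x))\<^sup>2" by linarith
    then show ?thesis by (auto simp: indicator_def)
  qed
  then show "AE x in lebesgue. norm (indicator {a..b} x *\<^sub>R f x) \<le> norm (indicator {a..b} x + (norm (f x))\<^sup>2 :: real)"
    by simp
qed

lemma sq_int_integrable_on: "sq_int f \<Longrightarrow> f integrable_on {a..b}"
  using sq_int_absolutely_integrable set_lebesgue_integral_eq_integral(1) by blast

lemma sq_int_square_absolutely_integrable: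
  assumes "sq_int f" "S \<in> sets lebesgue"
  shows "(\<lambda>x. (norm (f x))\<^sup>2) absolutely_integrable_on S"
  using assms integrable_mult_indicator[OF assms(2), of "\<lambda>x. (norm (f x))\<^sup>2"]
  by (simp add: set_integrable_def sq_int_def)

text \<open>
  The pointwise bound \<open>2 * norm (f x) \<le> t + (norm (f x))\<^sup>2 / t\<close>, integrated. The parameter \<open>t\<close> trades the
  length of the interval against the mass of \<open>f\<close>, which yields absolute continuity of the
  antiderivative.
\<close>

lemma antider_increment_bound:
  assumes f: "sq_int f" and "u \<le> v" and t: "t > 0"
  shows "norm (antider f v - antider f u) \<le> t / 2 * (v - u) + integral {u..v} (\<lambda>x. (norm (f x))\<^sup>2) / (2 * t)"
proof -
  have 1: "(f has_integral (antider f v - antider f u)) {u..v}"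
    by (intro has_integral_antider sq_int_integrable_on f \<open>u \<le> v\<close>)
  have "(\<lambda>x. (norm (f x))\<^sup>2) integrable_on {u..v}"
    by (rule set_lebesgue_integral_eq_integral(1)[OF sq_int_square_absolutely_integrable[OF f]]) simp
  then have "((\<lambda>x. t / 2 + (1 / (2 * t)) * (norm (f x))\<^sup>2) has_integral
      (t / 2 * (v - u) + (1 / (2 * t)) * integral {u..v} (\<lambda>x. (norm (f x))\<^sup>2))) {u..v}"
    using has_integral_const_real[of "t / 2" u v] \<open>u \<le> v\<close>
    by (intro has_integral_add has_integral_mult_right integrable_integral) (auto simp: mult.commute)
  note 2 = this
  have "norm (integral {u..v} f) \<le> integral {u..v} (\<lambda>x. t / 2 + (1 / (2 * t)) * (norm (f x))\<^sup>2)"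
  proof (rule integral_norm_bound_integral)
    show "f integrable_on {u..v}" "(\<lambda>x. t / 2 + (1 / (2 * t)) * (norm (f x))\<^sup>2) integrable_on {u..v}"
      using 1 2 by (auto simp: has_integral_integrable)
    fix x
    have "2 * (norm (f x) * t) \<le> (norm (f x))\<^sup>2 + t\<^sup>2" using sum_squares_bound[of "norm (f x)" t] by simp
    then show "norm (f x) \<le> t / 2 + (1 / (2 * t)) * (norm (f x))\<^sup>2"
      using t by (simp add: field_simps power2_eq_square)
  qed
  then show ?thesis using 1 2 by (simp add: integral_unique)
qed

lemma sum_integral_squares_le:
  assumes f: "sq_int f" and no: "nonoverlapping I u v"
  shows "(\<Sum>i\<in>I. integral {u i..v i} (\<lambda>x. (norm (f x))\<^sup>2)) \<le> (LINT x|lebesgue. (norm (f x))\<^sup>2)"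
proof -
  have fin: "finite I" and dis: "disjoint_family_on (\<lambda>i. {u i<..<v i}) I"
    using no by (auto simp: nonoverlapping_def)
  have int: "integrable lebesgue (\<lambda>x. indicator {u i<..<v i} x * (norm (f x))\<^sup>2)" for i
    using sq_int_square_absolutely_integrable[OF f, of "{u i<..<v i}"] by (simp add: set_integrable_def)
  have "integral {u i..v i} (\<lambda>x. (norm (f x))\<^sup>2) = (LINT x|lebesgue. indicator {u i<..<v i} x * (norm (f x))\<^sup>2)" for i
    using set_lebesgue_integral_eq_integral(2)[OF sq_int_square_absolutely_integrable[OF f, of "{u i<..<v i}"]]
    by (simp add: set_lebesgue_integral_def integral_open_interval_real)
  then have "(\<Sum>i\<in>I. integral {u i..v i} (\<lambda>x. (norm (f x))\<^sup>2)) =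
      (LINT x|lebesgue. (\<Sum>i\<in>I. indicator {u i<..<v i} x * (norm (f x))\<^sup>2))"
    using int by (simp add: Bochner_Integration.integral_sum)
  also have "\<dots> \<le> (LINT x|lebesgue. (norm (f x))\<^sup>2)"
  proof (rule integral_mono)
    show "integrable lebesgue (\<lambda>x. \<Sum>i\<in>I. indicator {u i<..<v i} x * (norm (f x))\<^sup>2)"
      using int by (intro Bochner_Integration.integrable_sum)
    show "integrable lebesgue (\<lambda>x. (norm (f x))\<^sup>2)" using f by (simp add: sq_int_def)
    fix x
    have "(\<Sum>i\<in>I. indicator {u i<..<v i} x :: real) = indicator (\<Union>i\<in>I. {u i<..<v i}) x"
      by (rule indicator_UN_disjoint[OF fin dis, symmetric])
    also have "\<dots> \<le> 1" by (simp add: indicator_le_1)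
    finally have "(\<Sum>i\<in>I. indicator {u i<..<v i} x) * (norm (f x))\<^sup>2 \<le> 1 * (norm (f x))\<^sup>2"
      by (intro mult_right_mono) auto
    then show "(\<Sum>i\<in>I. indicator {u i<..<v i} x * (norm (f x))\<^sup>2) \<le> (norm (f x))\<^sup>2"
      by (simp add: sum_distrib_right)
  qed
  finally show ?thesis .
qed

lemma ac_loc_antider:
  assumes f: "sq_int f"
  shows "ac_loc (antider f)"
  unfolding ac_loc_def absolutely_continuous_on_interval_def
proof (intro allI impI)
  fix a b e :: real assume e: "e > 0"
  define J where "J = (LINT x|lebesgue. (norm (f x))\<^sup>2)"
  have J: "J \<ge> 0" by (simp add: J_def)
  \<comment> \<open>This makes the mass term below \<open>e / 2\<close>, whatever the total mass \<open>J\<close> is.\<close>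
  define t where "t = (J + 1) / e"
  have t: "t > 0" "J / (2 * t) < e / 2" using J e by (auto simp: t_def field_simps)
  show "\<exists>\<delta>>0. \<forall>(n::nat) u v. (\<forall>k<n. a \<le> u k \<and> u k \<le> v k \<and> v k \<le> b) \<longrightarrow>
       disjoint_family_on (\<lambda>k. {u k<..<v k}) {..<n} \<longrightarrow>
       (\<Sum>k<n. v k - u k) < \<delta> \<longrightarrow> (\<Sum>k<n. norm (antider f (v k) - antider f (u k))) < e"
  proof (intro exI[of _ "e / t"] conjI allI impI)
    show "e / t > 0" using e t by simp
    fix n :: nat and u v :: "nat \<Rightarrow> real"
    assume uv: "\<forall>k<n. a \<le> u k \<and> u k \<le> v k \<and> v k \<le> b"
      and dis: "disjoint_family_on (\<lambda>k. {u k<..<v k}) {..<n}" and lt: "(\<Sum>k<n. v k - u k) < e / t"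
    have no: "nonoverlapping {..<n} u v" using uv dis by (auto simp: nonoverlapping_def)
    have "(\<Sum>k<n. norm (antider f (v k) - antider f (u k))) \<le>
      (\<Sum>k<n. t / 2 * (v k - u k) + integral {u k..v k} (\<lambda>x. (norm (f x))\<^sup>2) / (2 * t))"
      using uv t by (intro sum_mono antider_increment_bound f) auto
    also have "\<dots> = t / 2 * (\<Sum>k<n. v k - u k) + (\<Sum>k<n. integral {u k..v k} (\<lambda>x. (norm (f x))\<^sup>2)) / (2 * t)"
      by (simp add: sum.distrib sum_distrib_left sum_divide_distrib)
    also have "\<dots> \<le> t / 2 * (e / t) + J / (2 * t)"
      unfolding J_def using t lt sum_integral_squares_le[OF f no]
      by (intro add_mono mult_left_mono divide_right_mono) auto
    also have "\<dots> < e" using t by (simp add: field_simps)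
    finally show "(\<Sum>k<n. norm (antider f (v k) - antider f (u k))) < e" .
  qed
qed

lemma antider_AE_has_vector_derivative:
  assumes f: "sq_int f"
  shows "AE x in lebesgue. (antider f has_vector_derivative f x) (at x)"
  by (intro ac_loc_AE_derivative_if_integral ac_loc_antider has_integral_antider sq_int_integrable_on f)

lemma antider_linear_bound:
  assumes f: "sq_int f"
  shows "norm (antider f x) \<le> \<bar>x\<bar> + (LINT x|lebesgue. (norm (f x))\<^sup>2)"
proof -
  define J where "J = (LINT x|lebesgue. (norm (f x))\<^sup>2)"
  have le: "integral {u..v} (\<lambda>x. (norm (f x))\<^sup>2) \<le> J" if "u \<le> v" for u v
    using sum_integral_squares_le[OF f, of "{()}" "\<lambda>_. u" "\<lambda>_. v"] that
    by (simp add: J_def nonoverlapping_def disjoint_family_on_def)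
  have J: "0 \<le> J" by (simp add: J_def)
  show ?thesis
  proof (cases "0 \<le> x")
    case True
    then show ?thesis unfolding J_def[symmetric] using antider_increment_bound[OF f, of 0 x 1] le[of 0 x] J by simp
  next
    case False
    then show ?thesis unfolding J_def[symmetric] using antider_increment_bound[OF f, of x 0 1] le[of x 0] J by simp
  qed
qed

section \<open>Planar linear systems with square integrable forcing\<close>

lemma ac_loc_C1:
  fixes f :: "real \<Rightarrow> 'a::banach"
  assumes "\<And>x. (f has_vector_derivative f' x) (at x)" "continuous_on UNIV f'"
  shows "ac_loc f"
proof (rule ac_loc_dominated[OF ac_loc_id ac_loc_id])
  fix a b :: real
  have "compact (f' ` {a..b})"
    by (intro compact_continuous_image continuous_on_subset[OF assms(2)]) auto
  then have "bounded (f' ` {a..b})" by (rule compact_imp_bounded)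
  then obtain M where M: "\<forall>x\<in>{a..b}. norm (f' x) \<le> M" by (auto simp: bounded_iff)
  show "\<exists>K. \<forall>u\<in>{a..b}. \<forall>v\<in>{a..b}. u \<le> v \<longrightarrow> norm (f v - f u) \<le> K * (norm (v - u) + norm (v - u))"
  proof (intro exI[of _ "M / 2"] ballI impI)
    fix u v assume uv: "u \<in> {a..b}" "v \<in> {a..b}" "u \<le> v"
    have "norm (f v - f u) \<le> M * norm (v - u)"
    proof (rule differentiable_bound[of "{u..v}" f "\<lambda>x h. h *\<^sub>R f' x"])
      show "(f has_derivative (\<lambda>h. h *\<^sub>R f' x)) (at x within {u..v})" for x
        using assms(1)[of x] unfolding has_vector_derivative_def by (rule has_derivative_at_withinI)
      show "onorm (\<lambda>h. h *\<^sub>R f' x) \<le> M" if "x \<in> {u..v}" for x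
      proof -
        have "norm (f' x) \<le> M" using M uv that by auto
        then show ?thesis
          by (intro onorm_le) (simp add: mult.commute[of M] mult_left_mono)
      qed
    qed (use uv in auto)
    then show "norm (f v - f u) \<le> M / 2 * (norm (v - u) + norm (v - u))" by simp
  qed
qed

text \<open>
  The systems \<open>a' = al * a + be * b + f\<close>, \<open>b' = ga * a + de * b + g\<close> with bounded continuous
  coefficients.
\<close>

locale planar_system =
  fixes al be ga de :: "real \<Rightarrow> complex" and K0 :: real
  assumes cont: "continuous_on UNIV al" "continuous_on UNIV be" "continuous_on UNIV ga" "continuous_on UNIV de"
    and bounded: "\<And>x. norm (al x) \<le> K0" "\<And>x. norm (be x) \<le> K0" "\<And>x. norm (ga x) \<le> K0" "\<And>x. norm (de x) \<le> K0"
begin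

definition sol :: "(real \<Rightarrow> complex) \<Rightarrow> (real \<Rightarrow> complex) \<Rightarrow> (real \<Rightarrow> complex) \<Rightarrow> (real \<Rightarrow> complex) \<Rightarrow> bool" where
  "sol f g a b \<longleftrightarrow> ac_loc a \<and> ac_loc b \<and>
     (AE x in lebesgue. (a has_vector_derivative (al x * a x + be x * b x + f x)) (at x) \<and>
                        (b has_vector_derivative (ga x * a x + de x * b x + g x)) (at x))"

lemma K0_nonneg: "K0 \<ge> 0"
  using bounded(1)[of 0] norm_ge_zero order_trans by blast

lemma sol_continuous:
  assumes "sol f g a b"
  shows "continuous_on S a" "continuous_on S b"
  using assms ac_loc_continuous_on continuous_on_subset[of UNIV _ S] unfolding sol_def by blast+

text \<open>
  In integrated form this is a Volterra equation whose inhomogeneity, built from the antiderivatives of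
  \<open>f\<close> and \<open>g\<close>, is continuous.
\<close>

lemma sol_exists:
  assumes f: "sq_int f" and g: "sq_int g"
  shows "\<exists>a b. sol f g a b \<and> a 0 = a0 \<and> b 0 = b0"
proof -
  define M where "M t z = (al t * fst z + be t * snd z, ga t * fst z + de t * snd z)" for t z
  define G where "G x = (a0 + antider f x, b0 + antider g x)" for x
  define J where "J = (LINT x|lebesgue. (norm (f x))\<^sup>2) + (LINT x|lebesgue. (norm (g x))\<^sup>2)"
  have J: "J \<ge> 0" by (simp add: J_def)
  have Mcont: "continuous_on UNIV (\<lambda>t. M t (\<phi> t))" if "continuous_on UNIV \<phi>" for \<phi>
    unfolding M_def by (intro continuous_intros cont that)
  have bd: "norm (u * x + v * y) \<le> K0 * (norm x + norm y)" if "norm u \<le> K0" "norm v \<le> K0" for u v x y :: complex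
  proof -
    have "norm (u * x + v * y) \<le> norm u * norm x + norm v * norm y" by (metis norm_mult norm_triangle_ineq)
    also have "\<dots> \<le> K0 * norm x + K0 * norm y" using that by (intro add_mono mult_right_mono) auto
    finally show ?thesis by (simp add: algebra_simps)
  qed
  have components_le: "norm (fst z) \<le> norm z" "norm (snd z) \<le> norm z" for z :: "complex \<times> complex"
    using norm_fst_le[of "fst z" "snd z"] norm_snd_le[of "snd z" "fst z"] by simp_all
  have lip: "norm (M t x - M t y) \<le> (4 * K0) * norm (x - y)" for t x y
  proof -
    have "M t x - M t y = (al t * fst (x - y) + be t * snd (x - y), ga t * fst (x - y) + de t * snd (x - y))"
      by (simp add: M_def algebra_simps)
    also have "norm \<dots> \<le> norm (al t * fst (x - y) + be t * snd (x - y)) + norm (ga t * fst (x - y) + de t * snd (x - y))"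
      by (rule norm_Pair_le)
    also have "\<dots> \<le> K0 * (norm (fst (x - y)) + norm (snd (x - y))) + K0 * (norm (fst (x - y)) + norm (snd (x - y)))"
      by (intro add_mono bd bounded)
    also have "\<dots> \<le> K0 * (norm (x - y) + norm (x - y)) + K0 * (norm (x - y) + norm (x - y))"
      by (intro add_mono mult_left_mono K0_nonneg components_le)
    finally show ?thesis by (simp add: algebra_simps)
  qed
  \<comment> \<open>One more than the Lipschitz constant, so that \<open>\<bar>x\<bar> \<le> exp (L * \<bar>x\<bar>)\<close> as well.\<close>
  define L where "L = 4 * K0 + 1"
  have Gb: "norm (G x) \<le> (norm a0 + norm b0 + J + 2) * exp (L * \<bar>x\<bar>)" for x
  proof -
    have "norm (G x) \<le> norm (a0 + antider f x) + norm (b0 + antider g x)"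
      unfolding G_def by (rule norm_Pair_le)
    also have "\<dots> \<le> (norm a0 + norm (antider f x)) + (norm b0 + norm (antider g x))"
      by (intro add_mono norm_triangle_ineq)
    also have "\<dots> \<le> (norm a0 + norm b0 + J) + 2 * \<bar>x\<bar>"
      using antider_linear_bound[OF f, of x] antider_linear_bound[OF g, of x] by (simp add: J_def)
    also have "\<dots> \<le> (norm a0 + norm b0 + J) * exp (L * \<bar>x\<bar>) + 2 * exp (L * \<bar>x\<bar>)"
    proof (intro add_mono mult_left_mono)
      have "\<bar>x\<bar> \<le> L * \<bar>x\<bar>" using K0_nonneg by (simp add: L_def algebra_simps)
      also have "\<dots> \<le> exp (L * \<bar>x\<bar>)" using exp_ge_add_one_self[of "L * \<bar>x\<bar>"] by linarith
      finally show "\<bar>x\<bar> \<le> exp (L * \<bar>x\<bar>)" .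
      have "1 \<le> exp (L * \<bar>x\<bar>)" using K0_nonneg by (simp add: L_def)
      then show "norm a0 + norm b0 + J \<le> (norm a0 + norm b0 + J) * exp (L * \<bar>x\<bar>)"
        using mult_left_mono[of 1 "exp (L * \<bar>x\<bar>)" "norm a0 + norm b0 + J"] J by simp
    qed simp
    finally show ?thesis by (simp add: algebra_simps)
  qed
  have Gc: "continuous_on UNIV G"
    unfolding G_def
    by (intro continuous_intros ac_loc_continuous_on ac_loc_antider f g)
  have L1: "0 \<le> 4 * K0" "4 * K0 < L" "M t 0 = 0" for t using K0_nonneg by (auto simp: L_def M_def zero_prod_def)
  obtain \<Psi> where \<Psi>: "continuous_on UNIV \<Psi>" "\<forall>x. \<Psi> x = G x + antider (\<lambda>t. M t (\<Psi> t)) x"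
    by (rule linear_Volterra_solution[OF Mcont lip L1(3,1,2) Gc Gb]; (assumption | rule that))
  define H where "H = antider (\<lambda>t. M t (\<Psi> t))"
  have HD: "(H has_vector_derivative M x (\<Psi> x)) (at x)" for x
    unfolding H_def by (rule antider_has_vector_derivative[OF Mcont[OF \<Psi>(1)]])
  have ab: "fst (\<Psi> x) = a0 + antider f x + fst (H x)" "snd (\<Psi> x) = b0 + antider g x + snd (H x)" for x
    using spec[OF \<Psi>(2), of x] by (auto simp: G_def H_def)
  have H1: "((\<lambda>x. fst (H x)) has_vector_derivative fst (M x (\<Psi> x))) (at x)"
    and H2: "((\<lambda>x. snd (H x)) has_vector_derivative snd (M x (\<Psi> x))) (at x)" for x
    by (rule bounded_linear.has_vector_derivative[OF bounded_linear_fst HD]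
        bounded_linear.has_vector_derivative[OF bounded_linear_snd HD])+
  have acH: "ac_loc (\<lambda>x. fst (H x))" "ac_loc (\<lambda>x. snd (H x))"
    by (rule ac_loc_C1[OF H1] ac_loc_C1[OF H2]; intro continuous_intros Mcont \<Psi>(1))+
  have "sol f g (\<lambda>x. fst (\<Psi> x)) (\<lambda>x. snd (\<Psi> x))"
    unfolding sol_def
  proof (intro conjI)
    show "ac_loc (\<lambda>x. fst (\<Psi> x))" "ac_loc (\<lambda>x. snd (\<Psi> x))"
      unfolding ab by (intro ac_loc_add ac_loc_const ac_loc_antider f g acH)+
    have "AE x in lebesgue. (antider f has_vector_derivative f x) (at x)"
      "AE x in lebesgue. (antider g has_vector_derivative g x) (at x)"
      by (intro antider_AE_has_vector_derivative f g)+
    then show "AE x in lebesgue. ((\<lambda>x. fst (\<Psi> x)) has_vector_derivative al x * fst (\<Psi> x) + be x * snd (\<Psi> x) + f x) (at x) \<and>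
       ((\<lambda>x. snd (\<Psi> x)) has_vector_derivative ga x * fst (\<Psi> x) + de x * snd (\<Psi> x) + g x) (at x)"
    proof eventually_elim
      case (elim x)
      have "((\<lambda>x. a0 + antider f x + fst (H x)) has_vector_derivative 0 + f x + fst (M x (\<Psi> x))) (at x)"
        "((\<lambda>x. b0 + antider g x + snd (H x)) has_vector_derivative 0 + g x + snd (M x (\<Psi> x))) (at x)"
        by (intro has_vector_derivative_add has_vector_derivative_const elim H1 H2)+
      then show ?case unfolding ab[symmetric] by (simp add: M_def add.commute)
    qed
  qed
  moreover have "fst (\<Psi> 0) = a0" "snd (\<Psi> 0) = b0" using spec[OF \<Psi>(2), of 0] by (auto simp: G_def)
  ultimately show ?thesis by blast
qed

lemma sol_add_mult:
  assumes "sol f g a b" "sol f' g' a' b'"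
  shows "sol (\<lambda>x. f x + c * f' x) (\<lambda>x. g x + c * g' x) (\<lambda>x. a x + c * a' x) (\<lambda>x. b x + c * b' x)"
  unfolding sol_def
proof (intro conjI)
  show "ac_loc (\<lambda>x. a x + c * a' x)" "ac_loc (\<lambda>x. b x + c * b' x)"
    using assms by (auto simp: sol_def intro!: ac_loc_add ac_loc_mult ac_loc_const)
  have "AE x in lebesgue. (a has_vector_derivative (al x * a x + be x * b x + f x)) (at x) \<and>
                        (b has_vector_derivative (ga x * a x + de x * b x + g x)) (at x)"
    "AE x in lebesgue. (a' has_vector_derivative (al x * a' x + be x * b' x + f' x)) (at x) \<and>
                        (b' has_vector_derivative (ga x * a' x + de x * b' x + g' x)) (at x)"
    using assms by (auto simp: sol_def)
  then show "AE x in lebesgue. ((\<lambda>x. a x + c * a' x) has_vector_derivative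
           al x * (a x + c * a' x) + be x * (b x + c * b' x) + (f x + c * f' x)) (at x) \<and>
       ((\<lambda>x. b x + c * b' x) has_vector_derivative
           ga x * (a x + c * a' x) + de x * (b x + c * b' x) + (g x + c * g' x)) (at x)"
  proof eventually_elim
    case (elim x)
    have "((\<lambda>x. a x + c * a' x) has_vector_derivative (al x * a x + be x * b x + f x) + c * (al x * a' x + be x * b' x + f' x)) (at x)"
      "((\<lambda>x. b x + c * b' x) has_vector_derivative (ga x * a x + de x * b x + g x) + c * (ga x * a' x + de x * b' x + g' x)) (at x)"
      using elim by (intro has_vector_derivative_add has_vector_derivative_mult_right; simp)+
    then show ?case by (simp add: algebra_simps)
  qed
qed

end

lemma integrable_if_interval_integrals_bounded:
  fixes N :: "real \<Rightarrow> real"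
  assumes cont: "continuous_on UNIV N" and nonneg: "\<And>x. N x \<ge> 0"
    and bound: "\<And>n. integral {- real n..real n} N \<le> C"
  shows "integrable lebesgue N" "(LINT x|lebesgue. N x) \<le> C"
proof -
  define u where "u n = (\<lambda>x. indicator {- real n..real n} x * N x)" for n :: nat
  have ai: "N absolutely_integrable_on {a..b}" for a b
    by (intro nonnegative_absolutely_integrable_1 integrable_continuous_real continuous_on_subset[OF cont])
      (auto simp: nonneg)
  have int: "integrable lebesgue (u n)" for n
    using ai unfolding u_def set_integrable_def by simp
  have eq: "integral\<^sup>L lebesgue (u n) = integral {- real n..real n} N" for n
    using set_lebesgue_integral_eq_integral(2)[OF ai] unfolding u_def set_lebesgue_integral_def by simp
  have mono: "u m x \<le> u n x" if "m \<le> n" for m n x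
    using that nonneg by (auto simp: u_def indicator_def)
  have "incseq (\<lambda>n. integral\<^sup>L lebesgue (u n))"
    by (intro incseq_SucI integral_mono int mono) auto
  moreover have "\<And>n. integral\<^sup>L lebesgue (u n) \<le> C" using bound eq by simp
  ultimately obtain l where l: "(\<lambda>n. integral\<^sup>L lebesgue (u n)) \<longlonglongrightarrow> l" "\<forall>n. integral\<^sup>L lebesgue (u n) \<le> l"
    using incseq_convergent by blast
  have lim: "(\<lambda>n. u n x) \<longlonglongrightarrow> N x" for x
  proof (rule tendsto_eventually)
    obtain n0 :: nat where "\<bar>x\<bar> \<le> real n0" using real_arch_simple by blast
    then have "u n x = N x" if "n \<ge> n0" for n
      using that by (auto simp: u_def indicator_def)
    then show "\<forall>\<^sub>F n in sequentially. u n x = N x" using eventually_sequentially by blast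
  qed
  have meas: "N \<in> borel_measurable lebesgue"
    using borel_measurable_continuous_onI[OF cont] by (simp add: measurable_completion)
  have *: "AE x in lebesgue. mono (\<lambda>n. u n x)" "AE x in lebesgue. (\<lambda>n. u n x) \<longlonglongrightarrow> N x"
    using mono lim by (auto simp: mono_def)
  show "integrable lebesgue N"
    by (rule integrable_monotone_convergence[OF int * l(1) meas])
  have "(LINT x|lebesgue. N x) = l"
    by (rule integral_monotone_convergence[OF int * l(1) meas])
  also have "l \<le> C"
    using l(1) by (rule LIMSEQ_le_const2) (use bound eq in auto)
  finally show "(LINT x|lebesgue. N x) \<le> C" .
qed

lemma integral_le_lebesgue_integral:
  fixes N :: "real \<Rightarrow> real"
  assumes "integrable lebesgue N" "\<And>x. N x \<ge> 0"
  shows "integral {a..b} N \<le> (LINT x|lebesgue. N x)"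
proof -
  have ai: "N absolutely_integrable_on {a..b}"
    using integrable_mult_indicator[OF _ assms(1), of "{a..b}"] by (simp add: set_integrable_def)
  have "integral {a..b} N = (LINT x|lebesgue. indicator {a..b} x * N x)"
    using set_lebesgue_integral_eq_integral(2)[OF ai] by (simp add: set_lebesgue_integral_def)
  also have "\<dots> \<le> (LINT x|lebesgue. N x)"
    using ai assms by (intro integral_mono) (auto simp: set_integrable_def indicator_def)
  finally show ?thesis .
qed

text \<open>
  Integrability does not force convergence to \<open>0\<close> at infinity, but it does give points arbitrarily far
  out where the function is small; this is enough to discard boundary terms.
\<close>

lemma integrable_small_values:
  fixes N :: "real \<Rightarrow> real"
  assumes int: "integrable lebesgue N" and nonneg: "\<And>x. N x \<ge> 0" and e: "e > 0"
  shows "\<exists>y\<ge>n. N y < e" "\<exists>x\<le>n. N x < e"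
proof -
  define J where "J = (LINT x|lebesgue. N x)"
  have long: "\<exists>x\<in>{a..a + l}. N x < e" if l: "l > 0" "e * l > J" for a l
  proof (rule ccontr)
    assume "\<not> ?thesis"
    then have ge: "e \<le> N x" if "x \<in> {a..a + l}" for x using that by (meson not_le)
    have ai: "N absolutely_integrable_on {a..a + l}"
      using integrable_mult_indicator[OF _ int, of "{a..a + l}"] by (simp add: set_integrable_def)
    have "integral {a..a + l} (\<lambda>x. e) \<le> integral {a..a + l} N"
      using ge set_lebesgue_integral_eq_integral(1)[OF ai] by (intro integral_le) auto
    moreover have "integral {a..a + l} (\<lambda>x. e) = e * l" using l by simp
    ultimately have "e * l \<le> J"
      using integral_le_lebesgue_integral[OF int nonneg, of a "a + l"] unfolding J_def by linarith
    then show False using l(2) by linarith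
  qed
  define l where "l = (\<bar>J\<bar> + 1) / e"
  have l: "l > 0" "e * l > J" using e by (auto simp: l_def)
  show "\<exists>y\<ge>n. N y < e" using long[OF l, of n] by auto
  show "\<exists>x\<le>n. N x < e" using long[OF l, of "n - l"] by auto
qed

lemma linear_system_2_solvable:
  fixes p1 p2 q1 q2 r s :: complex
  assumes "\<And>c1 c2. p1 * c1 + p2 * c2 = 0 \<Longrightarrow> q1 * c1 + q2 * c2 = 0 \<Longrightarrow> c1 = 0 \<and> c2 = 0"
  shows "\<exists>c1 c2. p1 * c1 + p2 * c2 = r \<and> q1 * c1 + q2 * c2 = s"
proof -
  define D where "D = p1 * q2 - p2 * q1"
  \<comment> \<open>If the determinant vanished, its cofactors would solve the homogeneous equations.\<close>
  have "D \<noteq> 0"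
  proof
    assume D: "D = 0"
    have "p2 = 0 \<and> - p1 = 0" using D by (intro assms) (auto simp: D_def algebra_simps)
    moreover have "q2 = 0 \<and> - q1 = 0" using D by (intro assms) (auto simp: D_def algebra_simps)
    ultimately have "(1::complex) = 0 \<and> (0::complex) = 0" by (intro assms) auto
    then show False by simp
  qed
  then show ?thesis
    by (intro exI[of _ "(r * q2 - p2 * s) / D"] exI[of _ "(p1 * s - r * q1) / D"])
      (auto simp: field_simps, auto simp: D_def algebra_simps)
qed

section \<open>The energy estimate for an indefinite form with definite derivative\<close>

lemma Young_inequality_weighted:
  fixes s t k c :: real
  assumes "c > 0"
  shows "k * s * t \<le> c / 4 * s\<^sup>2 + k\<^sup>2 / c * t\<^sup>2"
proof -
  have "0 \<le> (c / 2 * s - k * t)\<^sup>2 / c" using assms by simp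
  also have "\<dots> = c / 4 * s\<^sup>2 + k\<^sup>2 / c * t\<^sup>2 - k * s * t"
    using assms by (simp add: power2_eq_square field_simps)
  finally show ?thesis by simp
qed

lemma square_of_sum_le: "(s + t)\<^sup>2 \<le> 2 * (s\<^sup>2 + t\<^sup>2)" for s t :: real
  using zero_le_power2[of "s - t"] by (simp add: power2_eq_square algebra_simps)

text \<open>
  The Hermitian form \<open>A * \<bar>a\<bar>\<^sup>2 - B * \<bar>b\<bar>\<^sup>2 + Re (m * a * cnj b)\<close> is indefinite on the coordinate axes because
  \<open>A\<close> and \<open>B\<close> have the same sign. The last assumption says that its derivative along solutions of the
  homogeneous system is bounded below by \<open>c * (\<bar>a\<bar>\<^sup>2 + \<bar>b\<bar>\<^sup>2)\<close>. This is a quantitative substitute for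
  an exponential dichotomy.
\<close>

locale lyapunov_system = planar_system +
  fixes A B :: real and m m' :: "real \<Rightarrow> complex" and Mb c :: real
  assumes AB: "A * B > 0" and m_ac: "ac_loc m" and m_bd: "\<And>x. norm (m x) \<le> Mb" and c: "c > 0"
    and m_deriv: "AE x in lebesgue. (m has_vector_derivative m' x) (at x)"
    and definite: "AE x in lebesgue. \<forall>a b. 
        2 * A * Re (cnj a * (al x * a + be x * b)) - 2 * B * Re (cnj b * (ga x * a + de x * b))
        + Re (m' x * a * cnj b + m x * (al x * a + be x * b) * cnj b + m x * a * cnj (ga x * a + de x * b))
        \<ge> c * ((norm a)\<^sup>2 + (norm b)\<^sup>2)"
begin

definition energy :: "real \<Rightarrow> complex \<Rightarrow> complex \<Rightarrow> real" where
  "energy x a b = A * (norm a)\<^sup>2 - B * (norm b)\<^sup>2 + Re (m x * a * cnj b)"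

definition form_bound :: real where "form_bound = 2 * \<bar>A\<bar> + 2 * \<bar>B\<bar> + Mb"

definition forcing_const :: real where "forcing_const = 2 * form_bound\<^sup>2 / c"

lemma Mb_nonneg: "Mb \<ge> 0" using m_bd[of 0] norm_ge_zero order_trans by blast

lemma energy_bound: "\<bar>energy x a b\<bar> \<le> form_bound * ((norm a)\<^sup>2 + (norm b)\<^sup>2)"
proof -
  have "\<bar>Re (m x * a * cnj b)\<bar> \<le> norm (m x * a * cnj b)" by (rule abs_Re_le_cmod)
  also have "\<dots> = norm (m x) * (norm a * norm b)" by (simp add: norm_mult)
  also have "\<dots> \<le> Mb * (norm a * norm b)" by (intro mult_right_mono m_bd) auto
  also have "\<dots> \<le> Mb * ((norm a)\<^sup>2 + (norm b)\<^sup>2)"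
  proof (intro mult_left_mono Mb_nonneg)
    have "norm a * norm b \<ge> 0" by simp
    then show "norm a * norm b \<le> (norm a)\<^sup>2 + (norm b)\<^sup>2"
      using sum_squares_bound[of "norm a" "norm b"] by linarith
  qed
  finally have "\<bar>Re (m x * a * cnj b)\<bar> \<le> Mb * ((norm a)\<^sup>2 + (norm b)\<^sup>2)" .
  moreover have "\<bar>A * (norm a)\<^sup>2\<bar> \<le> 2 * \<bar>A\<bar> * ((norm a)\<^sup>2 + (norm b)\<^sup>2)"
    unfolding abs_mult by (intro mult_mono) auto
  moreover have "\<bar>B * (norm b)\<^sup>2\<bar> \<le> 2 * \<bar>B\<bar> * ((norm a)\<^sup>2 + (norm b)\<^sup>2)"
    unfolding abs_mult by (intro mult_mono) auto
  ultimately show ?thesis unfolding energy_def form_bound_def distrib_right[of _ _ "_ + _"] by linarith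
qed

text \<open>
  The forcing changes the derivative of the energy by a term bilinear in \<open>(a, b)\<close> and \<open>(f, g)\<close>. Half of
  the lower bound \<open>c * (\<bar>a\<bar>\<^sup>2 + \<bar>b\<bar>\<^sup>2)\<close> absorbs it, at the price of a multiple of \<open>\<bar>f\<bar>\<^sup>2 + \<bar>g\<bar>\<^sup>2\<close>.
\<close>

lemma energy_derivative:
  assumes sol: "sol f g a b"
  shows "ac_loc (\<lambda>x. energy x (a x) (b x))"
    and "AE x in lebesgue. \<exists>D. ((\<lambda>x. energy x (a x) (b x)) has_real_derivative D) (at x) \<and>
      c / 2 * ((norm (a x))\<^sup>2 + (norm (b x))\<^sup>2) - forcing_const * ((norm (f x))\<^sup>2 + (norm (g x))\<^sup>2) \<le> D"
proof -
  define F where "F x = of_real A * (a x * cnj (a x)) - of_real B * (b x * cnj (b x)) + m x * a x * cnj (b x)" for x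
  have EF: "energy x (a x) (b x) = Re (F x)" for x
    by (simp add: energy_def F_def flip: complex_norm_square)
  have ac: "ac_loc a" "ac_loc b" using sol by (auto simp: sol_def)
  show "ac_loc (\<lambda>x. energy x (a x) (b x))"
    unfolding EF F_def
    by (intro ac_loc_Re ac_loc_add ac_loc_diff ac_loc_mult ac_loc_const ac_loc_cnj ac m_ac)
  have "AE x in lebesgue. (a has_vector_derivative (al x * a x + be x * b x + f x)) (at x) \<and>
                        (b has_vector_derivative (ga x * a x + de x * b x + g x)) (at x)"
    using sol by (auto simp: sol_def)
  with m_deriv definite
  show "AE x in lebesgue. \<exists>D. ((\<lambda>x. energy x (a x) (b x)) has_real_derivative D) (at x) \<and>
      c / 2 * ((norm (a x))\<^sup>2 + (norm (b x))\<^sup>2) - forcing_const * ((norm (f x))\<^sup>2 + (norm (g x))\<^sup>2) \<le> D"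
  proof eventually_elim
    case (elim x)
    define u where "u = al x * a x + be x * b x"
    define v where "v = ga x * a x + de x * b x"
    define F' where "F' = of_real A * (a x * cnj (u + f x) + (u + f x) * cnj (a x))
       - of_real B * (b x * cnj (v + g x) + (v + g x) * cnj (b x))
       + (m x * a x * cnj (v + g x) + (m x * (u + f x) + m' x * a x) * cnj (b x))"
    have da: "(a has_vector_derivative (u + f x)) (at x)" and db: "(b has_vector_derivative (v + g x)) (at x)"
      and dm: "(m has_vector_derivative m' x) (at x)"
      using elim by (auto simp: u_def v_def)
    have dac: "((\<lambda>x. cnj (a x)) has_vector_derivative cnj (u + f x)) (at x)"
      and dbc: "((\<lambda>x. cnj (b x)) has_vector_derivative cnj (v + g x)) (at x)"
      by (rule bounded_linear.has_vector_derivative[OF bounded_linear_cnj] da db)+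
    have "(F has_vector_derivative F') (at x)"
      unfolding F_def F'_def
      by (intro has_vector_derivative_add has_vector_derivative_diff has_vector_derivative_mult
          has_vector_derivative_mult_right da db dm dac dbc)
    then have "((\<lambda>x. energy x (a x) (b x)) has_real_derivative Re F') (at x)"
      unfolding EF by (simp add: has_vector_derivative_complex_iff)
    moreover have "c / 2 * ((norm (a x))\<^sup>2 + (norm (b x))\<^sup>2) - forcing_const * ((norm (f x))\<^sup>2 + (norm (g x))\<^sup>2) \<le> Re F'"
    proof -
      define n where "n = (norm (a x))\<^sup>2 + (norm (b x))\<^sup>2"
      define w where "w = (norm (f x))\<^sup>2 + (norm (g x))\<^sup>2"
      define r where "r = 2 * A * Re (cnj (a x) * f x) - 2 * B * Re (cnj (b x) * g x)
         + Re (m x * f x * cnj (b x)) + Re (m x * a x * cnj (g x))"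
      have split: "Re F' = (2 * A * Re (cnj (a x) * u) - 2 * B * Re (cnj (b x) * v)
          + Re (m' x * a x * cnj (b x) + m x * u * cnj (b x) + m x * a x * cnj v)) + r"
        unfolding F'_def r_def by (simp add: algebra_simps)
      have "c * n \<le> 2 * A * Re (cnj (a x) * u) - 2 * B * Re (cnj (b x) * v)
          + Re (m' x * a x * cnj (b x) + m x * u * cnj (b x) + m x * a x * cnj v)"
        using elim unfolding u_def v_def n_def by blast
      then have 1: "c * n + r \<le> Re F'" unfolding split by simp
      define s where "s = norm (a x) + norm (b x)"
      define t where "t = norm (f x) + norm (g x)"
      have st: "norm y * norm w \<le> s * t" if "y \<in> {a x, b x}" "w \<in> {f x, g x}" for y w
        using that unfolding s_def t_def by (intro mult_mono) auto
      have re: "\<bar>Re (cnj y * w)\<bar> \<le> s * t" if "y \<in> {a x, b x}" "w \<in> {f x, g x}" for y w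
        using abs_Re_le_cmod[of "cnj y * w"] st[OF that] by (simp add: norm_mult)
      have mre: "\<bar>Re (m x * y)\<bar> \<le> Mb * norm y" for y
        using abs_Re_le_cmod[of "m x * y"] mult_right_mono[OF m_bd[of x], of "norm y"] by (simp add: norm_mult)
      have "\<bar>2 * A * Re (cnj (a x) * f x)\<bar> \<le> 2 * \<bar>A\<bar> * (s * t)"
        using re[of "a x" "f x"] by (simp add: abs_mult mult_left_mono)
      moreover have "\<bar>2 * B * Re (cnj (b x) * g x)\<bar> \<le> 2 * \<bar>B\<bar> * (s * t)"
        using re[of "b x" "g x"] by (simp add: abs_mult mult_left_mono)
      moreover have "\<bar>Re (m x * f x * cnj (b x))\<bar> + \<bar>Re (m x * a x * cnj (g x))\<bar> \<le> Mb * (s * t)"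
      proof -
        have "\<bar>Re (m x * f x * cnj (b x))\<bar> \<le> Mb * (norm (b x) * norm (f x))"
          unfolding mult.assoc[of "m x"]
          using mre[of "f x * cnj (b x)"] by (simp add: norm_mult mult.commute[of "norm (b x)"])
        moreover have "\<bar>Re (m x * a x * cnj (g x))\<bar> \<le> Mb * (norm (a x) * norm (g x))"
          using mre[of "a x * cnj (g x)"] by (simp add: norm_mult mult.assoc)
        moreover have "norm (b x) * norm (f x) + norm (a x) * norm (g x) \<le> s * t"
          by (simp add: s_def t_def algebra_simps)
        then have "Mb * (norm (b x) * norm (f x) + norm (a x) * norm (g x)) \<le> Mb * (s * t)"
          by (intro mult_left_mono Mb_nonneg)
        ultimately show ?thesis by (simp add: algebra_simps)
      qed
      ultimately have "- r \<le> form_bound * s * t"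
        unfolding r_def form_bound_def by (simp add: algebra_simps)
      also have "\<dots> \<le> c / 4 * s\<^sup>2 + form_bound\<^sup>2 / c * t\<^sup>2" by (rule Young_inequality_weighted[OF c])
      also have "\<dots> \<le> c / 4 * (2 * n) + form_bound\<^sup>2 / c * (2 * w)"
        unfolding n_def w_def s_def t_def using c by (intro add_mono mult_left_mono square_of_sum_le) auto
      finally have "- r \<le> c / 2 * n + forcing_const * w"
        by (simp add: forcing_const_def)
      then show ?thesis using 1 unfolding n_def[symmetric] w_def[symmetric] by (simp add: algebra_simps)
    qed
    ultimately show ?case by blast
  qed
qed

definition sqnorm :: "(real \<Rightarrow> complex) \<Rightarrow> (real \<Rightarrow> complex) \<Rightarrow> real \<Rightarrow> real" where
  "sqnorm a b x = (norm (a x))\<^sup>2 + (norm (b x))\<^sup>2"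

lemma sqnorm_nonneg [simp]: "sqnorm a b x \<ge> 0" by (simp add: sqnorm_def)

lemma forcing_const_nonneg: "forcing_const \<ge> 0" using c by (simp add: forcing_const_def)

lemma sqnorm_sq_int:
  assumes "sq_int f" "sq_int g"
  shows "integrable lebesgue (sqnorm f g)" "sqnorm f g integrable_on {x..y}"
    "integral {x..y} (sqnorm f g) \<le> (LINT x|lebesgue. sqnorm f g x)" "(LINT x|lebesgue. sqnorm f g x) \<ge> 0"
proof -
  show *: "integrable lebesgue (sqnorm f g)"
    using assms unfolding sqnorm_def[abs_def] sq_int_def by (intro Bochner_Integration.integrable_add) auto
  have "sqnorm f g absolutely_integrable_on {x..y}"
    using integrable_mult_indicator[OF _ *, of "{x..y}"] by (simp add: set_integrable_def)
  then show "sqnorm f g integrable_on {x..y}" by (rule set_lebesgue_integral_eq_integral(1))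
  show "integral {x..y} (sqnorm f g) \<le> (LINT x|lebesgue. sqnorm f g x)"
    by (rule integral_le_lebesgue_integral[OF * sqnorm_nonneg])
  show "(LINT x|lebesgue. sqnorm f g x) \<ge> 0" by simp
qed

lemma sqnorm_continuous: "sol f g a b \<Longrightarrow> continuous_on S (sqnorm a b)"
  unfolding sqnorm_def[abs_def] by (intro continuous_intros sol_continuous)

lemma sqnorm_integrable_on: "sol f g a b \<Longrightarrow> sqnorm a b integrable_on {x..y}"
  by (intro integrable_continuous_real sqnorm_continuous)

lemma energy_estimate:
  assumes sol: "sol f g a b" and fg: "sq_int f" "sq_int g" and xy: "x \<le> y"
  shows "c / 2 * integral {x..y} (sqnorm a b) \<le> energy y (a y) (b y) - energy x (a x) (b x) + forcing_const * (LINT x|lebesgue. sqnorm f g x)"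
proof -
  have int: "(\<lambda>x. c / 2 * sqnorm a b x - forcing_const * sqnorm f g x) integrable_on {x..y}"
    by (intro integrable_diff integrable_on_mult_right sqnorm_integrable_on[OF sol] sqnorm_sq_int fg)
  have "integral {x..y} (\<lambda>x. c / 2 * sqnorm a b x - forcing_const * sqnorm f g x) \<le> energy y (a y) (b y) - energy x (a x) (b x)"
    using energy_derivative[OF sol] unfolding sqnorm_def[symmetric]
    by (intro ac_loc_increment_ge_integral int xy)
  moreover have "integral {x..y} (\<lambda>x. c / 2 * sqnorm a b x - forcing_const * sqnorm f g x) = c / 2 * integral {x..y} (sqnorm a b) - forcing_const * integral {x..y} (sqnorm f g)"
    using sqnorm_integrable_on[OF sol] sqnorm_sq_int(2)[OF fg] by (subst integral_diff) (auto intro: integrable_on_mult_right)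
  moreover have "forcing_const * integral {x..y} (sqnorm f g) \<le> forcing_const * (LINT x|lebesgue. sqnorm f g x)"
    by (intro mult_left_mono sqnorm_sq_int fg forcing_const_nonneg)
  ultimately show ?thesis by linarith
qed

text \<open>
  The energy is dominated by \<open>\<bar>a\<bar>\<^sup>2 + \<bar>b\<bar>\<^sup>2\<close>, which is integrable and hence small at suitable points far to
  the left and to the right. Between such points the energy estimate has negligible boundary terms.
\<close>

lemma resolvent_bound:
  assumes sol: "sol f g a b" and fg: "sq_int f" "sq_int g" and ab: "sq_int a" "sq_int b"
  shows "(LINT x|lebesgue. sqnorm a b x) \<le> 2 * forcing_const / c * (LINT x|lebesgue. sqnorm f g x)"
proof (rule integrable_if_interval_integrals_bounded(2)[OF sqnorm_continuous[OF sol] sqnorm_nonneg])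
  fix n :: nat
  have "c / 2 * integral {- real n..real n} (sqnorm a b) \<le> forcing_const * (LINT x|lebesgue. sqnorm f g x) + e" if e: "e > 0" for e
  proof -
    define d where "d = e / (2 * (form_bound + 1))"
    have form_bound: "form_bound \<ge> 0" using Mb_nonneg by (simp add: form_bound_def)
    have d: "d > 0" "2 * form_bound * d \<le> e" using e form_bound by (auto simp: d_def field_simps)
    obtain y where y: "y \<ge> real n" "sqnorm a b y < d"
      using integrable_small_values(1)[OF sqnorm_sq_int(1)[OF ab] sqnorm_nonneg d(1)] by blast
    obtain x where x: "x \<le> - real n" "sqnorm a b x < d"
      using integrable_small_values(2)[OF sqnorm_sq_int(1)[OF ab] sqnorm_nonneg d(1)] by blast
    have "integral {- real n..real n} (sqnorm a b) \<le> integral {x..y} (sqnorm a b)"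
      using x y by (intro integral_subset_le sqnorm_integrable_on[OF sol]) auto
    then have "c / 2 * integral {- real n..real n} (sqnorm a b) \<le> c / 2 * integral {x..y} (sqnorm a b)"
      using c by simp
    also have "\<dots> \<le> energy y (a y) (b y) - energy x (a x) (b x) + forcing_const * (LINT x|lebesgue. sqnorm f g x)"
      using x y by (intro energy_estimate sol fg) auto
    finally have "c / 2 * integral {- real n..real n} (sqnorm a b)
      \<le> energy y (a y) (b y) - energy x (a x) (b x) + forcing_const * (LINT x|lebesgue. sqnorm f g x)" .
    moreover have "energy y (a y) (b y) \<le> form_bound * d"
      using energy_bound[of y "a y" "b y"] mult_left_mono[OF less_imp_le[OF y(2)] form_bound] by (simp add: sqnorm_def)
    moreover have "- energy x (a x) (b x) \<le> form_bound * d"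
      using energy_bound[of x "a x" "b x"] mult_left_mono[OF less_imp_le[OF x(2)] form_bound] by (simp add: sqnorm_def)
    ultimately show ?thesis using d(2) by simp
  qed
  then have "c / 2 * integral {- real n..real n} (sqnorm a b) \<le> forcing_const * (LINT x|lebesgue. sqnorm f g x)"
    by (rule field_le_epsilon)
  then show "integral {- real n..real n} (sqnorm a b) \<le> 2 * forcing_const / c * (LINT x|lebesgue. sqnorm f g x)"
    using c by (simp add: field_simps)
qed

end

section \<open>Solvability on the whole line\<close>

context lyapunov_system
begin

text \<open>
  The form is nonpositive on one coordinate axis and nonnegative on the other; which is which depends
  on the common sign of \<open>A\<close> and \<open>B\<close>. The boundary conditions select the axis on which the boundary
  terms of the energy estimate have the favourable sign: nonpositive on the right, nonnegative on the
  left.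
\<close>

definition bc_right :: "complex \<Rightarrow> complex \<Rightarrow> complex" where
  "bc_right a b = (if A > 0 then a else b)"

definition bc_left :: "complex \<Rightarrow> complex \<Rightarrow> complex" where
  "bc_left a b = (if A > 0 then b else a)"

lemma bc_right_energy: "bc_right a b = 0 \<Longrightarrow> energy x a b \<le> 0"
  using AB by (auto simp: bc_right_def energy_def zero_less_mult_iff mult_le_0_iff split: if_splits)

lemma bc_left_energy: "bc_left a b = 0 \<Longrightarrow> energy x a b \<ge> 0"
  using AB by (auto simp: bc_left_def energy_def zero_less_mult_iff mult_le_0_iff split: if_splits)

lemma bc_linear:
  "bc_right (a + c1 * a1 + c2 * a2) (b + c1 * b1 + c2 * b2) = bc_right a b + bc_right a1 b1 * c1 + bc_right a2 b2 * c2"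
  "bc_left (a + c1 * a1 + c2 * a2) (b + c1 * b1 + c2 * b2) = bc_left a b + bc_left a1 b1 * c1 + bc_left a2 b2 * c2"
  by (simp_all add: bc_right_def bc_left_def algebra_simps)

lemma boundary_value_estimate:
  assumes sol: "sol f g a b" and fg: "sq_int f" "sq_int g" and T: "T > 0"
    and bc: "bc_right (a T) (b T) = 0" "bc_left (a (- T)) (b (- T)) = 0"
  shows "integral {- T..T} (sqnorm a b) \<le> 2 * forcing_const / c * (LINT x|lebesgue. sqnorm f g x)"
proof -
  have "c / 2 * integral {- T..T} (sqnorm a b) \<le> energy T (a T) (b T) - energy (- T) (a (- T)) (b (- T)) + forcing_const * (LINT x|lebesgue. sqnorm f g x)"
    using T by (intro energy_estimate sol fg) auto
  also have "\<dots> \<le> forcing_const * (LINT x|lebesgue. sqnorm f g x)"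
    using bc_right_energy[OF bc(1), of T] bc_left_energy[OF bc(2), of "- T"] by simp
  finally show ?thesis using c by (simp add: field_simps)
qed

text \<open>
  The derivative of \<open>\<bar>a\<bar>\<^sup>2 + \<bar>b\<bar>\<^sup>2\<close> is bounded by a multiple of this function plus \<open>\<bar>f\<bar>\<^sup>2 + \<bar>g\<bar>\<^sup>2\<close>. So its
  value at \<open>0\<close> exceeds its values on the unit interval by no more than integrals of these, and
  averaging over that interval gives the bound.
\<close>

lemma initial_value_bound:
  assumes sol: "sol f g a b" and fg: "sq_int f" "sq_int g"
  shows "sqnorm a b 0 \<le> (4 * K0 + 2) * integral {0..1} (sqnorm a b) + (LINT x|lebesgue. sqnorm f g x)"
proof -
  define k where "k x = - ((4 * K0 + 1) * sqnorm a b x + sqnorm f g x)" for x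
  have ac: "ac_loc a" "ac_loc b" using sol by (auto simp: sol_def)
  have NF: "sqnorm a b x = Re (a x * cnj (a x) + b x * cnj (b x))" for x
    by (simp add: sqnorm_def flip: complex_norm_square)
  have acN: "ac_loc (sqnorm a b)"
    unfolding NF[abs_def] by (intro ac_loc_Re ac_loc_add ac_loc_mult ac_loc_cnj ac)
  have kint: "k integrable_on {x..y}" for x y
    unfolding k_def[abs_def]
    by (intro integrable_neg integrable_add integrable_on_mult_right sqnorm_integrable_on[OF sol] sqnorm_sq_int(2)[OF fg])
  have "AE x in lebesgue. (a has_vector_derivative (al x * a x + be x * b x + f x)) (at x) \<and>
                        (b has_vector_derivative (ga x * a x + de x * b x + g x)) (at x)"
    using sol by (auto simp: sol_def)
  then have AE: "AE x in lebesgue. \<exists>D. (sqnorm a b has_real_derivative D) (at x) \<and> k x \<le> D"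
  proof eventually_elim
    case (elim x)
    define u where "u = al x * a x + be x * b x"
    define v where "v = ga x * a x + de x * b x"
    have da: "(a has_vector_derivative (u + f x)) (at x)" and db: "(b has_vector_derivative (v + g x)) (at x)"
      using elim by (auto simp: u_def v_def)
    have dac: "((\<lambda>x. cnj (a x)) has_vector_derivative cnj (u + f x)) (at x)"
      and dbc: "((\<lambda>x. cnj (b x)) has_vector_derivative cnj (v + g x)) (at x)"
      by (rule bounded_linear.has_vector_derivative[OF bounded_linear_cnj] da db)+
    define F' where "F' = (a x * cnj (u + f x) + (u + f x) * cnj (a x)) + (b x * cnj (v + g x) + (v + g x) * cnj (b x))"
    have "((\<lambda>x. a x * cnj (a x) + b x * cnj (b x)) has_vector_derivative F') (at x)"
      unfolding F'_def by (intro has_vector_derivative_add has_vector_derivative_mult da db dac dbc)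
    then have D: "(sqnorm a b has_real_derivative Re F') (at x)"
      unfolding NF[abs_def] by (simp add: has_vector_derivative_complex_iff)
    define s where "s = norm (a x) + norm (b x)"
    have un: "norm (p * a x + q * b x) \<le> K0 * s" if "norm p \<le> K0" "norm q \<le> K0" for p q
    proof -
      have "norm (p * a x + q * b x) \<le> norm p * norm (a x) + norm q * norm (b x)"
        using norm_triangle_ineq[of "p * a x" "q * b x"] by (simp add: norm_mult)
      also have "\<dots> \<le> K0 * norm (a x) + K0 * norm (b x)" using that by (intro add_mono mult_right_mono) auto
      finally show ?thesis by (simp add: s_def algebra_simps)
    qed
    have Re2: "Re (y * cnj w + w * cnj y) \<ge> - (2 * (norm y * norm w))" for y w
    proof -
      have "Re (y * cnj w + w * cnj y) = 2 * Re (y * cnj w)" by simp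
      moreover have "\<bar>Re (y * cnj w)\<bar> \<le> norm y * norm w"
        using abs_Re_le_cmod[of "y * cnj w"] by (simp add: norm_mult)
      ultimately show ?thesis by linarith
    qed
    have part: "Re (y * cnj (u' + w) + (u' + w) * cnj y) \<ge> - (2 * (norm y * (K0 * s))) - (norm y)\<^sup>2 - (norm w)\<^sup>2"
      if "norm u' \<le> K0 * s" for y u' w
    proof -
      have "norm y * norm (u' + w) \<le> norm y * (K0 * s + norm w)"
        using norm_triangle_ineq[of u' w] that by (intro mult_left_mono) auto
      then have "norm y * norm (u' + w) \<le> norm y * (K0 * s) + norm y * norm w" by (simp add: distrib_left)
      moreover have "2 * (norm y * norm w) \<le> (norm y)\<^sup>2 + (norm w)\<^sup>2"
        using sum_squares_bound[of "norm y" "norm w"] by simp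
      ultimately show ?thesis using Re2[of y "u' + w"] by linarith
    qed
    have "2 * (norm (a x) * (K0 * s)) + 2 * (norm (b x) * (K0 * s)) = K0 * (2 * s\<^sup>2)"
      by (simp add: s_def power2_eq_square algebra_simps)
    also have "\<dots> \<le> K0 * (2 * (2 * sqnorm a b x))"
      using square_of_sum_le[of "norm (a x)" "norm (b x)"] K0_nonneg unfolding s_def sqnorm_def
      by (intro mult_left_mono) auto
    finally have "2 * (norm (a x) * (K0 * s)) + 2 * (norm (b x) * (K0 * s)) \<le> 4 * K0 * sqnorm a b x" by simp
    moreover have "Re F' = Re (a x * cnj (u + f x) + (u + f x) * cnj (a x)) + Re (b x * cnj (v + g x) + (v + g x) * cnj (b x))"
      unfolding F'_def by (rule plus_complex.sel(1))
    ultimately have "k x \<le> Re F'"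
      using part[OF un[OF bounded(1,2)[of x]], of "a x" "f x"] part[OF un[OF bounded(3,4)[of x]], of "b x" "g x"]
      unfolding k_def u_def v_def by (simp only: sqnorm_def distrib_right mult_1 minus_add_distrib)
    with D show ?case by blast
  qed
  define J where "J = (LINT x|lebesgue. sqnorm f g x)"
  define I where "I = integral {0..1} (sqnorm a b)"
  have pt: "sqnorm a b 0 - ((4 * K0 + 1) * I + J) \<le> sqnorm a b x" if x: "x \<in> {0..1}" for x
  proof -
    have "integral {0..x} k \<le> sqnorm a b x - sqnorm a b 0"
      using x by (intro ac_loc_increment_ge_integral[OF acN AE] kint) auto
    moreover have "integral {0..x} k = - ((4 * K0 + 1) * integral {0..x} (sqnorm a b) + integral {0..x} (sqnorm f g))"
      unfolding k_def[abs_def]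
      by (intro integral_unique has_integral_neg has_integral_add has_integral_mult_right integrable_integral
          sqnorm_integrable_on[OF sol] sqnorm_sq_int(2)[OF fg])
    moreover have "(4 * K0 + 1) * integral {0..x} (sqnorm a b) \<le> (4 * K0 + 1) * I"
      unfolding I_def using x K0_nonneg
      by (intro mult_left_mono integral_subset_le sqnorm_integrable_on[OF sol]) auto
    moreover have "integral {0..x} (sqnorm f g) \<le> J" unfolding J_def by (rule sqnorm_sq_int[OF fg])
    ultimately show ?thesis by linarith
  qed
  have "integral {0..1} (\<lambda>x::real. sqnorm a b 0 - ((4 * K0 + 1) * I + J)) \<le> I"
    unfolding I_def[symmetric] using pt sqnorm_integrable_on[OF sol, of 0 1]
    by (subst (2) I_def) (intro integral_le; auto)
  then show ?thesis unfolding I_def[symmetric] J_def[symmetric] by (simp add: algebra_simps)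
qed

text \<open>
  A homogeneous solution with these boundary conditions vanishes by the energy estimate. So
  the two linear conditions on the two free constants are independent, and the inhomogeneous problem is
  solvable.
\<close>

lemma boundary_value_solution:
  assumes p: "sol f g ap bp" and h1: "sol (\<lambda>x. 0) (\<lambda>x. 0) a1 b1" and h2: "sol (\<lambda>x. 0) (\<lambda>x. 0) a2 b2"
    and init: "a1 0 = 1" "b1 0 = 0" "a2 0 = 0" "b2 0 = 1" and T: "T > 0"
  shows "\<exists>c1 c2. bc_right (ap T + c1 * a1 T + c2 * a2 T) (bp T + c1 * b1 T + c2 * b2 T) = 0 \<and>
     bc_left (ap (- T) + c1 * a1 (- T) + c2 * a2 (- T)) (bp (- T) + c1 * b1 (- T) + c2 * b2 (- T)) = 0"
proof -
  have z: "sq_int (\<lambda>x. 0)" by (simp add: sq_int_def)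
  have "c1 = 0 \<and> c2 = 0"
    if bc: "bc_right (a1 T) (b1 T) * c1 + bc_right (a2 T) (b2 T) * c2 = 0"
      "bc_left (a1 (- T)) (b1 (- T)) * c1 + bc_left (a2 (- T)) (b2 (- T)) * c2 = 0" for c1 c2
  proof -
    define a where "a x = 0 + c1 * a1 x + c2 * a2 x" for x
    define b where "b x = 0 + c1 * b1 x + c2 * b2 x" for x
    have s0: "sol (\<lambda>x. 0) (\<lambda>x. 0) (\<lambda>x. 0) (\<lambda>x. 0)"
      by (simp add: sol_def ac_loc_const has_vector_derivative_const)
    have sab: "sol (\<lambda>x. 0) (\<lambda>x. 0) a b"
      using sol_add_mult[OF sol_add_mult[OF s0 h1, of c1] h2, of c2] by (simp add: a_def[abs_def] b_def[abs_def])
    have "bc_right (a T) (b T) = 0" "bc_left (a (- T)) (b (- T)) = 0"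
      unfolding a_def b_def bc_linear using bc by (auto simp: bc_right_def bc_left_def)
    then have "integral {- T..T} (sqnorm a b) \<le> 2 * forcing_const / c * (LINT x|lebesgue. sqnorm (\<lambda>x. 0) (\<lambda>x. 0) x)"
      by (intro boundary_value_estimate[OF sab z z T])
    then have "integral {- T..T} (sqnorm a b) \<le> 0" by (simp add: sqnorm_def)
    moreover have "integral {- T..T} (sqnorm a b) \<ge> 0"
      by (intro integral_nonneg sqnorm_integrable_on[OF sab]) auto
    ultimately have "integral {- T..T} (sqnorm a b) = 0" by simp
    then have "sqnorm a b 0 = 0"
      using integral_eq_0_iff[OF sqnorm_continuous[OF sab], of "- T" T] T by auto
    then show "c1 = 0 \<and> c2 = 0"
      using init by (simp add: sqnorm_def a_def b_def)
  qed
  then obtain c1 c2 where "bc_right (a1 T) (b1 T) * c1 + bc_right (a2 T) (b2 T) * c2 = - bc_right (ap T) (bp T)"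
    "bc_left (a1 (- T)) (b1 (- T)) * c1 + bc_left (a2 (- T)) (b2 (- T)) * c2 = - bc_left (ap (- T)) (bp (- T))"
    using linear_system_2_solvable by blast
  then show ?thesis unfolding bc_linear by (intro exI[of _ c1] exI[of _ c2]) (simp add: add.assoc)
qed

text \<open>
  The solutions of the boundary value problems on \<open>[- n, n]\<close> obey a bound that does not depend on \<open>n\<close>.
  Hence their initial values are bounded, and a subsequence of them converges. The solution with the
  limiting initial value inherits the bound on every interval, because integrals over fixed intervals
  depend continuously on the initial value, and so it is square integrable.
\<close>

lemma resolvent_exists:
  assumes f: "sq_int f" and g: "sq_int g"
  shows "\<exists>a b. sol f g a b \<and> sq_int a \<and> sq_int b"
proof -
  note fg = f g
  have z: "sq_int (\<lambda>x. 0)" by (simp add: sq_int_def)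
  obtain ap bp where p: "sol f g ap bp" "ap 0 = 0" "bp 0 = 0" using sol_exists[OF f g] by blast
  obtain a1 b1 where h1: "sol (\<lambda>x. 0) (\<lambda>x. 0) a1 b1" "a1 0 = 1" "b1 0 = 0" using sol_exists[OF z z] by blast
  obtain a2 b2 where h2: "sol (\<lambda>x. 0) (\<lambda>x. 0) a2 b2" "a2 0 = 0" "b2 0 = 1" using sol_exists[OF z z] by blast
  define a where "a w x = ap x + fst w * a1 x + snd w * a2 x" for w :: "complex \<times> complex" and x
  define b where "b w x = bp x + fst w * b1 x + snd w * b2 x" for w :: "complex \<times> complex" and x
  have sab: "sol f g (a w) (b w)" for w
    using sol_add_mult[OF sol_add_mult[OF p(1) h1(1), of "fst w"] h2(1), of "snd w"]
    by (simp add: a_def[abs_def] b_def[abs_def])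
  define J where "J = 2 * forcing_const / c * (LINT x|lebesgue. sqnorm f g x)"
  have "\<exists>w. bc_right (a w (real (Suc n))) (b w (real (Suc n))) = 0 \<and>
      bc_left (a w (- real (Suc n))) (b w (- real (Suc n))) = 0" for n
  proof -
    obtain c1 c2 where "bc_right (ap (real (Suc n)) + c1 * a1 (real (Suc n)) + c2 * a2 (real (Suc n)))
         (bp (real (Suc n)) + c1 * b1 (real (Suc n)) + c2 * b2 (real (Suc n))) = 0"
     "bc_left (ap (- real (Suc n)) + c1 * a1 (- real (Suc n)) + c2 * a2 (- real (Suc n)))
         (bp (- real (Suc n)) + c1 * b1 (- real (Suc n)) + c2 * b2 (- real (Suc n))) = 0"
      using boundary_value_solution[OF p(1) h1(1) h2(1) h1(2,3) h2(2,3), of "real (Suc n)"] by auto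
    then show ?thesis by (intro exI[of _ "(c1, c2)"]) (simp add: a_def b_def)
  qed
  then obtain w where w: "\<forall>n. bc_right (a (w n) (real (Suc n))) (b (w n) (real (Suc n))) = 0 \<and>
      bc_left (a (w n) (- real (Suc n))) (b (w n) (- real (Suc n))) = 0" by metis
  have est: "integral {- real (Suc n)..real (Suc n)} (sqnorm (a (w n)) (b (w n))) \<le> J" for n
    unfolding J_def using spec[OF w, of n] by (intro boundary_value_estimate[OF sab fg]) auto
  have est': "integral {x..y} (sqnorm (a (w n)) (b (w n))) \<le> J" if "- real (Suc n) \<le> x" "y \<le> real (Suc n)" for n x y
  proof -
    have "integral {x..y} (sqnorm (a (w n)) (b (w n))) \<le> integral {- real (Suc n)..real (Suc n)} (sqnorm (a (w n)) (b (w n)))"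
      using that by (intro integral_subset_le sqnorm_integrable_on[OF sab]) auto
    then show ?thesis using est[of n] by simp
  qed
  \<comment> \<open>A common bound for the squared norms of all initial values.\<close>
  define R where "R = (4 * K0 + 2) * J + (LINT x|lebesgue. sqnorm f g x)"
  have wn: "norm (w n) \<le> sqrt R" for n
  proof -
    have "sqnorm (a (w n)) (b (w n)) 0 \<le> (4 * K0 + 2) * integral {0..1} (sqnorm (a (w n)) (b (w n))) + (LINT x|lebesgue. sqnorm f g x)"
      by (rule initial_value_bound[OF sab fg])
    also have "\<dots> \<le> R"
      unfolding R_def using K0_nonneg by (intro add_mono mult_left_mono est') auto
    also have "sqnorm (a (w n)) (b (w n)) 0 = (norm (w n))\<^sup>2"
      using p h1 h2 by (simp add: sqnorm_def a_def b_def norm_prod_def)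
    finally show ?thesis by (rule real_le_rsqrt)
  qed
  have "bounded (range w)" using wn by (auto simp: bounded_iff)
  then obtain l r where lr: "strict_mono (r :: nat \<Rightarrow> nat)" "(w \<circ> r) \<longlonglongrightarrow> l"
    using bounded_imp_convergent_subsequence by blast
  have lim: "integral {x..y} (sqnorm (a l) (b l)) \<le> J" for x y
  proof -
    have "continuous_on (UNIV \<times> cbox x y) (\<lambda>(w, t). sqnorm (a w) (b w) t)"
      unfolding sqnorm_def a_def b_def split_def
      by (intro continuous_intros continuous_on_compose2[OF sol_continuous(1)[OF p(1), of UNIV] continuous_on_snd]
          continuous_on_compose2[OF sol_continuous(2)[OF p(1), of UNIV] continuous_on_snd]
          continuous_on_compose2[OF sol_continuous(1)[OF h1(1), of UNIV] continuous_on_snd]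
          continuous_on_compose2[OF sol_continuous(2)[OF h1(1), of UNIV] continuous_on_snd]
          continuous_on_compose2[OF sol_continuous(1)[OF h2(1), of UNIV] continuous_on_snd]
          continuous_on_compose2[OF sol_continuous(2)[OF h2(1), of UNIV] continuous_on_snd]) auto
    then have "continuous_on UNIV (\<lambda>w. integral (cbox x y) (sqnorm (a w) (b w)))"
      by (rule integral_continuous_on_param)
    then have "isCont (\<lambda>w. integral {x..y} (sqnorm (a w) (b w))) l"
      unfolding box_real continuous_on_eq_continuous_at[OF open_UNIV] by blast
    then have "(\<lambda>n. integral {x..y} (sqnorm (a ((w \<circ> r) n)) (b ((w \<circ> r) n)))) \<longlonglongrightarrow> integral {x..y} (sqnorm (a l) (b l))"
      using lr(2) by (rule isCont_tendsto_compose)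
    moreover have "\<forall>\<^sub>F n in sequentially. integral {x..y} (sqnorm (a ((w \<circ> r) n)) (b ((w \<circ> r) n))) \<le> J"
    proof -
      obtain n0 :: nat where n0: "max \<bar>x\<bar> \<bar>y\<bar> \<le> real n0" using real_arch_simple by blast
      have "integral {x..y} (sqnorm (a ((w \<circ> r) n)) (b ((w \<circ> r) n))) \<le> J" if "n \<ge> n0" for n
      proof -
        have "n \<le> r n" using lr(1) by (rule seq_suble)
        then have "real n0 \<le> real (Suc (r n))" using that by simp
        then show ?thesis using n0 unfolding comp_def by (intro est') auto
      qed
      then show ?thesis using eventually_sequentially by blast
    qed
    ultimately show ?thesis by (rule tendsto_upperbound) simp
  qed
  have int: "integrable lebesgue (sqnorm (a l) (b l))"
    by (rule integrable_if_interval_integrals_bounded(1)[OF sqnorm_continuous[OF sab] sqnorm_nonneg lim])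
  have sq: "sq_int u" if u: "continuous_on UNIV u" "\<And>x. (norm (u x))\<^sup>2 \<le> sqnorm (a l) (b l) x" for u
  proof -
    have m: "u \<in> borel_measurable lebesgue"
      using borel_measurable_continuous_onI[OF u(1)] by (simp add: measurable_completion)
    moreover have "integrable lebesgue (\<lambda>x. (norm (u x))\<^sup>2)"
      by (rule Bochner_Integration.integrable_bound[OF int]) (use m u(2) in auto)
    ultimately show ?thesis by (simp add: sq_int_def)
  qed
  have "sq_int (a l)" "sq_int (b l)"
    by (intro sq sol_continuous[OF sab]; simp add: sqnorm_def)+
  then show ?thesis using sab by blast
qed

end

section \<open>The Dirac operator as a planar system\<close>

text \<open>
  Finiteness of the essential supremum is needed because \<^const>\<open>real_of_ereal\<close> sends \<open>\<infinity>\<close> to \<open>0\<close>.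
\<close>

lemma Linfty_norm_bound:
  assumes "f \<in> Linfty"
  shows "AE x in lebesgue. norm (f x) \<le> Linfty_norm f" "Linfty_norm f \<ge> 0"
proof -
  define S where "S = esssup lebesgue (\<lambda>x. ereal (cmod (f x)))"
  have AE: "AE x in lebesgue. ereal (cmod (f x)) \<le> S" unfolding S_def by (rule esssup_AE)
  have fin: "S < \<infinity>" using assms by (simp add: Linfty_def S_def)
  have pos: "S \<ge> 0"
  proof (rule ccontr)
    assume "\<not> S \<ge> 0"
    then have nb: "\<not> ereal (cmod (f x)) \<le> S" for x
      by (meson ereal_less_eq(5) norm_ge_zero order_trans)
    have "AE x::real in lebesgue. False" using AE by (simp only: nb)
    then show False unfolding AE_lebesgue_iff_negligible by simp
  qed
  have S: "S = ereal (Linfty_norm f)"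
    using fin pos by (cases S) (auto simp: Linfty_norm_def S_def[symmetric])
  show "AE x in lebesgue. norm (f x) \<le> Linfty_norm f" using AE by (simp add: S)
  show "Linfty_norm f \<ge> 0" using pos by (simp add: S)
qed

lemma bounded_continuous_Linfty:
  assumes "continuous_on UNIV f" "\<And>x. norm (f x) \<le> M"
  shows "f \<in> Linfty"
proof -
  have f: "f \<in> borel_measurable lebesgue"
    using borel_measurable_continuous_onI[OF assms(1)] by (simp add: measurable_completion)
  have "esssup lebesgue (\<lambda>x. ereal (cmod (f x))) \<le> ereal M"
    using f assms(2) by (intro esssup_I) auto
  also have "\<dots> < \<infinity>" by simp
  finally show ?thesis using f by (simp add: Linfty_def)
qed

lemma periodic_continuous_bounded:
  fixes p :: "real \<Rightarrow> complex"
  assumes per: "\<And>x. p (x + 1) = p x" and cont: "continuous_on UNIV p"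
  shows "\<exists>M. \<forall>x. norm (p x) \<le> M"
proof -
  interpret periodic_fun_simple' p by standard (rule per)
  have "bounded (p ` {0..1})"
    by (intro compact_imp_bounded compact_continuous_image continuous_on_subset[OF cont]) auto
  then obtain M where M: "\<forall>x\<in>{0..1}. norm (p x) \<le> M" by (auto simp: bounded_iff)
  have "norm (p x) \<le> M" for x
  proof -
    have "p x = p (frac x)" using plus_of_int[of "frac x" "\<lfloor>x\<rfloor>"] by (simp add: frac_def)
    moreover have "frac x \<in> {0..1}" using frac_ge_0[of x] frac_lt_1[of x] by auto
    ultimately show ?thesis using M by metis
  qed
  then show ?thesis by blast
qed

lemma norm_complex2: "(norm (v :: complex^2))\<^sup>2 = (norm (v $ 1))\<^sup>2 + (norm (v $ 2))\<^sup>2"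
  by (simp add: norm_vec_def L2_set_def sum_2 sum_nonneg)

lemma has_vector_derivative_vector_2:
  fixes \<Psi> :: "real \<Rightarrow> complex^2"
  assumes "((\<lambda>x. \<Psi> x $ 1) has_vector_derivative a') (at x)" "((\<lambda>x. \<Psi> x $ 2) has_vector_derivative b') (at x)"
  shows "(\<Psi> has_vector_derivative vector [a', b']) (at x)"
proof -
  define e1 where "e1 c = (vector [c, 0] :: complex^2)" for c
  define e2 where "e2 c = (vector [0, c] :: complex^2)" for c
  have lin: "bounded_linear e1" "bounded_linear e2"
    unfolding linear_conv_bounded_linear[symmetric]
    by (auto intro!: linearI simp: e1_def e2_def vec_eq_iff forall_2)
  have eq: "\<Psi> = (\<lambda>x. e1 (\<Psi> x $ 1) + e2 (\<Psi> x $ 2))"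
    by (auto simp: fun_eq_iff e1_def e2_def vec_eq_iff forall_2)
  have "((\<lambda>x. e1 (\<Psi> x $ 1) + e2 (\<Psi> x $ 2)) has_vector_derivative e1 a' + e2 b') (at x)"
    by (intro has_vector_derivative_add bounded_linear.has_vector_derivative[OF lin(1)]
        bounded_linear.has_vector_derivative[OF lin(2)] assms)
  moreover have "e1 a' + e2 b' = vector [a', b']"
    by (auto simp: e1_def e2_def vec_eq_iff forall_2)
  ultimately show ?thesis using eq by simp
qed

lemma dirac_expr_components:
  assumes "((\<lambda>x. \<Psi> x $ 1) has_vector_derivative a') (at x)" "((\<lambda>x. \<Psi> x $ 2) has_vector_derivative b') (at x)"
  shows "dirac_expr h p q \<Psi> x $ 1 = \<i> * of_real h * a' - \<i> * q x * \<Psi> x $ 2"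
    "dirac_expr h p q \<Psi> x $ 2 = - (\<i> * of_real h * b') + \<i> * p x * \<Psi> x $ 1"
proof -
  have "vector_derivative \<Psi> (at x) = vector [a', b']"
    using has_vector_derivative_vector_2[OF assms] by (rule vector_derivative_at)
  then show "dirac_expr h p q \<Psi> x $ 1 = \<i> * of_real h * a' - \<i> * q x * \<Psi> x $ 2"
    "dirac_expr h p q \<Psi> x $ 2 = - (\<i> * of_real h * b') + \<i> * p x * \<Psi> x $ 1"
    by (auto simp: dirac_expr_def sigma3_def dirac_potential_def matrix_vector_mult_def sum_2)
qed

lemma sq_int_add_mult:
  assumes "sq_int f" "sq_int g"
  shows "sq_int (\<lambda>x. f x + c * g x)"
proof -
  have f: "f \<in> borel_measurable lebesgue" "integrable lebesgue (\<lambda>x. (norm (f x))\<^sup>2)"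
    and g: "g \<in> borel_measurable lebesgue" "integrable lebesgue (\<lambda>x. (norm (g x))\<^sup>2)"
    using assms by (auto simp: sq_int_def)
  have m: "(\<lambda>x. f x + c * g x) \<in> borel_measurable lebesgue"
    using f g by (intro borel_measurable_add borel_measurable_times) auto
  have "integrable lebesgue (\<lambda>x. (norm (f x + c * g x))\<^sup>2)"
  proof (rule Bochner_Integration.integrable_bound)
    show "integrable lebesgue (\<lambda>x. 2 * (norm (f x))\<^sup>2 + 2 * (norm c)\<^sup>2 * (norm (g x))\<^sup>2)"
      using f g by (intro Bochner_Integration.integrable_add integrable_mult_right) auto
    have "(norm (f x + c * g x))\<^sup>2 \<le> 2 * (norm (f x))\<^sup>2 + 2 * (norm c)\<^sup>2 * (norm (g x))\<^sup>2" for x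
    proof -
      have "(norm (f x + c * g x))\<^sup>2 \<le> (norm (f x) + norm (c * g x))\<^sup>2"
        by (intro power_mono norm_triangle_ineq) auto
      also have "\<dots> \<le> 2 * ((norm (f x))\<^sup>2 + (norm (c * g x))\<^sup>2)" by (rule square_of_sum_le)
      finally show ?thesis by (simp add: norm_mult power_mult_distrib)
    qed
    then show "AE x in lebesgue. norm ((norm (f x + c * g x))\<^sup>2) \<le> norm (2 * (norm (f x))\<^sup>2 + 2 * (norm c)\<^sup>2 * (norm (g x))\<^sup>2)"
      by simp
  qed (use m in auto)
  with m show ?thesis by (simp add: sq_int_def)
qed

lemma sq_int_mult: "sq_int g \<Longrightarrow> sq_int (\<lambda>x. c * g x)"
  using sq_int_add_mult[of "\<lambda>x. 0" g c] by (simp add: sq_int_def)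

lemma L2_C2_components:
  "\<Psi> \<in> L2_C2 \<longleftrightarrow> sq_int (\<lambda>x. \<Psi> x $ 1) \<and> sq_int (\<lambda>x. \<Psi> x $ 2)"
proof
  assume \<Psi>: "\<Psi> \<in> L2_C2"
  then have m: "\<Psi> \<in> borel_measurable lebesgue" and i: "integrable lebesgue (\<lambda>x. (norm (\<Psi> x))\<^sup>2)"
    by (auto simp: L2_C2_def)
  have "sq_int (\<lambda>x. \<Psi> x $ j)" for j
  proof -
    have mj: "(\<lambda>x. \<Psi> x $ j) \<in> borel_measurable lebesgue"
      by (rule measurable_compose[OF m]) (intro borel_measurable_continuous_onI continuous_intros)
    have "norm (\<Psi> x $ j) \<le> norm (\<Psi> x)" for x by (rule Finite_Cartesian_Product.norm_nth_le)
    then have "integrable lebesgue (\<lambda>x. (norm (\<Psi> x $ j))\<^sup>2)"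
      using mj by (intro Bochner_Integration.integrable_bound[OF i]) (auto intro!: power_mono)
    with mj show ?thesis by (simp add: sq_int_def)
  qed
  then show "sq_int (\<lambda>x. \<Psi> x $ 1) \<and> sq_int (\<lambda>x. \<Psi> x $ 2)" by blast
next
  assume s: "sq_int (\<lambda>x. \<Psi> x $ 1) \<and> sq_int (\<lambda>x. \<Psi> x $ 2)"
  have "\<Psi> \<in> borel_measurable lebesgue"
  proof -
    have m: "(\<lambda>x. (\<Psi> x $ 1, \<Psi> x $ 2)) \<in> lebesgue \<rightarrow>\<^sub>M borel \<Otimes>\<^sub>M borel"
      using s by (intro measurable_Pair) (auto simp: sq_int_def)
    have c: "continuous_on UNIV (\<lambda>z::complex \<times> complex. vector [fst z, snd z] :: complex^2)"
    proof -
      have "linear (\<lambda>z::complex \<times> complex. vector [fst z, snd z] :: complex^2)"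
        by (auto intro!: linearI simp: vec_eq_iff forall_2)
      then show ?thesis by (simp add: linear_conv_bounded_linear linear_continuous_on)
    qed
    have "(\<lambda>x. vector [fst (\<Psi> x $ 1, \<Psi> x $ 2), snd (\<Psi> x $ 1, \<Psi> x $ 2)] :: complex^2) \<in> borel_measurable lebesgue"
      using m unfolding borel_prod
      by (rule measurable_compose[OF _ borel_measurable_continuous_onI[OF c]])
    moreover have "(\<lambda>x. vector [fst (\<Psi> x $ 1, \<Psi> x $ 2), snd (\<Psi> x $ 1, \<Psi> x $ 2)] :: complex^2) = \<Psi>"
      by (auto simp: fun_eq_iff vec_eq_iff forall_2)
    ultimately show ?thesis by simp
  qed
  moreover have "integrable lebesgue (\<lambda>x. (norm (\<Psi> x))\<^sup>2)"
    unfolding norm_complex2 using s by (intro Bochner_Integration.integrable_add) (auto simp: sq_int_def)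
  ultimately show "\<Psi> \<in> L2_C2" by (simp add: L2_C2_def)
qed

lemma AC_loc_iff: "f \<in> AC_loc \<longleftrightarrow> ac_loc f"
  by (simp add: AC_loc_def ac_loc_def)

text \<open>
  Solving \<open>(H - z) \<Psi> = \<Phi>\<close> for the derivatives of the components of \<open>\<Psi>\<close> gives the planar system with these
  coefficients and with the forcing \<open>src1 \<Phi>\<close>, \<open>src2 \<Phi>\<close> defined below.
\<close>

locale dirac_system = lyapunov_system "\<lambda>x. of_real (1 / h) * (- \<i> * z)" "\<lambda>x. of_real (1 / h) * q x"
    "\<lambda>x. of_real (1 / h) * p x" "\<lambda>x. of_real (1 / h) * (\<i> * z)" K0 A B m m' Mb c
  for h :: real and z :: complex and p q :: "real \<Rightarrow> complex" and K0 A B m m' Mb c +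
  assumes h: "h > 0"
begin

definition shifted :: "(real \<Rightarrow> complex^2) \<Rightarrow> real \<Rightarrow> complex^2" where
  "shifted \<Psi> x = dirac_expr h p q \<Psi> x - z *s \<Psi> x"

definition src1 :: "(real \<Rightarrow> complex^2) \<Rightarrow> real \<Rightarrow> complex" where
  "src1 \<Phi> x = of_real (1 / h) * (- \<i> * \<Phi> x $ 1)"

definition src2 :: "(real \<Rightarrow> complex^2) \<Rightarrow> real \<Rightarrow> complex" where
  "src2 \<Phi> x = of_real (1 / h) * (\<i> * \<Phi> x $ 2)"

lemma sqnorm_src: "sqnorm (src1 \<Phi>) (src2 \<Phi>) x = (1 / h)\<^sup>2 * (norm (\<Phi> x))\<^sup>2"
  by (simp add: sqnorm_def src1_def src2_def norm_complex2 norm_mult norm_divide power_mult_distrib power_divide add_divide_distrib)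

lemma sq_int_src:
  assumes "\<Phi> \<in> L2_C2"
  shows "sq_int (src1 \<Phi>)" "sq_int (src2 \<Phi>)"
proof -
  have "src1 \<Phi> = (\<lambda>x. (of_real (1 / h) * - \<i>) * \<Phi> x $ 1)" "src2 \<Phi> = (\<lambda>x. (of_real (1 / h) * \<i>) * \<Phi> x $ 2)"
    by (auto simp: fun_eq_iff src1_def src2_def)
  then show "sq_int (src1 \<Phi>)" "sq_int (src2 \<Phi>)"
    using assms sq_int_mult unfolding L2_C2_components by metis+
qed

lemma pointwise_equation:
  assumes a: "((\<lambda>x. \<Psi> x $ 1) has_vector_derivative a') (at x)" and b: "((\<lambda>x. \<Psi> x $ 2) has_vector_derivative b') (at x)"
  shows "shifted \<Psi> x = \<Phi> x \<longleftrightarrow>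
    a' = of_real (1 / h) * (- \<i> * z) * \<Psi> x $ 1 + of_real (1 / h) * q x * \<Psi> x $ 2 + src1 \<Phi> x \<and>
    b' = of_real (1 / h) * p x * \<Psi> x $ 1 + of_real (1 / h) * (\<i> * z) * \<Psi> x $ 2 + src2 \<Phi> x"
proof -
  have solve: "\<i> * of_real h * y - X = Y \<longleftrightarrow> y = of_real (1 / h) * (- \<i> * (Y + X))" for X Y y :: complex
  proof -
    have h0: "complex_of_real h \<noteq> 0" using h by simp
    have "\<i> * of_real h * y - X = Y \<longleftrightarrow> \<i> * of_real h * y = Y + X" by (auto simp: algebra_simps)
    also have "\<dots> \<longleftrightarrow> - \<i> / of_real h * (\<i> * of_real h * y) = - \<i> / of_real h * (Y + X)"
      by (simp only: mult_cancel_left) (use h0 in simp)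
    also have "- \<i> / of_real h * (\<i> * of_real h * y) = y" using h0 by (simp add: field_simps)
    finally show ?thesis by simp
  qed
  have S1: "shifted \<Psi> x $ 1 = \<i> * of_real h * a' - (\<i> * q x * \<Psi> x $ 2 + z * \<Psi> x $ 1)"
    and S2: "- (shifted \<Psi> x $ 2) = \<i> * of_real h * b' - (\<i> * p x * \<Psi> x $ 1 - z * \<Psi> x $ 2)"
    by (simp_all add: shifted_def dirac_expr_components[OF a b])
  have "shifted \<Psi> x = \<Phi> x \<longleftrightarrow> shifted \<Psi> x $ 1 = \<Phi> x $ 1 \<and> - (shifted \<Psi> x $ 2) = - (\<Phi> x $ 2)"
    by (simp add: vec_eq_iff forall_2)
  then show ?thesis
    unfolding S1 S2 solve src1_def src2_def by (simp add: algebra_simps add_divide_distrib diff_divide_distrib)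
qed

lemma domain_sol:
  assumes "\<Psi> \<in> dirac_domain h p q"
  shows "sol (src1 (shifted \<Psi>)) (src2 (shifted \<Psi>)) (\<lambda>x. \<Psi> x $ 1) (\<lambda>x. \<Psi> x $ 2)"
    "sq_int (\<lambda>x. \<Psi> x $ 1)" "sq_int (\<lambda>x. \<Psi> x $ 2)" "shifted \<Psi> \<in> L2_C2"
proof -
  have ac: "ac_loc (\<lambda>x. \<Psi> x $ j)" for j using assms by (simp add: dirac_domain_def AC_loc_iff)
  show sq: "sq_int (\<lambda>x. \<Psi> x $ 1)" "sq_int (\<lambda>x. \<Psi> x $ 2)"
    using assms by (auto simp: dirac_domain_def L2_C2_components)
  have "sq_int (\<lambda>x. dirac_expr h p q \<Psi> x $ 1)" "sq_int (\<lambda>x. dirac_expr h p q \<Psi> x $ 2)"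
    using assms by (auto simp: dirac_domain_def L2_C2_components)
  from sq_int_add_mult[OF this(1) sq(1), of "- z"] sq_int_add_mult[OF this(2) sq(2), of "- z"]
  show "shifted \<Psi> \<in> L2_C2" unfolding L2_C2_components by (simp add: shifted_def)
  have diff: "AE x in lebesgue. ((\<lambda>x. \<Psi> x $ 1) has_vector_derivative vector_derivative (\<lambda>x. \<Psi> x $ 1) (at x)) (at x)"
    "AE x in lebesgue. ((\<lambda>x. \<Psi> x $ 2) has_vector_derivative vector_derivative (\<lambda>x. \<Psi> x $ 2) (at x)) (at x)"
    by (intro ac_loc_AE_has_vector_derivative ac)+
  show "sol (src1 (shifted \<Psi>)) (src2 (shifted \<Psi>)) (\<lambda>x. \<Psi> x $ 1) (\<lambda>x. \<Psi> x $ 2)"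
    unfolding sol_def
  proof (intro conjI ac)
    show "AE x in lebesgue. ((\<lambda>x. \<Psi> x $ 1) has_vector_derivative
          of_real (1 / h) * (- \<i> * z) * \<Psi> x $ 1 + of_real (1 / h) * q x * \<Psi> x $ 2 + src1 (shifted \<Psi>) x) (at x) \<and>
        ((\<lambda>x. \<Psi> x $ 2) has_vector_derivative
          of_real (1 / h) * p x * \<Psi> x $ 1 + of_real (1 / h) * (\<i> * z) * \<Psi> x $ 2 + src2 (shifted \<Psi>) x) (at x)"
      using diff
    proof eventually_elim
      case (elim x)
      show ?case using pointwise_equation[OF elim, of "shifted \<Psi>"] elim by metis
    qed
  qed
qed

lemma surjective:
  assumes \<Phi>: "\<Phi> \<in> L2_C2"
  shows "\<exists>\<Psi>\<in>dirac_domain h p q. AE_equal (shifted \<Psi>) \<Phi>"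
proof -
  obtain a b where ab: "sol (src1 \<Phi>) (src2 \<Phi>) a b" "sq_int a" "sq_int b"
    using resolvent_exists[OF sq_int_src[OF \<Phi>]] by blast
  define \<Psi> where "\<Psi> x = (vector [a x, b x] :: complex^2)" for x
  have comp: "(\<lambda>x. \<Psi> x $ 1) = a" "(\<lambda>x. \<Psi> x $ 2) = b" by (auto simp: \<Psi>_def)
  have comp': "\<Psi> x $ 1 = a x" "\<Psi> x $ 2 = b x" for x by (auto simp: \<Psi>_def)
  have AE: "AE x in lebesgue. shifted \<Psi> x = \<Phi> x"
  proof -
    have "AE x in lebesgue. (a has_vector_derivative (of_real (1 / h) * (- \<i> * z) * a x + of_real (1 / h) * q x * b x + src1 \<Phi> x)) (at x) \<and>
          (b has_vector_derivative (of_real (1 / h) * p x * a x + of_real (1 / h) * (\<i> * z) * b x + src2 \<Phi> x)) (at x)"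
      using ab(1) by (simp only: sol_def)
    then show ?thesis
    proof eventually_elim
      case (elim x)
      then show ?case using pointwise_equation[of \<Psi> _ x _ \<Phi>] unfolding comp comp' by blast
    qed
  qed
  have L2: "\<Psi> \<in> L2_C2" using ab by (simp add: L2_C2_components comp)
  have ac_ab: "ac_loc a" "ac_loc b" using ab(1) unfolding sol_def by blast+
  have ac: "\<forall>j. (\<lambda>x. \<Psi> x $ j) \<in> AC_loc"
    using ac_ab by (simp add: AC_loc_iff forall_2 comp)
  have "sq_int (\<lambda>x. \<Phi> x $ 1 + z * \<Psi> x $ 1)" "sq_int (\<lambda>x. \<Phi> x $ 2 + z * \<Psi> x $ 2)"
    using \<Phi> L2 by (auto simp: L2_C2_components intro: sq_int_add_mult)
  then have R: "(\<lambda>x. \<Phi> x + z *s \<Psi> x) \<in> L2_C2" by (simp add: L2_C2_components)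
  have eq: "AE x in lebesgue. dirac_expr h p q \<Psi> x = \<Phi> x + z *s \<Psi> x"
    using AE by eventually_elim (simp add: shifted_def algebra_simps)
  have "dirac_expr h p q \<Psi> \<in> L2_C2"
  proof -
    have m: "dirac_expr h p q \<Psi> \<in> borel_measurable lebesgue"
    proof (rule borel_measurable_AE)
      show "(\<lambda>x. \<Phi> x + z *s \<Psi> x) \<in> borel_measurable lebesgue" using R by (simp add: L2_C2_def)
      show "AE x in lebesgue. \<Phi> x + z *s \<Psi> x = dirac_expr h p q \<Psi> x"
        using eq by eventually_elim simp
    qed
    have mR: "(\<lambda>x. (norm (\<Phi> x + z *s \<Psi> x))\<^sup>2) \<in> borel_measurable lebesgue"
      using R by (auto simp: L2_C2_def)
    have mD: "(\<lambda>x. (norm (dirac_expr h p q \<Psi> x))\<^sup>2) \<in> borel_measurable lebesgue"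
      using m by auto
    have "AE x in lebesgue. (norm (dirac_expr h p q \<Psi> x))\<^sup>2 = (norm (\<Phi> x + z *s \<Psi> x))\<^sup>2"
      using eq by eventually_elim simp
    then have "integrable lebesgue (\<lambda>x. (norm (dirac_expr h p q \<Psi> x))\<^sup>2) \<longleftrightarrow>
        integrable lebesgue (\<lambda>x. (norm (\<Phi> x + z *s \<Psi> x))\<^sup>2)"
      by (intro integrable_cong_AE mR mD)
    then show ?thesis using R m by (simp add: L2_C2_def)
  qed
  then have "\<Psi> \<in> dirac_domain h p q" using L2 ac by (simp add: dirac_domain_def)
  then show ?thesis using AE by (auto simp: AE_equal_def)
qed

lemma injective:
  assumes "\<Psi>1 \<in> dirac_domain h p q" "\<Psi>2 \<in> dirac_domain h p q" "AE_equal (shifted \<Psi>1) (shifted \<Psi>2)"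
  shows "AE_equal \<Psi>1 \<Psi>2"
proof -
  note d1 = domain_sol[OF assms(1)] and d2 = domain_sol[OF assms(2)]
  define f where "f x = src1 (shifted \<Psi>1) x + (- 1) * src1 (shifted \<Psi>2) x" for x
  define g where "g x = src2 (shifted \<Psi>1) x + (- 1) * src2 (shifted \<Psi>2) x" for x
  define a where "a x = \<Psi>1 x $ 1 + (- 1) * \<Psi>2 x $ 1" for x
  define b where "b x = \<Psi>1 x $ 2 + (- 1) * \<Psi>2 x $ 2" for x
  have sol: "sol f g a b"
    unfolding f_def g_def a_def b_def by (rule sol_add_mult[OF d1(1) d2(1)])
  have sq: "sq_int f" "sq_int g" "sq_int a" "sq_int b"
    unfolding f_def g_def a_def b_def
    by (intro sq_int_add_mult sq_int_src d1 d2)+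
  have "AE x in lebesgue. sqnorm f g x = 0"
    using assms(3) unfolding AE_equal_def
    by eventually_elim (simp add: sqnorm_def f_def g_def src1_def src2_def)
  then have "(LINT x|lebesgue. sqnorm f g x) = 0" by (rule integral_eq_zero_AE)
  then have "(LINT x|lebesgue. sqnorm a b x) \<le> 0" using resolvent_bound[OF sol sq] by simp
  moreover have "(LINT x|lebesgue. sqnorm a b x) \<ge> 0" by simp
  ultimately have "(LINT x|lebesgue. sqnorm a b x) = 0" by (rule antisym)
  then have "AE x in lebesgue. sqnorm a b x = 0"
    using integral_nonneg_eq_0_iff_AE[OF sqnorm_sq_int(1)[OF sq(3,4)]] by simp
  then show ?thesis
    unfolding AE_equal_def
  proof eventually_elim
    case (elim x)
    then have "a x = 0" "b x = 0" by (auto simp: sqnorm_def add_nonneg_eq_0_iff)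
    then show ?case by (simp add: a_def b_def vec_eq_iff forall_2)
  qed
qed

lemma resolvent_norm_bound:
  assumes "\<Psi> \<in> dirac_domain h p q"
  shows "L2_C2_norm \<Psi> \<le> sqrt (2 * forcing_const / c * (1 / h)\<^sup>2) * L2_C2_norm (shifted \<Psi>)"
proof -
  note d = domain_sol[OF assms]
  have "(LINT x|lebesgue. (norm (\<Psi> x))\<^sup>2) = (LINT x|lebesgue. sqnorm (\<lambda>x. \<Psi> x $ 1) (\<lambda>x. \<Psi> x $ 2) x)"
    by (simp add: sqnorm_def norm_complex2)
  also have "\<dots> \<le> 2 * forcing_const / c * (LINT x|lebesgue. sqnorm (src1 (shifted \<Psi>)) (src2 (shifted \<Psi>)) x)"
    by (rule resolvent_bound[OF d(1) sq_int_src[OF d(4)] d(2,3)])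
  also have "\<dots> = (2 * forcing_const / c * (1 / h)\<^sup>2) * (LINT x|lebesgue. (norm (shifted \<Psi> x))\<^sup>2)"
    unfolding sqnorm_src by simp
  finally show ?thesis
    unfolding L2_C2_norm_def real_sqrt_mult[symmetric] by (rule real_sqrt_le_mono)
qed

lemma not_in_spectrum: "z \<notin> dirac_spectrum h p q"
proof -
  have "z \<in> L2_resolvent_set (dirac_domain h p q) (dirac_expr h p q)"
    unfolding L2_resolvent_set_def Let_def shifted_def[symmetric] mem_Collect_eq
  proof (intro conjI)
    show "\<forall>\<Phi>\<in>L2_C2. \<exists>\<Psi>\<in>dirac_domain h p q. AE_equal (shifted \<Psi>) \<Phi>"
      by (rule ballI) (rule surjective)
    show "\<forall>\<Psi>1\<in>dirac_domain h p q. \<forall>\<Psi>2\<in>dirac_domain h p q.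
        AE_equal (shifted \<Psi>1) (shifted \<Psi>2) \<longrightarrow> AE_equal \<Psi>1 \<Psi>2"
      by (rule ballI, rule ballI, rule impI) (rule injective)
    show "\<exists>K. \<forall>\<Psi>\<in>dirac_domain h p q. L2_C2_norm \<Psi> \<le> K * L2_C2_norm (shifted \<Psi>)"
      by (rule exI, rule ballI) (rule resolvent_norm_bound)
  qed
  then show ?thesis by (simp add: dirac_spectrum_def L2_spectrum_def)
qed

end

section \<open>Energy forms outside the enclosure region\<close>

text \<open>
  Here the form has no mixed term. The diagonal part of the system contributes
  \<open>\<bar>Im z\<bar> * (P * \<bar>a\<bar>\<^sup>2 + Q * \<bar>b\<bar>\<^sup>2)\<close> to half its \<open>h\<close>-scaled derivative, the off-diagonal part at most
  \<open>2 * P * Q * \<bar>a\<bar> * \<bar>b\<bar>\<close>. The weights \<open>P\<close> and \<open>Q\<close> are chosen so that the arithmetic-geometric mean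
  inequality loses nothing more than the factor \<open>sqrt (P * Q)\<close>.
\<close>

lemma strip_definite:
  fixes a b z p q :: complex and h s P Q r :: real
  assumes h: "h > 0" and s: "\<bar>s\<bar> = 1" "s * Im z = \<bar>Im z\<bar>" and p: "norm p \<le> P" and q: "norm q \<le> Q"
    and PQ: "P > 0" "Q > 0" and r: "r = sqrt (P * Q)" "r < \<bar>Im z\<bar>"
  shows "2 * (s * P) * Re (cnj a * (of_real (1 / h) * (- \<i> * z) * a + of_real (1 / h) * q * b))
       - 2 * (s * Q) * Re (cnj b * (of_real (1 / h) * p * a + of_real (1 / h) * (\<i> * z) * b))
     \<ge> 2 / h * (\<bar>Im z\<bar> - r) * min P Q * ((norm a)\<^sup>2 + (norm b)\<^sup>2)"
proof -
  define k where "k = 1 / h"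
  have k: "k > 0" using h by (simp add: k_def)
  define T where "T = s * (P * Re (cnj a * q * b) - Q * Re (cnj b * p * a))"
  have n: "\<bar>Re (cnj x * y * w)\<bar> \<le> norm y * (norm x * norm w)" for x y w :: complex
    using abs_Re_le_cmod[of "cnj x * y * w"] by (simp add: norm_mult ac_simps)
  have "\<bar>T\<bar> = \<bar>P * Re (cnj a * q * b) - Q * Re (cnj b * p * a)\<bar>"
    using s(1) by (simp only: T_def abs_mult mult_1)
  also have "\<dots> \<le> P * \<bar>Re (cnj a * q * b)\<bar> + Q * \<bar>Re (cnj b * p * a)\<bar>"
    using PQ abs_triangle_ineq4[of "P * Re (cnj a * q * b)" "Q * Re (cnj b * p * a)"] by (simp only: abs_mult abs_of_pos)
  also have "\<dots> \<le> P * (Q * (norm a * norm b)) + Q * (P * (norm a * norm b))"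
  proof (intro add_mono mult_left_mono)
    show "\<bar>Re (cnj a * q * b)\<bar> \<le> Q * (norm a * norm b)"
      using n[of a q b] mult_right_mono[OF q, of "norm a * norm b"] by simp
    show "\<bar>Re (cnj b * p * a)\<bar> \<le> P * (norm a * norm b)"
      using n[of b p a] mult_right_mono[OF p, of "norm a * norm b"] by (simp only: mult.commute[of "norm b"]) simp
  qed (use PQ in auto)
  also have "\<dots> = r * (2 * (sqrt P * norm a) * (sqrt Q * norm b))"
  proof -
    have "r * (sqrt P * sqrt Q) = P * Q"
      using PQ by (simp add: r(1) real_sqrt_mult[symmetric])
    then show ?thesis by (simp add: algebra_simps)
  qed
  also have "\<dots> \<le> r * ((sqrt P * norm a)\<^sup>2 + (sqrt Q * norm b)\<^sup>2)"
    using PQ by (intro mult_left_mono sum_squares_bound) (simp add: r(1))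
  also have "\<dots> = r * (P * (norm a)\<^sup>2 + Q * (norm b)\<^sup>2)"
    using PQ by (simp add: power_mult_distrib)
  finally have T: "- T \<le> r * (P * (norm a)\<^sup>2 + Q * (norm b)\<^sup>2)" by linarith
  define W where "W = P * (norm a)\<^sup>2 + Q * (norm b)\<^sup>2"
  define V where "V = min P Q * ((norm a)\<^sup>2 + (norm b)\<^sup>2)"
  have id: "2 * (s * P) * Re (cnj a * (of_real k * (- \<i> * z) * a + of_real k * q * b))
       - 2 * (s * Q) * Re (cnj b * (of_real k * p * a + of_real k * (\<i> * z) * b))
     = 2 * k * (s * Im z * W + T)"
    unfolding T_def W_def cmod_power2 by (simp add: algebra_simps power2_eq_square)
  have "V \<le> W"
    unfolding V_def W_def distrib_left by (intro add_mono mult_right_mono) auto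
  then have "(\<bar>Im z\<bar> - r) * V \<le> (\<bar>Im z\<bar> - r) * W" using r(2) by (intro mult_left_mono) auto
  also have "\<dots> \<le> \<bar>Im z\<bar> * W + T" using T unfolding W_def[symmetric] left_diff_distrib by linarith
  finally have "2 * k * ((\<bar>Im z\<bar> - r) * V) \<le> 2 * k * (\<bar>Im z\<bar> * W + T)"
    using k by (intro mult_left_mono) auto
  moreover have "2 / h * (\<bar>Im z\<bar> - r) * min P Q * ((norm a)\<^sup>2 + (norm b)\<^sup>2) = 2 * k * ((\<bar>Im z\<bar> - r) * V)"
    by (simp add: k_def V_def)
  ultimately show ?thesis unfolding k_def[symmetric] id s(2) by linarith
qed

text \<open>
  The derivatives of \<open>\<bar>a\<bar>\<^sup>2\<close> and \<open>\<bar>b\<bar>\<^sup>2\<close> involve \<open>Im z\<close> and the real parts of \<open>q * cnj (a * cnj b)\<close> and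
  \<open>p * (a * cnj b)\<close>; those of the imaginary parts of the latter involve \<open>Re z\<close> and the same real parts.
  In the combination
  \<open>Im (p * (a * cnj b)) + Im (q * cnj (a * cnj b)) + Re z * (\<bar>b\<bar>\<^sup>2 - \<bar>a\<bar>\<^sup>2)\<close>
  these real parts cancel. What remains is the product \<open>Re z * Im z\<close>, the term with \<open>Im (p * q)\<close> and
  those with \<open>p'\<close> and \<open>q'\<close>. The left-hand side is the derivative
  of \<open>s\<close> times this form along the homogeneous system, with \<open>p'\<close> and \<open>q'\<close> the derivatives of \<open>p\<close>
  and \<open>q\<close>, and \<open>k\<close> in place of \<open>1 / h\<close>.
\<close>

lemma hyperbola_energy_identity:
  fixes a b z p q p' q' :: complex and k s :: real
  shows "2 * (- s * Re z) * Re (cnj a * (of_real k * (- \<i> * z) * a + of_real k * q * b))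
       - 2 * (- s * Re z) * Re (cnj b * (of_real k * p * a + of_real k * (\<i> * z) * b))
       + Re (of_real s * (- \<i>) * (p' - cnj q') * a * cnj b
          + of_real s * (- \<i>) * (p - cnj q) * (of_real k * (- \<i> * z) * a + of_real k * q * b) * cnj b
          + of_real s * (- \<i>) * (p - cnj q) * a * cnj (of_real k * p * a + of_real k * (\<i> * z) * b))
     = s * (Im (p' * (a * cnj b)) + Im (q' * cnj (a * cnj b))
        + k * (Im (p * q) - 2 * Re z * Im z) * ((norm a)\<^sup>2 + (norm b)\<^sup>2))"
  unfolding cmod_power2 by (simp add: algebra_simps power2_eq_square)

lemma hyperbola_definite:
  fixes a b z p q p' q' :: complex and h s P1 Q1 R :: real
  assumes h: "h > 0" and s: "\<bar>s\<bar> = 1" "s * (Re z * Im z) = - \<bar>Im z * Re z\<bar>"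
    and bd: "norm p' \<le> P1" "norm q' \<le> Q1" "norm (cnj p * cnj q - p * q) \<le> R"
  shows "2 * (- s * Re z) * Re (cnj a * (of_real (1 / h) * (- \<i> * z) * a + of_real (1 / h) * q * b))
       - 2 * (- s * Re z) * Re (cnj b * (of_real (1 / h) * p * a + of_real (1 / h) * (\<i> * z) * b))
       + Re (of_real s * (- \<i>) * (p' - cnj q') * a * cnj b
          + of_real s * (- \<i>) * (p - cnj q) * (of_real (1 / h) * (- \<i> * z) * a + of_real (1 / h) * q * b) * cnj b
          + of_real s * (- \<i>) * (p - cnj q) * a * cnj (of_real (1 / h) * p * a + of_real (1 / h) * (\<i> * z) * b))
     \<ge> 2 / h * (\<bar>Im z\<bar> * \<bar>Re z\<bar> - (h / 2 * (P1 + Q1) + 1 / 4 * R)) * ((norm a)\<^sup>2 + (norm b)\<^sup>2)"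
proof -
  define n where "n = (norm a)\<^sup>2 + (norm b)\<^sup>2"
  define k where "k = 1 / h"
  have k: "k > 0" "k * h = 1" using h by (auto simp: k_def)
  define T where "T = Im (p' * (a * cnj b)) + Im (q' * cnj (a * cnj b))"
  have n0: "n \<ge> 0" by (simp add: n_def)
  have w: "norm a * norm b \<le> n"
  proof -
    have "norm a * norm b \<ge> 0" by simp
    then show ?thesis using sum_squares_bound[of "norm a" "norm b"] unfolding n_def by linarith
  qed
  have "P1 \<ge> 0" "Q1 \<ge> 0" using bd norm_ge_zero order_trans by blast+
  have im: "\<bar>Im (u * v)\<bar> \<le> C * n" if "norm u \<le> C" "norm v = norm a * norm b" for u v :: complex and C :: real
  proof -
    have "\<bar>Im (u * v)\<bar> \<le> norm u * (norm a * norm b)"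
      using abs_Im_le_cmod[of "u * v"] that(2) by (simp add: norm_mult)
    also have "\<dots> \<le> C * n"
      using that(1) w by (intro mult_mono) (auto intro: order_trans[OF norm_ge_zero])
    finally show ?thesis .
  qed
  have T: "\<bar>T\<bar> \<le> (P1 + Q1) * n"
    using im[OF bd(1), of "a * cnj b"] im[OF bd(2), of "cnj (a * cnj b)"]
    unfolding T_def distrib_right by (simp only: norm_mult complex_mod_cnj) linarith
  have "cnj p * cnj q - p * q = of_real (- 2 * Im (p * q)) * \<i>"
    by (simp add: complex_eq_iff)
  then have "norm (cnj p * cnj q - p * q) = 2 * \<bar>Im (p * q)\<bar>"
    by (simp only: norm_mult norm_of_real norm_ii abs_mult)
  then have I: "\<bar>Im (p * q)\<bar> \<le> R / 2" using bd(3) by linarith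
  have sT: "\<bar>s * x\<bar> = \<bar>x\<bar>" for x using s(1) by (simp add: abs_mult)
  have "s * (T + k * (Im (p * q) - 2 * Re z * Im z) * n) = s * T + k * ((s * Im (p * q)) - 2 * (s * (Re z * Im z))) * n"
    by (simp add: algebra_simps)
  also have "\<dots> \<ge> - ((P1 + Q1) * n) + k * (- (R / 2) + 2 * \<bar>Im z * Re z\<bar>) * n"
  proof (intro add_mono mult_right_mono mult_left_mono)
    show "- ((P1 + Q1) * n) \<le> s * T" using T sT[of T] by linarith
    show "- (R / 2) + 2 * \<bar>Im z * Re z\<bar> \<le> s * Im (p * q) - 2 * (s * (Re z * Im z))"
      unfolding s(2) using I sT[of "Im (p * q)"] by linarith
  qed (use k n0 in auto)
  also have "- ((P1 + Q1) * n) + k * (- (R / 2) + 2 * \<bar>Im z * Re z\<bar>) * n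
     = 2 * k * (\<bar>Im z\<bar> * \<bar>Re z\<bar> - (h / 2 * (P1 + Q1) + 1 / 4 * R)) * n"
  proof -
    have "2 * k * (\<bar>Im z\<bar> * \<bar>Re z\<bar> - (h / 2 * (P1 + Q1) + 1 / 4 * R)) * n
      = - ((k * h) * (P1 + Q1) * n) + k * (- (R / 2) + 2 * \<bar>Im z * Re z\<bar>) * n"
      by (simp add: abs_mult algebra_simps)
    then show ?thesis unfolding k(2) by simp
  qed
  finally show ?thesis
    unfolding hyperbola_energy_identity k_def[symmetric] T_def[symmetric] n_def[symmetric]
    by (simp add: k_def)
qed

text \<open>
  This provides strictly positive weights for the form even if \<open>p\<close> or \<open>q\<close> vanishes identically.
\<close>

lemma slightly_larger_factors:
  fixes P Q y :: real
  assumes "P \<ge> 0" "Q \<ge> 0" "P * Q < y"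
  shows "\<exists>P' Q'. P \<le> P' \<and> Q \<le> Q' \<and> 0 < P' \<and> 0 < Q' \<and> P' * Q' < y"
proof -
  define e where "e = min 1 ((y - P * Q) / (2 * (P + Q + 1)))"
  have e: "0 < e" "e \<le> 1" using assms by (auto simp: e_def)
  have "e \<le> (y - P * Q) / (2 * (P + Q + 1))" unfolding e_def by (rule min.cobounded2)
  then have "e * (P + Q + 1) \<le> (y - P * Q) / 2" using assms by (simp add: field_simps)
  moreover have "(P + e) * (Q + e) \<le> P * Q + e * (P + Q + 1)"
    using e assms mult_left_mono[of e 1 e] by (simp add: algebra_simps)
  ultimately have "(P + e) * (Q + e) \<le> P * Q + (y - P * Q) / 2" by (meson add_left_mono order_trans)
  also have "\<dots> < y" using assms(3) by (simp add: field_simps)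
  finally have "(P + e) * (Q + e) < y" .
  then show ?thesis using e assms by (intro exI[of _ "P + e"] exI[of _ "Q + e"]) auto
qed

theorem theorem5p1:
  fixes h :: real and p q :: "real \<Rightarrow> complex"
  assumes "h > 0"
    and "\<And>x. p (x + 1) = p x" and "\<And>x. q (x + 1) = q x"
    and "p \<in> AC_loc" and "q \<in> AC_loc"
    and "(\<lambda>x. vector_derivative p (at x)) \<in> Linfty"
    and "(\<lambda>x. vector_derivative q (at x)) \<in> Linfty"
  shows "dirac_spectrum h p q \<subseteq> dirac_Lambda h p q"
proof -
  have ac: "ac_loc p" "ac_loc q" using assms by (auto simp: AC_loc_iff)
  note cont = ac[THEN ac_loc_continuous_on]
  obtain Mp Mq where Mp: "\<And>x. norm (p x) \<le> Mp" and Mq: "\<And>x. norm (q x) \<le> Mq"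
    using periodic_continuous_bounded[OF assms(2) cont(1)] periodic_continuous_bounded[OF assms(3) cont(2)] by blast
  have M0: "Mp \<ge> 0" "Mq \<ge> 0" using Mp[of 0] Mq[of 0] norm_ge_zero order_trans by blast+
  have pq: "p \<in> Linfty" "q \<in> Linfty" by (rule bounded_continuous_Linfty[OF cont(1) Mp] bounded_continuous_Linfty[OF cont(2) Mq])+
  have pqI: "(\<lambda>x. cnj (p x) * cnj (q x) - p x * q x) \<in> Linfty"
  proof (rule bounded_continuous_Linfty)
    show "continuous_on UNIV (\<lambda>x. cnj (p x) * cnj (q x) - p x * q x)" by (intro continuous_intros cont)
    show "norm (cnj (p x) * cnj (q x) - p x * q x) \<le> Mp * Mq + Mp * Mq" for x
    proof -
      have "norm (p x) * norm (q x) \<le> Mp * Mq" by (intro mult_mono Mp Mq M0) auto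
      then show ?thesis
        using norm_triangle_ineq4[of "cnj (p x) * cnj (q x)" "p x * q x"] by (simp add: norm_mult)
    qed
  qed
  note bounds = Linfty_norm_bound[OF pq(1)] Linfty_norm_bound[OF pq(2)]
  note dbounds = Linfty_norm_bound[OF assms(6)] Linfty_norm_bound[OF assms(7)] Linfty_norm_bound[OF pqI]
  have "z \<notin> dirac_spectrum h p q" if z: "z \<notin> dirac_Lambda h p q" for z
  proof -
    define K0 where "K0 = (norm z + Mp + Mq) / h"
    have sys: "planar_system (\<lambda>x. of_real (1 / h) * (- \<i> * z)) (\<lambda>x. of_real (1 / h) * q x)
        (\<lambda>x. of_real (1 / h) * p x) (\<lambda>x. of_real (1 / h) * (\<i> * z)) K0"
    proof
      show "continuous_on UNIV (\<lambda>x. of_real (1 / h) * q x)" "continuous_on UNIV (\<lambda>x. of_real (1 / h) * p x)"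
        by (intro continuous_intros cont)+
      have sc: "norm (of_real (1 / h) * w) \<le> K0" if "norm w \<le> norm z + Mp + Mq" for w :: complex
        using that \<open>h > 0\<close> by (simp add: K0_def norm_mult norm_divide divide_right_mono)
      show "norm (of_real (1 / h) * (- \<i> * z)) \<le> K0" "norm (of_real (1 / h) * q x) \<le> K0"
        "norm (of_real (1 / h) * p x) \<le> K0" "norm (of_real (1 / h) * (\<i> * z)) \<le> K0" for x
      proof -
        have "norm (- \<i> * z) = norm z" "norm (\<i> * z) = norm z" by (simp_all add: norm_mult)
        moreover have "norm (q x) \<le> norm z + Mp + Mq" "norm (p x) \<le> norm z + Mp + Mq"
          using M0 Mp[of x] Mq[of x] norm_ge_zero[of z] by linarith+
        ultimately show "norm (of_real (1 / h) * (- \<i> * z)) \<le> K0" "norm (of_real (1 / h) * (\<i> * z)) \<le> K0"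
          "norm (of_real (1 / h) * q x) \<le> K0" "norm (of_real (1 / h) * p x) \<le> K0"
          using M0 by (auto intro!: sc simp del: of_real_divide mult_minus_left)
      qed
    qed (intro continuous_intros)+
    consider (strip) "\<bar>Im z\<bar> > sqrt (Linfty_norm p * Linfty_norm q)"
      | (hyp) "\<bar>Im z\<bar> * \<bar>Re z\<bar> > dirac_C h p q"
      using z by (auto simp: dirac_Lambda_def)
    then show ?thesis
    proof cases
      case strip
      have "Linfty_norm p * Linfty_norm q < (Im z)\<^sup>2"
        using strip bounds(2,4) by (metis abs_ge_zero power2_abs real_less_rsqrt real_sqrt_less_iff real_sqrt_unique)
      then obtain P Q where PQ: "Linfty_norm p \<le> P" "Linfty_norm q \<le> Q" "0 < P" "0 < Q" "P * Q < (Im z)\<^sup>2"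
        using slightly_larger_factors[OF bounds(2,4)] by blast
      define r where "r = sqrt (P * Q)"
      have r: "r < \<bar>Im z\<bar>"
        unfolding r_def using PQ(5) real_sqrt_less_mono[OF PQ(5)] by simp
      \<comment> \<open>With this sign the energy increases along homogeneous solutions.\<close>
      define s where "s = (if Im z \<ge> 0 then 1 else - 1 :: real)"
      have s: "\<bar>s\<bar> = 1" "s * Im z = \<bar>Im z\<bar>" by (auto simp: s_def)
      interpret dirac_system h z p q K0 "s * P" "s * Q" "\<lambda>_. 0" "\<lambda>_. 0" 0 "2 / h * (\<bar>Im z\<bar> - r) * min P Q"
      proof (intro dirac_system.intro lyapunov_system.intro sys lyapunov_system_axioms.intro dirac_system_axioms.intro)
        show "s * P * (s * Q) > 0" using PQ s(1) by (auto simp: s_def)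
        show "0 < 2 / h * (\<bar>Im z\<bar> - r) * min P Q" using \<open>h > 0\<close> r PQ by simp
        show "AE x in lebesgue. \<forall>a b. 2 / h * (\<bar>Im z\<bar> - r) * min P Q * ((norm a)\<^sup>2 + (norm b)\<^sup>2)
          \<le> 2 * (s * P) * Re (cnj a * (of_real (1 / h) * (- \<i> * z) * a + of_real (1 / h) * q x * b))
           - 2 * (s * Q) * Re (cnj b * (of_real (1 / h) * p x * a + of_real (1 / h) * (\<i> * z) * b))
           + Re (0 * a * cnj b + 0 * (of_real (1 / h) * (- \<i> * z) * a + of_real (1 / h) * q x * b) * cnj b
             + 0 * a * cnj (of_real (1 / h) * p x * a + of_real (1 / h) * (\<i> * z) * b))"
          using bounds(1,3)
        proof eventually_elim
          case (elim x)
          have "norm (p x) \<le> P" "norm (q x) \<le> Q" using elim PQ by auto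
          from strip_definite[OF \<open>h > 0\<close> s this PQ(3,4) r_def r] show ?case by simp
        qed
      qed (simp_all add: ac_loc_const has_vector_derivative_const \<open>h > 0\<close>)
      show ?thesis by (rule not_in_spectrum)
    next
      case hyp
      define C where "C = dirac_C h p q"
      have C: "C = h / 2 * (Linfty_norm (\<lambda>x. vector_derivative p (at x)) + Linfty_norm (\<lambda>x. vector_derivative q (at x)))
         + 1 / 4 * Linfty_norm (\<lambda>x. cnj (p x) * cnj (q x) - p x * q x)" by (simp add: C_def dirac_C_def)
      have "C \<ge> 0" unfolding C using dbounds(2,4,6) \<open>h > 0\<close> by simp
      then have nz: "Re z \<noteq> 0" using hyp by (auto simp: C_def)
      \<comment> \<open>With this sign the energy increases along homogeneous solutions.\<close>
      define s where "s = (if Re z * Im z \<ge> 0 then - 1 else 1 :: real)"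
      have s: "\<bar>s\<bar> = 1" "s * (Re z * Im z) = - \<bar>Im z * Re z\<bar>" by (auto simp: s_def mult.commute)
      define m where "m x = of_real s * (- \<i>) * (p x - cnj (q x))" for x
      define m' where "m' x = of_real s * (- \<i>) * (vector_derivative p (at x) - cnj (vector_derivative q (at x)))" for x
      interpret dirac_system h z p q K0 "- s * Re z" "- s * Re z" m m' "Mp + Mq" "2 / h * (\<bar>Im z\<bar> * \<bar>Re z\<bar> - C)"
      proof (intro dirac_system.intro lyapunov_system.intro sys lyapunov_system_axioms.intro dirac_system_axioms.intro)
        have "s \<noteq> 0" by (auto simp: s_def)
        then have "- s * Re z \<noteq> 0" using nz by simp
        then show "- s * Re z * (- s * Re z) > 0" using not_real_square_gt_zero by blast
        show "0 < 2 / h * (\<bar>Im z\<bar> * \<bar>Re z\<bar> - C)" using \<open>h > 0\<close> hyp by (simp add: C_def)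
        show "ac_loc m" unfolding m_def[abs_def] by (intro ac_loc_mult ac_loc_const ac_loc_diff ac_loc_cnj ac)
        show "norm (m x) \<le> Mp + Mq" for x
        proof -
          have "norm (m x) = norm (p x - cnj (q x))" using s(1) by (simp add: m_def norm_mult)
          also have "\<dots> \<le> norm (p x) + norm (q x)" using norm_triangle_ineq4[of "p x" "cnj (q x)"] by simp
          finally show ?thesis using Mp[of x] Mq[of x] by simp
        qed
        have "AE x in lebesgue. (p has_vector_derivative vector_derivative p (at x)) (at x)"
          "AE x in lebesgue. (q has_vector_derivative vector_derivative q (at x)) (at x)"
          by (intro ac_loc_AE_has_vector_derivative ac)+
        then show "AE x in lebesgue. (m has_vector_derivative m' x) (at x)"
        proof eventually_elim
          case (elim x)
          then show ?case unfolding m_def[abs_def] m'_def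
            by (intro has_vector_derivative_mult_right has_vector_derivative_diff
                bounded_linear.has_vector_derivative[OF bounded_linear_cnj])
        qed
        show "AE x in lebesgue. \<forall>a b. 2 / h * (\<bar>Im z\<bar> * \<bar>Re z\<bar> - C) * ((norm a)\<^sup>2 + (norm b)\<^sup>2)
          \<le> 2 * (- s * Re z) * Re (cnj a * (of_real (1 / h) * (- \<i> * z) * a + of_real (1 / h) * q x * b))
           - 2 * (- s * Re z) * Re (cnj b * (of_real (1 / h) * p x * a + of_real (1 / h) * (\<i> * z) * b))
           + Re (m' x * a * cnj b + m x * (of_real (1 / h) * (- \<i> * z) * a + of_real (1 / h) * q x * b) * cnj b
             + m x * a * cnj (of_real (1 / h) * p x * a + of_real (1 / h) * (\<i> * z) * b))"
          using dbounds(1,3,5)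
        proof eventually_elim
          case (elim x)
          show ?case
            unfolding m_def m'_def C
            by (intro allI hyperbola_definite[OF \<open>h > 0\<close> s elim])
        qed
      qed fact
      show ?thesis by (rule not_in_spectrum)
    qed
  qed
  then show ?thesis by blast
qed

end
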